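(* For every $\nu\ge 0$, the operator $\mathcal{A}-\nu I$ (with domain $D(\mathcal{A})$) generates a $C_0$-semigroup $\{T_{\mathcal{A}-\nu I}(t)\}_{t\ge 0}$ on $\mathcal{X}$. Moreover, this semigroup satisfies: (i) for every $u_0\in\mathcal{X}$, the map $t\mapsto T_{\mathcal{A}-\nu I}(t)u_0$ belongs to $\mathcal{C}([0,\infty),\mathcal{X})\cap \mathcal{C}^1((0,\infty),\mathcal{X})$; (ii) $\|T_{\mathcal{A}-\nu I}(t)u_0\|_{\mathcal{X}^\infty}\le \|u_0\|_{\mathcal{X}^\infty}$ for all $t\ge 0$ and all $u_0\in\mathcal{X}^\infty$, whence $\{T_{\mathcal{A}-\nu I}(t)\}_{t\ge 0}\subset\mathcal{L}(\mathcal{X}^\infty)$; (iii) $T_{\mathcal{A}-\nu I}(t)u_0\in\mathcal{X}_\varepsilon$ for all $t\ge 0$, all $\varepsilon\ge 0$ and all $u_0\in\mathcal{X}_\varepsilon$ (in particular, taking $\varepsilon=0$, the semigroup is positive).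
   Context: Let $H>0$, $m>0$, $m_p>0$ be constants. $\mathcal{X}=L^2(0,H)\times L^2(0,H)\times\mathbb{R}$ (real-valued functions), with norm $\|(n,p,z)\|_{\mathcal{X}}=\|n\|_{L^2(0,H)}+\|p\|_{L^2(0,H)}+|z|$ and scalar product $\langle (n_1,p_1,z_1),(n_2,p_2,z_2)\rangle_{\mathcal{X}}=\langle n_1,n_2\rangle_{L^2(0,H)}+\langle p_1,p_2\rangle_{L^2(0,H)}+z_1z_2$. $\mathcal{X}_+$ is the positive cone of $\mathcal{X}$, i.e. the set of $(n,p,z)\in\mathcal{X}$ with $n\ge0$ a.e., $p\ge 0$ a.e., $z\ge 0$. For $\varepsilon\ge0$, $\mathcal{X}_\varepsilon=\{(n,p,z)\in\mathcal{X}:(n+\varepsilon\mathbf{1}_{[0,H]},p,z)\in\mathcal{X}_+\}$. $\mathcal{X}^\infty=L^\infty(0,H)\times L^\infty(0,H)\times\mathbb{R}\subset\mathcal{X}$, with norm $\|(n,p,z)\|_{\mathcal{X}^\infty}=\|n\|_{L^\infty(0,H)}+\|p\|_{L^\infty(0,H)}+|z|$. $\mathcal{L}(\mathcal{X}^\infty)$ is the space of bounded linear operators on $\mathcal{X}^\infty$. The linear operator $\mathcal{A}:D(\mathcal{A})\subset\mathcal{X}\to\mathcal{X}$ is $\mathcal{A}(n,p,z)=(n'',\;p''-m_p p,\;-mz)$ with domain $D(\mathcal{A})=\{(n,p,z)\in H^2(0,H)\times H^2(0,H)\times\mathbb{R}: n'(0)=n(H)=p'(0)=p'(H)=0\}$,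 where $'$ denotes the derivative with respect to $h\in[0,H]$. *)

theory Defs
  imports
    "HOL-Analysis.Analysis"
    "HOL-Library.Function_Algebras"
    "HOL-Probability.Essential_Supremum"
begin

text \<open>Function spaces are represented by everywhere defined functions, without passing to
  the quotient by almost everywhere equality. The norms below are therefore seminorms, and
  equality in the quotient space reads \<open>N (u - v) = 0\<close>.\<close>

instantiation "fun" :: (type, real_vector) real_vector
begin

definition scaleR_fun :: "real \<Rightarrow> ('a \<Rightarrow> 'b) \<Rightarrow> 'a \<Rightarrow> 'b" where
  "scaleR_fun c f = (\<lambda>x. c *\<^sub>R f x)"

instance
  by standard (auto simp: scaleR_fun_def fun_eq_iff scaleR_add_right scaleR_add_left)

end

lemma scaleR_fun_apply [simp]: "(c *\<^sub>R f) x = c *\<^sub>R f x"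
  by (simp add: scaleR_fun_def)

definition L2_space :: "'a measure \<Rightarrow> ('a \<Rightarrow> real) set" where
  "L2_space M = {f \<in> borel_measurable M. integrable M (\<lambda>x. (f x)\<^sup>2)}"

definition L2_norm :: "'a measure \<Rightarrow> ('a \<Rightarrow> real) \<Rightarrow> real" where
  "L2_norm M f = sqrt (\<integral>x. (f x)\<^sup>2 \<partial>M)"

definition Linf_space :: "'a measure \<Rightarrow> ('a \<Rightarrow> real) set" where
  "Linf_space M = {f \<in> borel_measurable M. esssup M (\<lambda>x. ereal \<bar>f x\<bar>) < \<infinity>}"

definition Linf_norm :: "'a measure \<Rightarrow> ('a \<Rightarrow> real) \<Rightarrow> real" where
  "Linf_norm M f = real_of_ereal (esssup M (\<lambda>x. ereal \<bar>f x\<bar>))"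

abbreviation leb :: "real \<Rightarrow> real measure" where
  "leb H \<equiv> lebesgue_on {0<..<H}"

definition test_function :: "real \<Rightarrow> (real \<Rightarrow> real) \<Rightarrow> bool" where
  "test_function H \<phi> \<longleftrightarrow>
     (\<forall>k x. (deriv ^^ k) \<phi> field_differentiable at x) \<and>
     compact (closure {x. \<phi> x \<noteq> 0}) \<and> closure {x. \<phi> x \<noteq> 0} \<subseteq> {0<..<H}"

definition has_weak_deriv :: "real \<Rightarrow> (real \<Rightarrow> real) \<Rightarrow> (real \<Rightarrow> real) \<Rightarrow> bool" where
  "has_weak_deriv H f g \<longleftrightarrow> f \<in> L2_space (leb H) \<and> g \<in> L2_space (leb H) \<and>
     (\<forall>\<phi>. test_function H \<phi> \<longrightarrow>
        (\<integral>x. f x * deriv \<phi> x \<partial>leb H) = - (\<integral>x. g x * \<phi> x \<partial>leb H))"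

definition H1_space :: "real \<Rightarrow> (real \<Rightarrow> real) set" where
  "H1_space H = {f. \<exists>g. has_weak_deriv H f g}"

text \<open>A representative of the weak derivative, which is unique up to null sets.\<close>

definition wderiv :: "real \<Rightarrow> (real \<Rightarrow> real) \<Rightarrow> real \<Rightarrow> real" where
  "wderiv H f = (SOME g. has_weak_deriv H f g)"

definition H2_space :: "real \<Rightarrow> (real \<Rightarrow> real) set" where
  "H2_space H = {f \<in> H1_space H. wderiv H f \<in> H1_space H}"

text \<open>Point values on \<open>[0,H]\<close> are those of the continuous representative.\<close>

definition has_trace :: "real \<Rightarrow> (real \<Rightarrow> real) \<Rightarrow> real \<Rightarrow> real \<Rightarrow> bool" where
  "has_trace H f a y \<longleftrightarrow>
     (\<exists>c. continuous_on {0..H} c \<and> (AE x in leb H. f x = c x) \<and> c a = y)"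

text \<open>Below, \<open>S\<close> is a subspace carrying the seminorm \<open>N\<close>; linearity and the semigroup laws
  hold modulo \<open>N\<close>-null elements.\<close>

definition bounded_op :: "'a::real_vector set \<Rightarrow> ('a \<Rightarrow> real) \<Rightarrow> ('a \<Rightarrow> 'a) \<Rightarrow> bool" where
  "bounded_op S N A \<longleftrightarrow>
     (\<forall>u\<in>S. A u \<in> S) \<and>
     (\<forall>u\<in>S. \<forall>v\<in>S. N (A (u + v) - (A u + A v)) = 0) \<and>
     (\<forall>c. \<forall>u\<in>S. N (A (c *\<^sub>R u) - c *\<^sub>R A u) = 0) \<and>
     (\<exists>C. \<forall>u\<in>S. N (A u) \<le> C * N u)"

definition C0_semigroup ::
  "'a::real_vector set \<Rightarrow> ('a \<Rightarrow> real) \<Rightarrow> (real \<Rightarrow> 'a \<Rightarrow> 'a) \<Rightarrow> bool" where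
  "C0_semigroup S N T \<longleftrightarrow>
     (\<forall>t\<ge>0. bounded_op S N (T t)) \<and>
     (\<forall>u\<in>S. N (T 0 u - u) = 0) \<and>
     (\<forall>s\<ge>0. \<forall>t\<ge>0. \<forall>u\<in>S. N (T (s + t) u - T s (T t u)) = 0) \<and>
     (\<forall>u\<in>S. ((\<lambda>t. N (T t u - u)) \<longlongrightarrow> 0) (at_right 0))"

definition generator ::
  "'a::real_vector set \<Rightarrow> ('a \<Rightarrow> real) \<Rightarrow> (real \<Rightarrow> 'a \<Rightarrow> 'a) \<Rightarrow> ('a \<times> 'a) set" where
  "generator S N T =
     {(u, v). u \<in> S \<and> v \<in> S \<and>
        ((\<lambda>t. N ((1 / t) *\<^sub>R (T t u - u) - v)) \<longlongrightarrow> 0) (at_right 0)}"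

definition generates ::
  "'a::real_vector set \<Rightarrow> ('a \<Rightarrow> real) \<Rightarrow> 'a set \<Rightarrow> ('a \<Rightarrow> 'a) \<Rightarrow> (real \<Rightarrow> 'a \<Rightarrow> 'a) \<Rightarrow> bool" where
  "generates S N D A T \<longleftrightarrow>
     C0_semigroup S N T \<and>
     generator S N T = {(u, v). u \<in> D \<and> v \<in> S \<and> N (v - A u) = 0}"

definition C0_curve ::
  "'a::real_vector set \<Rightarrow> ('a \<Rightarrow> real) \<Rightarrow> real set \<Rightarrow> (real \<Rightarrow> 'a) \<Rightarrow> bool" where
  "C0_curve S N J f \<longleftrightarrow>
     (\<forall>t\<in>J. f t \<in> S \<and> ((\<lambda>s. N (f s - f t)) \<longlongrightarrow> 0) (at t within J))"

definition C1_curve ::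
  "'a::real_vector set \<Rightarrow> ('a \<Rightarrow> real) \<Rightarrow> real set \<Rightarrow> (real \<Rightarrow> 'a) \<Rightarrow> bool" where
  "C1_curve S N J f \<longleftrightarrow> C0_curve S N J f \<and>
     (\<exists>f'. C0_curve S N J f' \<and>
        (\<forall>t\<in>J. ((\<lambda>s. N ((1 / (s - t)) *\<^sub>R (f s - f t) - f' t)) \<longlongrightarrow> 0) (at t within J)))"

type_synonym state = "(real \<Rightarrow> real) \<times> (real \<Rightarrow> real) \<times> real"

definition X_space :: "real \<Rightarrow> state set" where
  "X_space H = L2_space (leb H) \<times> L2_space (leb H) \<times> UNIV"

definition X_norm :: "real \<Rightarrow> state \<Rightarrow> real" where
  "X_norm H = (\<lambda>(n, p, z). L2_norm (leb H) n + L2_norm (leb H) p + \<bar>z\<bar>)"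

definition Xinf_space :: "real \<Rightarrow> state set" where
  "Xinf_space H = Linf_space (leb H) \<times> Linf_space (leb H) \<times> UNIV"

definition Xinf_norm :: "real \<Rightarrow> state \<Rightarrow> real" where
  "Xinf_norm H = (\<lambda>(n, p, z). Linf_norm (leb H) n + Linf_norm (leb H) p + \<bar>z\<bar>)"

definition X_plus :: "real \<Rightarrow> state set" where
  "X_plus H = {(n, p, z) \<in> X_space H.
     (AE h in leb H. 0 \<le> n h) \<and> (AE h in leb H. 0 \<le> p h) \<and> 0 \<le> z}"

definition X_eps :: "real \<Rightarrow> real \<Rightarrow> state set" where
  "X_eps H \<epsilon> = {(n, p, z) \<in> X_space H. (n + \<epsilon> *\<^sub>R indicator {0..H}, p, z) \<in> X_plus H}"

definition A_dom :: "real \<Rightarrow> state set" where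
  "A_dom H = {(n, p, z). n \<in> H2_space H \<and> p \<in> H2_space H \<and>
     has_trace H (wderiv H n) 0 0 \<and> has_trace H n H 0 \<and>
     has_trace H (wderiv H p) 0 0 \<and> has_trace H (wderiv H p) H 0}"

definition A_op :: "real \<Rightarrow> real \<Rightarrow> real \<Rightarrow> state \<Rightarrow> state" where
  "A_op H m m\<^sub>p = (\<lambda>(n, p, z).
     (wderiv H (wderiv H n), wderiv H (wderiv H p) - m\<^sub>p *\<^sub>R p, - m * z))"

end

theory Submission
  imports Defs
begin

text \<open>The three components of the state do not interact. The third one decays exponentially; the other two
  are governed by \<open>u'' - \<kappa> u\<close> on \<open>(0,H)\<close> with a Neumann condition at \<open>0\<close> and, at \<open>H\<close>, a Dirichlet
  condition for the first and a Neumann condition for the second. A flag \<open>d\<close> for the condition at \<open>H\<close> and the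
  rate \<open>\<kappa>\<close> cover both, including the shift by \<open>\<nu>\<close>.

  Such an operator is diagonal in an orthonormal system of cosines, with eigenvalues \<open>- lam k\<close>. By
  Parseval's identity (\<open>parseval\<close>) square integrable functions are square summable sequences of
  coefficients, and the semigroup multiplies the coefficients by \<open>exp (- lam k * t)\<close>. The semigroup law and
  the contraction property can be read off. Strong continuity, continuous differentiability for positive
  times and the generator all amount to the convergence of bounded multipliers, one coefficient at a time
  (\<open>spectral_convergence\<close>). The generator turns out to be multiplication by \<open>- lam k\<close> with its maximal domain
  (\<open>generator_coef\<close>).

  That this domain is the space of twice weakly differentiable functions with the prescribed traces is not a
  statement about coefficients. Functions with a weak derivative are the indefinite integrals, by the
  lemma of du Bois-Reymond (\<open>du_Bois_Reymond\<close>), so that the domain consists of twofold indefinite integrals of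
  square integrable functions with a condition at \<open>H\<close> (\<open>laplace_domD\<close>, \<open>laplace_domI\<close>), and integration by
  parts computes their coefficients (\<open>coef_second_derivative\<close>).

  Nor does order show in the coefficients. Here the exponential formula helps: the semigroup is the strong
  limit of powers of resolvents. A resolvent has an explicit nonnegative Green kernel, and the normalised kernel
  has mass at most one, so it preserves every lower bound \<open>l \<le> 0\<close>. The semigroup inherits this
  (\<open>heat_ge\<close>). With \<open>l = 0\<close> and \<open>l = - \<epsilon>\<close> this is positivity and the invariance of the shifted
  cone; applied to \<open>f\<close> and \<open>- f\<close> it is the contraction property for the essential supremum.\<close>

section \<open>Square integrable functions\<close>

definition L2_inner :: "'a measure \<Rightarrow> ('a \<Rightarrow> real) \<Rightarrow> ('a \<Rightarrow> real) \<Rightarrow> real" where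
  "L2_inner M f g = (\<integral>x. f x * g x \<partial>M)"

lemma L2_measurable: "f \<in> L2_space M \<Longrightarrow> f \<in> borel_measurable M"
  by (simp add: L2_space_def)

lemma L2_mult_integrable:
  assumes "f \<in> L2_space M" "g \<in> L2_space M"
  shows "integrable M (\<lambda>x. f x * g x)"
proof (rule Bochner_Integration.integrable_bound[where f = "\<lambda>x. (f x)\<^sup>2 + (g x)\<^sup>2"])
  show "integrable M (\<lambda>x. (f x)\<^sup>2 + (g x)\<^sup>2)"
    using assms by (simp add: L2_space_def)
  show "(\<lambda>x. f x * g x) \<in> borel_measurable M"
    using assms by (intro borel_measurable_times L2_measurable)
  have "\<bar>a * b\<bar> \<le> a\<^sup>2 + b\<^sup>2" for a b :: real
  proof -
    have "0 \<le> (\<bar>a\<bar> - \<bar>b\<bar>)\<^sup>2 + \<bar>a\<bar>\<^sup>2 + \<bar>b\<bar>\<^sup>2" by simp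
    then have "0 \<le> 2 * (\<bar>a\<bar>\<^sup>2 + \<bar>b\<bar>\<^sup>2 - \<bar>a\<bar> * \<bar>b\<bar>)" by (simp add: power2_diff algebra_simps)
    then show ?thesis by (simp add: abs_mult)
  qed
  then show "AE x in M. norm (f x * g x) \<le> norm ((f x)\<^sup>2 + (g x)\<^sup>2)"
    by simp
qed

lemma L2_bound:
  assumes "f \<in> borel_measurable M" "w \<in> L2_space M" "AE x in M. \<bar>f x\<bar> \<le> \<bar>w x\<bar>"
  shows "f \<in> L2_space M"
proof -
  have "integrable M (\<lambda>x. (w x)\<^sup>2)" using assms by (simp add: L2_space_def)
  then have "integrable M (\<lambda>x. (f x)\<^sup>2)"
    by (rule Bochner_Integration.integrable_bound)
       (use assms in \<open>auto elim!: eventually_mono simp: abs_le_square_iff\<close>)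
  then show ?thesis using assms by (simp add: L2_space_def)
qed

lemma subspace_L2: "subspace (L2_space M)"
proof (rule subspaceI)
  show "0 \<in> L2_space M" by (simp add: L2_space_def zero_fun_def)
next
  fix f g assume fg: "f \<in> L2_space M" "g \<in> L2_space M"
  have "integrable M (\<lambda>x. (f x)\<^sup>2 + 2 * (f x * g x) + (g x)\<^sup>2)"
    using fg L2_mult_integrable[OF fg] by (simp add: L2_space_def)
  moreover have "(\<lambda>x. f x + g x) \<in> borel_measurable M"
    using fg by (intro borel_measurable_add L2_measurable)
  ultimately show "f + g \<in> L2_space M"
    by (simp add: L2_space_def power2_sum plus_fun_def mult.assoc add.commute add.left_commute)
next
  fix c f assume "f \<in> L2_space M"
  moreover from this have "(\<lambda>x. c * f x) \<in> borel_measurable M"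
    by (intro borel_measurable_times borel_measurable_const L2_measurable)
  ultimately show "c *\<^sub>R f \<in> L2_space M"
    by (simp add: L2_space_def scaleR_fun_def power_mult_distrib)
qed

lemmas L2_add = subspace_add[OF subspace_L2]
  and L2_diff = subspace_diff[OF subspace_L2]
  and L2_scaleR = subspace_scale[OF subspace_L2]
  and L2_0 = subspace_0[OF subspace_L2]

lemma L2_inner_commute: "L2_inner M f g = L2_inner M g f"
  by (simp add: L2_inner_def mult.commute)

lemma L2_inner_add:
  assumes "f \<in> L2_space M" "g \<in> L2_space M" "h \<in> L2_space M"
  shows "L2_inner M (f + g) h = L2_inner M f h + L2_inner M g h"
  using L2_mult_integrable[OF assms(1,3)] L2_mult_integrable[OF assms(2,3)]
  by (simp add: L2_inner_def algebra_simps)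

lemma L2_inner_diff:
  assumes "f \<in> L2_space M" "g \<in> L2_space M" "h \<in> L2_space M"
  shows "L2_inner M (f - g) h = L2_inner M f h - L2_inner M g h"
  using L2_mult_integrable[OF assms(1,3)] L2_mult_integrable[OF assms(2,3)]
  by (simp add: L2_inner_def algebra_simps)

lemma L2_inner_scaleR: "L2_inner M (c *\<^sub>R f) h = c * L2_inner M f h"
  by (simp add: L2_inner_def mult.assoc)

lemma L2_inner_add_right:
  assumes "f \<in> L2_space M" "g \<in> L2_space M" "h \<in> L2_space M"
  shows "L2_inner M h (f + g) = L2_inner M h f + L2_inner M h g"
  using L2_inner_add[OF assms] by (simp add: L2_inner_def mult.commute)

lemma L2_inner_diff_right:
  assumes "f \<in> L2_space M" "g \<in> L2_space M" "h \<in> L2_space M"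
  shows "L2_inner M h (f - g) = L2_inner M h f - L2_inner M h g"
  using L2_inner_diff[OF assms] by (simp add: L2_inner_def mult.commute)

lemma L2_inner_scaleR_right: "L2_inner M h (c *\<^sub>R f) = c * L2_inner M h f"
  by (metis L2_inner_commute L2_inner_scaleR)

lemma L2_inner_cong_AE:
  assumes "f \<in> borel_measurable M" "g \<in> borel_measurable M" "h \<in> borel_measurable M"
    and "AE x in M. f x = g x"
  shows "L2_inner M f h = L2_inner M g h"
  unfolding L2_inner_def
  by (rule integral_cong_AE) (use assms in \<open>auto elim: eventually_mono\<close>)

lemma L2_norm_nonneg [simp]: "0 \<le> L2_norm M f"
  by (simp add: L2_norm_def)

lemma L2_norm_power2: "(L2_norm M f)\<^sup>2 = L2_inner M f f"
  by (simp add: L2_norm_def L2_inner_def power2_eq_square)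

lemma L2_norm_eq: "L2_norm M f = sqrt (L2_inner M f f)"
  by (simp add: L2_norm_def L2_inner_def power2_eq_square)

lemma L2_inner_self_nonneg [simp]: "0 \<le> L2_inner M f f"
  using L2_norm_power2[of M f] by (metis zero_le_power2)

lemma L2_norm_scaleR [simp]: "L2_norm M (c *\<^sub>R f) = \<bar>c\<bar> * L2_norm M f"
proof -
  have "L2_inner M (c *\<^sub>R f) (c *\<^sub>R f) = c\<^sup>2 * L2_inner M f f"
    by (simp add: L2_inner_scaleR L2_inner_scaleR_right power2_eq_square)
  then show ?thesis by (simp add: L2_norm_eq real_sqrt_mult)
qed

lemma L2_norm_minus_commute: "L2_norm M (f - g) = L2_norm M (g - f)"
  using L2_norm_scaleR[of M "-1" "g - f"] by simp

lemma L2_Cauchy_Schwarz: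
  assumes f: "f \<in> L2_space M" and g: "g \<in> L2_space M"
  shows "\<bar>L2_inner M f g\<bar> \<le> L2_norm M f * L2_norm M g"
proof -
  let ?ip = "L2_inner M"
  have q: "0 \<le> ?ip f f - 2 * t * ?ip f g + t\<^sup>2 * ?ip g g" for t
  proof -
    have tg: "t *\<^sub>R g \<in> L2_space M" by (rule L2_scaleR[OF g])
    have "0 \<le> ?ip (f - t *\<^sub>R g) (f - t *\<^sub>R g)" by simp
    also have "\<dots> = ?ip f f - 2 * t * ?ip f g + t\<^sup>2 * ?ip g g"
      using L2_inner_commute[of M g f]
      by (simp add: L2_inner_diff L2_inner_diff_right L2_inner_scaleR L2_inner_scaleR_right
          f g tg L2_diff power2_eq_square algebra_simps)
    finally show ?thesis .
  qed
  have "(?ip f g)\<^sup>2 \<le> ?ip f f * ?ip g g"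
  proof (cases "?ip g g = 0")
    case True
    have "?ip f g = 0"
    proof (rule ccontr)
      assume n: "?ip f g \<noteq> 0"
      from q[of "(?ip f f + 1) / (2 * ?ip f g)"] show False
        using n True by (simp add: field_simps)
    qed
    then show ?thesis by simp
  next
    case False
    then have p: "?ip g g > 0" using L2_inner_self_nonneg[of M g] by linarith
    from q[of "?ip f g / ?ip g g"] show ?thesis
      using p by (simp add: field_simps power2_eq_square)
  qed
  then have "sqrt ((?ip f g)\<^sup>2) \<le> sqrt (?ip f f * ?ip g g)" by (rule real_sqrt_le_mono)
  then show ?thesis by (simp add: L2_norm_eq real_sqrt_mult)
qed

lemma L2_norm_add_power2:
  assumes f: "f \<in> L2_space M" and g: "g \<in> L2_space M"
  shows "(L2_norm M (f + g))\<^sup>2 = (L2_norm M f)\<^sup>2 + 2 * L2_inner M f g + (L2_norm M g)\<^sup>2"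
  using L2_inner_commute[of M g f]
  by (simp add: L2_norm_power2 L2_inner_add L2_inner_add_right L2_add f g)

lemma L2_norm_diff_power2:
  assumes f: "f \<in> L2_space M" and g: "g \<in> L2_space M"
  shows "(L2_norm M (f - g))\<^sup>2 = (L2_norm M f)\<^sup>2 - 2 * L2_inner M f g + (L2_norm M g)\<^sup>2"
  using L2_inner_commute[of M g f]
  by (simp add: L2_norm_power2 L2_inner_diff L2_inner_diff_right L2_diff f g)

lemma L2_norm_triangle:
  assumes f: "f \<in> L2_space M" and g: "g \<in> L2_space M"
  shows "L2_norm M (f + g) \<le> L2_norm M f + L2_norm M g"
proof (rule power2_le_imp_le)
  show "(L2_norm M (f + g))\<^sup>2 \<le> (L2_norm M f + L2_norm M g)\<^sup>2"
    using L2_Cauchy_Schwarz[OF f g] by (simp add: L2_norm_add_power2[OF f g] power2_sum)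
qed simp

lemma L2_norm_triangle_diff:
  assumes "f \<in> L2_space M" "g \<in> L2_space M" "h \<in> L2_space M"
  shows "L2_norm M (f - h) \<le> L2_norm M (f - g) + L2_norm M (g - h)"
  using L2_norm_triangle[OF L2_diff[OF assms(1,2)] L2_diff[OF assms(2,3)]] by simp

lemma L2_norm_eq_0_iff:
  assumes "f \<in> L2_space M"
  shows "L2_norm M f = 0 \<longleftrightarrow> (AE x in M. f x = 0)"
proof -
  have "(\<integral>x. (f x)\<^sup>2 \<partial>M) = 0 \<longleftrightarrow> (AE x in M. (f x)\<^sup>2 = 0)"
    using assms by (intro integral_nonneg_eq_0_iff_AE) (auto simp: L2_space_def)
  then show ?thesis by (simp add: L2_norm_def)
qed

lemma L2_norm_mono:
  assumes "f \<in> borel_measurable M" "w \<in> L2_space M" "AE x in M. \<bar>f x\<bar> \<le> \<bar>w x\<bar>"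
  shows "L2_norm M f \<le> L2_norm M w"
proof -
  have f: "f \<in> L2_space M" by (rule L2_bound[OF assms])
  have "(\<integral>x. (f x)\<^sup>2 \<partial>M) \<le> (\<integral>x. (w x)\<^sup>2 \<partial>M)"
    by (rule integral_mono_AE)
       (use f assms in \<open>auto elim!: eventually_mono simp: L2_space_def abs_le_square_iff\<close>)
  then show ?thesis by (simp add: L2_norm_def)
qed

lemma L2_dominated_convergence:
  fixes s :: "nat \<Rightarrow> 'a \<Rightarrow> real"
  assumes f: "f \<in> borel_measurable M" and s: "\<And>n. s n \<in> borel_measurable M"
    and w: "w \<in> L2_space M" and b: "\<And>n. AE x in M. \<bar>s n x\<bar> \<le> w x"
    and lim: "AE x in M. (\<lambda>n. s n x) \<longlonglongrightarrow> f x"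
  shows "f \<in> L2_space M" "\<And>n. s n \<in> L2_space M" "(\<lambda>n. L2_norm M (s n - f)) \<longlonglongrightarrow> 0"
proof -
  have "AE x in M. \<forall>n. \<bar>s n x\<bar> \<le> w x" using b by (simp add: AE_all_countable)
  with lim have fb: "AE x in M. \<bar>f x\<bar> \<le> w x"
  proof eventually_elim
    case (elim x)
    then have "(\<lambda>n. \<bar>s n x\<bar>) \<longlonglongrightarrow> \<bar>f x\<bar>" by (intro tendsto_rabs) auto
    then show ?case using elim by (intro LIMSEQ_le_const2) auto
  qed
  show "f \<in> L2_space M" by (rule L2_bound[OF f w]) (use fb in \<open>auto elim: eventually_mono\<close>)
  show "s n \<in> L2_space M" for n
    by (rule L2_bound[OF s w]) (use b[of n] in \<open>auto elim: eventually_mono\<close>)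
  have "(\<lambda>n. \<integral>x. (s n x - f x)\<^sup>2 \<partial>M) \<longlonglongrightarrow> (\<integral>x. 0 \<partial>M)"
  proof (rule integral_dominated_convergence[where w = "\<lambda>x. 4 * (w x)\<^sup>2"])
    show "integrable M (\<lambda>x. 4 * (w x)\<^sup>2)" using w by (simp add: L2_space_def)
    show "AE x in M. (\<lambda>n. (s n x - f x)\<^sup>2) \<longlonglongrightarrow> 0"
      using lim
    proof eventually_elim
      case (elim x)
      then have "(\<lambda>n. (s n x - f x)\<^sup>2) \<longlonglongrightarrow> (f x - f x)\<^sup>2" by (intro tendsto_intros)
      then show ?case by simp
    qed
    show "AE x in M. norm ((s n x - f x)\<^sup>2) \<le> 4 * (w x)\<^sup>2" for n
      using b[of n] fb
    proof eventually_elim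
      case (elim x)
      then have "\<bar>s n x - f x\<bar> \<le> \<bar>2 * w x\<bar>" by linarith
      then have "(s n x - f x)\<^sup>2 \<le> (2 * w x)\<^sup>2" by (simp only: abs_le_square_iff)
      then show ?case by (simp add: power_mult_distrib)
    qed
  qed (use f s in auto)
  then have "(\<lambda>n. sqrt (\<integral>x. (s n x - f x)\<^sup>2 \<partial>M)) \<longlonglongrightarrow> sqrt 0"
    by (intro tendsto_real_sqrt) simp
  then show "(\<lambda>n. L2_norm M (s n - f)) \<longlonglongrightarrow> 0" by (simp add: L2_norm_def)
qed

text \<open>The defect \<open>max 0 (l - f)\<close> is dominated by \<open>\<bar>u n - f\<bar>\<close> for every \<open>n\<close>, so its norm
  vanishes.\<close>

lemma L2_limit_ge:
  assumes u: "\<And>n. u n \<in> L2_space M" and f: "f \<in> L2_space M"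
    and lim: "(\<lambda>n::nat. L2_norm M (u n - f)) \<longlonglongrightarrow> 0"
    and ge: "\<And>n. AE x in M. l x \<le> u n x" and l: "l \<in> borel_measurable M"
  shows "AE x in M. l x \<le> f x"
proof -
  define p where "p x = max 0 (l x - f x)" for x
  have p: "p \<in> borel_measurable M"
    using l L2_measurable[OF f] unfolding p_def
    by (intro borel_measurable_max borel_measurable_diff) auto
  have b: "AE x in M. \<bar>p x\<bar> \<le> \<bar>(u n - f) x\<bar>" for n
    using ge[of n] by eventually_elim (auto simp: p_def)
  have d: "u n - f \<in> L2_space M" for n by (rule L2_diff[OF u f])
  have "L2_norm M p \<le> L2_norm M (u n - f)" for n by (rule L2_norm_mono[OF p d b])
  then have "L2_norm M p \<le> 0" by (intro LIMSEQ_le_const[OF lim]) blast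
  then have "L2_norm M p = 0" using L2_norm_nonneg[of M p] by linarith
  then have "AE x in M. p x = 0" using L2_norm_eq_0_iff[OF L2_bound[OF p d b]] by simp
  then show ?thesis by eventually_elim (auto simp: p_def max_def split: if_splits)
qed

section \<open>Density of continuous functions\<close>

lemma finite_measure_leb: "finite_measure (leb H)"
  by (cases "0 \<le> H"; intro finite_measureI) (auto simp: emeasure_restrict_space)

lemma AE_leb_I:
  assumes "negligible N" "\<And>x. 0 < x \<Longrightarrow> x < H \<Longrightarrow> x \<notin> N \<Longrightarrow> P x"
  shows "AE x in leb H. P x"
proof -
  have "N \<in> null_sets lebesgue" using assms by (simp add: negligible_iff_null_sets)
  then have "AE x in lebesgue. x \<notin> N" by (rule AE_not_in)
  then show ?thesis
    by (subst AE_restrict_space_iff) (auto elim!: eventually_mono intro: assms)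
qed

lemma AE_leb_all: "(\<And>x. 0 < x \<Longrightarrow> x < H \<Longrightarrow> P x) \<Longrightarrow> AE x in leb H. P x"
  by (rule AE_leb_I[of "{}"]) auto

lemma measurable_leb_continuous: "continuous_on {0..H} g \<Longrightarrow> g \<in> borel_measurable (leb H)"
  by (rule continuous_imp_measurable_on_sets_lebesgue)
     (auto intro: continuous_on_subset)

lemma L2_const: "(\<lambda>x. c) \<in> L2_space (leb H)"
  using finite_measure.integrable_const[OF finite_measure_leb] by (simp add: L2_space_def)

lemma L2_bounded:
  assumes "g \<in> borel_measurable (leb H)" "AE x in leb H. \<bar>g x\<bar> \<le> B"
  shows "g \<in> L2_space (leb H)"
  by (rule L2_bound[OF assms(1) L2_const[of B]]) (use assms(2) in \<open>auto elim: eventually_mono\<close>)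

lemma L2_continuous:
  assumes "continuous_on {0..H} g"
  shows "g \<in> L2_space (leb H)"
proof -
  have "bounded (g ` {0..H})"
    by (intro compact_imp_bounded compact_continuous_image assms) simp
  then obtain B where "\<forall>x\<in>{0..H}. \<bar>g x\<bar> \<le> B" by (auto simp: bounded_iff)
  then show ?thesis
    by (intro L2_bounded[of _ _ B] measurable_leb_continuous assms AE_leb_all) auto
qed

lemma L2_norm_bounded:
  assumes H: "H > 0" and g: "g \<in> borel_measurable (leb H)" and b: "AE x in leb H. \<bar>g x\<bar> \<le> B"
  shows "L2_norm (leb H) g \<le> \<bar>B\<bar> * sqrt H"
proof -
  have "L2_norm (leb H) g \<le> L2_norm (leb H) (\<lambda>x. B)"
    by (rule L2_norm_mono[OF g L2_const]) (use b in \<open>auto elim: eventually_mono\<close>)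
  also have "\<dots> = \<bar>B\<bar> * sqrt H"
    using H by (simp add: L2_norm_def measure_restrict_space real_sqrt_mult)
  finally show ?thesis .
qed

text \<open>A measurable function is almost everywhere a pointwise limit of continuous ones. Truncation
  at height \<open>m\<close> turns this into convergence in the mean: \<open>f\<close> is close to its truncation, and the
  truncated approximants are dominated by the constant \<open>m\<close>.\<close>

lemma L2_continuous_dense:
  assumes f: "f \<in> L2_space (leb H)" and e: "e > 0"
  obtains g where "continuous_on UNIV g" "L2_norm (leb H) (g - f) < e"
proof -
  define f0 where "f0 x = (if x \<in> {0<..<H} then f x else 0)" for x
  define clip :: "nat \<Rightarrow> real \<Rightarrow> real" where "clip m y = max (- real m) (min y (real m))" for m y
  have clip_cont: "continuous_on UNIV (clip m)" for m
    unfolding clip_def by (intro continuous_intros)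
  have clip_meas: "(\<lambda>x. clip m (h x)) \<in> borel_measurable (leb H)"
    if "h \<in> borel_measurable (leb H)" for m h
    using that unfolding clip_def
    by (intro borel_measurable_max borel_measurable_min) auto
  have fm: "f \<in> borel_measurable (leb H)" by (rule L2_measurable[OF f])
  have "f0 \<in> borel_measurable lebesgue"
    using fm unfolding f0_def by (intro borel_measurable_if_I) auto
  then have "f0 measurable_on UNIV" by (rule lebesgue_measurable_imp_measurable_on_real) simp
  then obtain N g where N: "negligible N" and g: "\<And>n. continuous_on UNIV (g n)"
    and lim: "\<And>x. x \<notin> N \<Longrightarrow> (\<lambda>n. g n x) \<longlonglongrightarrow> f0 x"
    unfolding measurable_on_def by auto
  have gm: "g n \<in> borel_measurable (leb H)" for n
    by (rule measurable_leb_continuous) (rule continuous_on_subset[OF g subset_UNIV])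
  have "(\<lambda>m. L2_norm (leb H) ((\<lambda>x. clip m (f x)) - f)) \<longlonglongrightarrow> 0"
  proof (rule L2_dominated_convergence(3)[where w = "\<lambda>x. \<bar>f x\<bar>"])
    show "(\<lambda>x. \<bar>f x\<bar>) \<in> L2_space (leb H)"
      by (rule L2_bound[OF _ f]) (use fm in auto)
    show "AE x in leb H. (\<lambda>m. clip m (f x)) \<longlonglongrightarrow> f x"
    proof (rule AE_leb_all)
      fix x
      obtain m0 where m0: "\<bar>f x\<bar> \<le> real m0" using real_arch_simple by blast
      have "\<forall>\<^sub>F m in sequentially. clip m (f x) = f x"
        using eventually_ge_at_top[of m0] by eventually_elim (use m0 in \<open>auto simp: clip_def\<close>)
      then show "(\<lambda>m. clip m (f x)) \<longlonglongrightarrow> f x" by (rule tendsto_eventually)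
    qed
    show "AE x in leb H. \<bar>clip m (f x)\<bar> \<le> \<bar>f x\<bar>" for m
      by (rule AE_leb_all) (auto simp: clip_def)
  qed (use fm clip_meas in auto)
  from order_tendstoD(2)[OF this, of "e/2"] e
  obtain m where m: "L2_norm (leb H) ((\<lambda>x. clip m (f x)) - f) < e/2"
    by (auto simp: eventually_sequentially)
  have cg: "continuous_on UNIV (\<lambda>x. clip m (g n x))" for n
    using continuous_on_compose2[OF clip_cont g] by simp
  have "(\<lambda>n. L2_norm (leb H) ((\<lambda>x. clip m (g n x)) - (\<lambda>x. clip m (f x)))) \<longlonglongrightarrow> 0"
  proof (rule L2_dominated_convergence(3)[where w = "\<lambda>x. real m"])
    show "AE x in leb H. (\<lambda>n. clip m (g n x)) \<longlonglongrightarrow> clip m (f x)"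
    proof (rule AE_leb_I[OF N])
      fix x assume x: "0 < x" "x < H" "x \<notin> N"
      then have "(\<lambda>n. g n x) \<longlonglongrightarrow> f x" using lim[of x] by (simp add: f0_def)
      then show "(\<lambda>n. clip m (g n x)) \<longlonglongrightarrow> clip m (f x)"
        unfolding clip_def by (intro tendsto_intros)
    qed
    show "AE x in leb H. \<bar>clip m (g n x)\<bar> \<le> real m" for n
      by (rule AE_leb_all) (auto simp: clip_def)
  qed (use fm gm clip_meas L2_const in auto)
  from order_tendstoD(2)[OF this, of "e/2"] e
  obtain n where n: "L2_norm (leb H) ((\<lambda>x. clip m (g n x)) - (\<lambda>x. clip m (f x))) < e/2"
    by (auto simp: eventually_sequentially)
  show thesis
  proof (rule that[OF cg])
    have "(\<lambda>x. clip m (g n x)) \<in> L2_space (leb H)"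
      by (rule L2_continuous) (rule continuous_on_subset[OF cg subset_UNIV])
    moreover have "(\<lambda>x. clip m (f x)) \<in> L2_space (leb H)"
      by (rule L2_bound[OF _ f]) (use clip_meas[OF fm] in \<open>auto simp: clip_def intro!: AE_leb_all\<close>)
    ultimately show "L2_norm (leb H) ((\<lambda>x. clip m (g n x)) - f) < e"
      using L2_norm_triangle_diff[OF _ _ f] m n by fastforce
  qed
qed

lemma L2_continuous_approx:
  assumes f: "f \<in> L2_space (leb H)"
  obtains g where "\<And>n. continuous_on UNIV (g n)" "\<And>n. g n \<in> L2_space (leb H)"
    "(\<lambda>n::nat. L2_norm (leb H) (g n - f)) \<longlonglongrightarrow> 0"
proof -
  have "\<exists>g. continuous_on UNIV g \<and> L2_norm (leb H) (g - f) < inverse (real (Suc n))" for n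
    using L2_continuous_dense[OF f, of "inverse (real (Suc n))"] by auto
  then obtain g where g: "\<And>n. continuous_on UNIV (g n)"
    and n: "\<And>n. L2_norm (leb H) (g n - f) < inverse (real (Suc n))" by metis
  have "(\<lambda>n. L2_norm (leb H) (g n - f)) \<longlonglongrightarrow> 0"
    by (rule real_tendsto_sandwich[OF _ _ tendsto_const LIMSEQ_inverse_real_of_nat])
       (use n in \<open>auto intro!: always_eventually less_imp_le\<close>)
  then show thesis
    using that[of g] g L2_continuous continuous_on_subset by blast
qed

text \<open>Replacing an approximant \<open>g\<close> by \<open>max l g\<close> only brings it closer to a function that is itself
  bounded below by \<open>l\<close>.\<close>

lemma L2_continuous_approx_ge:
  assumes f: "f \<in> L2_space (leb H)" and l: "AE x in leb H. l \<le> f x"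
  obtains g where "\<And>n. continuous_on UNIV (g n)" "\<And>n. g n \<in> L2_space (leb H)"
    "\<And>n x. l \<le> g n x" "(\<lambda>n::nat. L2_norm (leb H) (g n - f)) \<longlonglongrightarrow> 0"
proof -
  obtain g where g: "\<And>n. continuous_on UNIV (g n)" "\<And>n. g n \<in> L2_space (leb H)"
    "(\<lambda>n::nat. L2_norm (leb H) (g n - f)) \<longlonglongrightarrow> 0"
    using L2_continuous_approx[OF f] by blast
  define h where "h n x = max l (g n x)" for n x
  have h: "continuous_on UNIV (h n)" for n unfolding h_def by (intro continuous_intros g)
  have hL: "h n \<in> L2_space (leb H)" for n
    using L2_continuous continuous_on_subset[OF h] by blast
  have le: "L2_norm (leb H) (h n - f) \<le> L2_norm (leb H) (g n - f)" for n
  proof (rule L2_norm_mono)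
    show "AE x in leb H. \<bar>(h n - f) x\<bar> \<le> \<bar>(g n - f) x\<bar>"
      using l by eventually_elim (auto simp: h_def)
  qed (auto intro: L2_measurable L2_diff hL g f)
  have "(\<lambda>n. L2_norm (leb H) (h n - f)) \<longlonglongrightarrow> 0"
    by (rule real_tendsto_sandwich[OF _ _ tendsto_const g(3)]) (auto intro!: always_eventually le)
  then show thesis using that[of h] h hL by (auto simp: h_def)
qed

section \<open>Cosine expansions\<close>

lemma integral_leb:
  fixes g :: "real \<Rightarrow> real"
  assumes "integrable (leb H) g"
  shows "(\<integral>x. g x \<partial>leb H) = integral {0..H} g"
  using lebesgue_integral_eq_integral[OF assms] by (simp add: integral_open_interval_real)

lemma integrable_leb_L2: "f \<in> L2_space (leb H) \<Longrightarrow> integrable (leb H) f"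
  by (rule finite_measure.square_integrable_imp_integrable[OF finite_measure_leb])
     (auto simp: L2_space_def)

lemma leb_FTC:
  assumes H: "0 \<le> H"
    and G: "\<And>x. 0 \<le> x \<Longrightarrow> x \<le> H \<Longrightarrow> (G has_real_derivative g x) (at x within {0..H})"
    and g: "continuous_on {0..H} g"
  shows "(\<integral>x. g x \<partial>leb H) = G H - G 0"
proof -
  have "(g has_integral G H - G 0) {0..H}"
    using H G by (intro fundamental_theorem_of_calculus)
      (auto simp: has_real_derivative_iff_has_vector_derivative[symmetric])
  then show ?thesis
    using integral_leb[OF integrable_leb_L2[OF L2_continuous[OF g]]] by (simp add: integral_unique)
qed

lemma integral_leb_cos:
  assumes H: "H > 0"
  shows "(\<integral>x. cos (real_of_int i * pi / H * x) \<partial>leb H) = (if i = 0 then H else 0)"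
proof (cases "i = 0")
  case True
  then show ?thesis using H by (simp add: measure_restrict_space)
next
  case False
  define a where "a = real_of_int i * pi / H"
  have a: "a \<noteq> 0" using False H by (simp add: a_def)
  have "(\<integral>x. cos (a * x) \<partial>leb H) = sin (a * H) / a - sin (a * 0) / a"
    using H a by (intro leb_FTC) (auto intro!: derivative_eq_intros continuous_intros)
  moreover have "sin (a * H) = 0" using H by (simp add: a_def sin_times_pi_eq_0)
  ultimately show ?thesis using False by (simp add: a_def)
qed

text \<open>The two boundary value problems on \<open>(0,H)\<close> share the Neumann condition at \<open>0\<close> and differ at \<open>H\<close>:
  a Dirichlet condition if \<open>d\<close> holds, a Neumann condition otherwise.\<close>

locale mixed_problem =
  fixes H :: real and d :: bool
  assumes H_pos: "H > 0"
begin

abbreviation L2 :: "(real \<Rightarrow> real) set" where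
  "L2 \<equiv> L2_space (leb H)"

abbreviation norm2 :: "(real \<Rightarrow> real) \<Rightarrow> real" where
  "norm2 \<equiv> L2_norm (leb H)"

definition freq :: "nat \<Rightarrow> real" where
  "freq k = (real k + (if d then 1/2 else 0)) * pi / H"

definition cosk :: "nat \<Rightarrow> real \<Rightarrow> real" where
  "cosk k x = cos (freq k * x)"

text \<open>The norm of \<open>cos (freq k x)\<close>; the constant function is the one exceptional case.\<close>

definition cosnorm :: "nat \<Rightarrow> real" where
  "cosnorm k = (if \<not> d \<and> k = 0 then sqrt H else sqrt (H / 2))"

definition eigf :: "nat \<Rightarrow> real \<Rightarrow> real" where
  "eigf k = (1 / cosnorm k) *\<^sub>R cosk k"

definition coef :: "(real \<Rightarrow> real) \<Rightarrow> nat \<Rightarrow> real" where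
  "coef f k = L2_inner (leb H) f (eigf k)"

lemma cosnorm_pos: "cosnorm k > 0"
  using H_pos by (simp add: cosnorm_def)

lemma cosk_continuous: "continuous_on S (cosk k)"
  unfolding cosk_def by (intro continuous_intros)

lemma cosk_L2: "cosk k \<in> L2"
  by (intro L2_continuous cosk_continuous)

lemma eigf_L2: "eigf k \<in> L2"
  unfolding eigf_def by (intro L2_scaleR cosk_L2)

lemma eigf_continuous: "continuous_on S (eigf k)"
  unfolding eigf_def scaleR_fun_def by (intro continuous_intros cosk_continuous)

text \<open>The product of two cosines is half the sum of the cosines of the sum and the difference of the
  frequencies. Both are integral multiples of \<open>pi / H\<close>, also in the Dirichlet case, where the two halves
  add up to one or cancel; such a cosine has mean zero unless its frequency vanishes.\<close>

lemma cosk_inner: "L2_inner (leb H) (cosk j) (cosk k) = (if j = k then (cosnorm k)\<^sup>2 else 0)"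
proof -
  define i1 :: int where "i1 = int j - int k"
  define i2 :: int where "i2 = int j + int k + (if d then 1 else 0)"
  have f1: "freq j - freq k = real_of_int i1 * pi / H"
    using H_pos by (auto simp: freq_def i1_def field_simps)
  have f2: "freq j + freq k = real_of_int i2 * pi / H"
    using H_pos by (auto simp: freq_def i2_def field_simps)
  have "L2_inner (leb H) (cosk j) (cosk k)
      = (\<integral>x. (cos (real_of_int i1 * pi / H * x) + cos (real_of_int i2 * pi / H * x)) / 2 \<partial>leb H)"
    unfolding L2_inner_def cosk_def cos_times_cos f1[symmetric] f2[symmetric]
    by (simp add: algebra_simps)
  also have "\<dots> = ((\<integral>x. cos (real_of_int i1 * pi / H * x) \<partial>leb H)
      + (\<integral>x. cos (real_of_int i2 * pi / H * x) \<partial>leb H)) / 2"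
    by (subst integral_divide_zero, subst Bochner_Integration.integral_add)
       (auto intro!: integrable_leb_L2 L2_continuous continuous_intros
          simp: less_imp_neq[OF H_pos, symmetric])
  also have "\<dots> = (if j = k then (cosnorm k)\<^sup>2 else 0)"
  proof -
    have i1: "i1 = 0 \<longleftrightarrow> j = k" by (simp add: i1_def)
    have i2: "i2 = 0 \<longleftrightarrow> \<not> d \<and> j = 0 \<and> k = 0" by (auto simp: i2_def)
    have n: "(cosnorm k)\<^sup>2 = (if \<not> d \<and> k = 0 then H else H / 2)"
      using less_imp_le[OF H_pos] by (simp add: cosnorm_def)
    show ?thesis unfolding integral_leb_cos[OF H_pos] i1 i2 n by auto
  qed
  finally show ?thesis .
qed

lemma coef_eigf: "coef (eigf j) k = (if j = k then 1 else 0)"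
  using cosnorm_pos[of k]
  by (auto simp: coef_def eigf_def L2_inner_scaleR L2_inner_scaleR_right cosk_inner power2_eq_square)

lemma eigf_norm: "norm2 (eigf k) = 1"
  using coef_eigf[of k k] by (simp add: L2_norm_eq coef_def)

lemma coef_add: "f \<in> L2 \<Longrightarrow> g \<in> L2 \<Longrightarrow> coef (f + g) k = coef f k + coef g k"
  by (simp add: coef_def L2_inner_add eigf_L2)

lemma coef_diff: "f \<in> L2 \<Longrightarrow> g \<in> L2 \<Longrightarrow> coef (f - g) k = coef f k - coef g k"
  by (simp add: coef_def L2_inner_diff eigf_L2)

lemma coef_scaleR: "coef (c *\<^sub>R f) k = c * coef f k"
  by (simp add: coef_def L2_inner_scaleR)

lemma coef_le_norm: "f \<in> L2 \<Longrightarrow> \<bar>coef f k\<bar> \<le> norm2 f"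
  using L2_Cauchy_Schwarz[OF _ eigf_L2, of f k] by (simp add: coef_def eigf_norm)

lemma combination_L2: "(\<Sum>k<n. b k *\<^sub>R eigf k) \<in> L2"
  by (intro subspace_sum[OF subspace_L2] L2_scaleR eigf_L2)

definition partial_sum :: "nat \<Rightarrow> (real \<Rightarrow> real) \<Rightarrow> real \<Rightarrow> real" where
  "partial_sum n f = (\<Sum>k<n. coef f k *\<^sub>R eigf k)"

lemma partial_sum_L2: "partial_sum n f \<in> L2"
  unfolding partial_sum_def by (rule combination_L2)

lemma partial_sum_add:
  "f \<in> L2 \<Longrightarrow> g \<in> L2 \<Longrightarrow>
    partial_sum n (f + g) = partial_sum n f + partial_sum n g"
  by (simp add: partial_sum_def coef_add scaleR_add_left sum.distrib)

lemma partial_sum_diff: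
  "f \<in> L2 \<Longrightarrow> g \<in> L2 \<Longrightarrow>
    partial_sum n (f - g) = partial_sum n f - partial_sum n g"
  by (simp add: partial_sum_def coef_diff scaleR_diff_left sum_subtractf)

lemma partial_sum_scaleR: "partial_sum n (c *\<^sub>R f) = c *\<^sub>R partial_sum n f"
  by (simp add: partial_sum_def coef_scaleR scaleR_sum_right)

lemma coef_combination: "coef (\<Sum>k<n. b k *\<^sub>R eigf k) j = (if j < n then b j else 0)"
proof (induction n)
  case 0
  show ?case by (simp add: coef_def L2_inner_def)
next
  case (Suc n)
  have "coef (\<Sum>k<Suc n. b k *\<^sub>R eigf k) j = coef (\<Sum>k<n. b k *\<^sub>R eigf k) j + b n * coef (eigf n) j"
    unfolding sum.lessThan_Suc coef_add[OF combination_L2 L2_scaleR[OF eigf_L2]] coef_scaleR ..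
  also have "\<dots> = (if j < Suc n then b j else 0)"
    unfolding Suc coef_eigf by (auto simp: less_Suc_eq)
  finally show ?case .
qed

lemma coef_partial_sum: "coef (partial_sum n f) j = (if j < n then coef f j else 0)"
  unfolding partial_sum_def by (rule coef_combination)

lemma residual_norm:
  assumes f: "f \<in> L2"
  shows "(norm2 (f - partial_sum n f))\<^sup>2 = (norm2 f)\<^sup>2 - (\<Sum>k<n. (coef f k)\<^sup>2)"
proof (induction n)
  case 0
  show ?case by (simp add: partial_sum_def)
next
  case (Suc n)
  let ?r = "f - partial_sum n f"
  have r: "?r \<in> L2" by (intro L2_diff f partial_sum_L2)
  have c: "coef ?r n = coef f n"
    by (simp add: coef_diff f partial_sum_L2 coef_partial_sum)
  have eq: "f - partial_sum (Suc n) f = ?r - coef f n *\<^sub>R eigf n"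
    by (simp add: partial_sum_def algebra_simps)
  have "(norm2 (f - partial_sum (Suc n) f))\<^sup>2
      = (norm2 ?r)\<^sup>2 - 2 * (coef f n * coef ?r n) + (coef f n)\<^sup>2"
    unfolding eq L2_norm_diff_power2[OF r L2_scaleR[OF eigf_L2]]
    by (simp add: L2_inner_scaleR_right coef_def eigf_norm)
  also have "\<dots> = (norm2 ?r)\<^sup>2 - (coef f n)\<^sup>2"
    unfolding c by (simp add: power2_eq_square)
  finally show ?case using Suc.IH unfolding sum.lessThan_Suc by linarith
qed

lemma residual_le: "f \<in> L2 \<Longrightarrow> norm2 (f - partial_sum n f) \<le> norm2 f"
  by (rule power2_le_imp_le) (simp_all add: residual_norm sum_nonneg)

definition expandable :: "(real \<Rightarrow> real) set" where
  "expandable = {f \<in> L2. (\<lambda>n. norm2 (f - partial_sum n f)) \<longlonglongrightarrow> 0}"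

text \<open>Subtracting a partial sum is a contraction, so the set of functions that their expansion
  represents is closed.\<close>

lemma expandable_closed:
  assumes f: "f \<in> L2"
    and appr: "\<And>e. e > 0 \<Longrightarrow> \<exists>g\<in>expandable. norm2 (g - f) < e"
  shows "f \<in> expandable"
proof -
  let ?N = norm2
  have "(\<lambda>n. ?N (f - partial_sum n f)) \<longlonglongrightarrow> 0"
  proof (rule LIMSEQ_I)
    fix e :: real assume e: "e > 0"
    obtain g where g: "g \<in> L2" "(\<lambda>n. ?N (g - partial_sum n g)) \<longlonglongrightarrow> 0"
      and gf: "?N (g - f) < e/2"
      using appr[of "e/2"] e by (auto simp: expandable_def)
    from LIMSEQ_D[OF g(2), of "e/2"] e
    obtain n0 where n0: "\<And>n. n \<ge> n0 \<Longrightarrow> ?N (g - partial_sum n g) < e/2" by auto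
    show "\<exists>n0. \<forall>n\<ge>n0. norm (?N (f - partial_sum n f) - 0) < e"
    proof (intro exI allI impI)
      fix n assume "n \<ge> n0"
      let ?h = "f - g"
      have h: "?h \<in> L2" by (rule L2_diff[OF f g(1)])
      have eq: "f - partial_sum n f = (?h - partial_sum n ?h) + (g - partial_sum n g)"
        by (simp add: partial_sum_diff f g(1) algebra_simps)
      have "?N (f - partial_sum n f) \<le> ?N (?h - partial_sum n ?h) + ?N (g - partial_sum n g)"
        unfolding eq by (intro L2_norm_triangle L2_diff h g(1) partial_sum_L2)
      also have "\<dots> \<le> ?N ?h + ?N (g - partial_sum n g)" using residual_le[OF h] by simp
      also have "\<dots> < e" using gf n0[OF \<open>n \<ge> n0\<close>] by (simp add: L2_norm_minus_commute[of _ f g])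
      finally show "norm (?N (f - partial_sum n f) - 0) < e" by simp
    qed
  qed
  then show ?thesis using f by (simp add: expandable_def)
qed

lemma subspace_expandable: "subspace expandable"
proof (rule subspaceI)
  have "partial_sum n 0 = 0" for n
    using partial_sum_scaleR[of n 0 0] by simp
  then show "0 \<in> expandable"
    using L2_0 by (simp add: expandable_def) (simp add: L2_norm_def)
next
  fix f g assume "f \<in> expandable" "g \<in> expandable"
  then have f: "f \<in> L2" and g: "g \<in> L2"
    and l: "(\<lambda>n. norm2 (f - partial_sum n f)) \<longlonglongrightarrow> 0"
      "(\<lambda>n. norm2 (g - partial_sum n g)) \<longlonglongrightarrow> 0"
    by (auto simp: expandable_def)
  have eq: "(f + g) - partial_sum n (f + g) = (f - partial_sum n f) + (g - partial_sum n g)" for n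
    by (simp add: partial_sum_add f g algebra_simps)
  have "(\<lambda>n. norm2 ((f + g) - partial_sum n (f + g))) \<longlonglongrightarrow> 0"
  proof (rule real_tendsto_sandwich[OF _ _ tendsto_const])
    show "\<forall>\<^sub>F n in sequentially. norm2 ((f + g) - partial_sum n (f + g))
      \<le> norm2 (f - partial_sum n f) + norm2 (g - partial_sum n g)"
      unfolding eq
      by (intro always_eventually allI L2_norm_triangle L2_diff f g partial_sum_L2)
    show "(\<lambda>n. norm2 (f - partial_sum n f) + norm2 (g - partial_sum n g)) \<longlonglongrightarrow> 0"
      using tendsto_add[OF l] by simp
  qed (auto intro!: always_eventually)
  then show "f + g \<in> expandable" using f g L2_add by (auto simp: expandable_def)
next
  fix c f assume "f \<in> expandable"
  then have f: "f \<in> L2"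
    and l: "(\<lambda>n. norm2 (f - partial_sum n f)) \<longlonglongrightarrow> 0"
    by (auto simp: expandable_def)
  have "c *\<^sub>R f - partial_sum n (c *\<^sub>R f) = c *\<^sub>R (f - partial_sum n f)" for n
    by (simp add: partial_sum_scaleR scaleR_diff_right)
  then show "c *\<^sub>R f \<in> expandable"
    using f L2_scaleR tendsto_mult_left[OF l, of "\<bar>c\<bar>"] by (auto simp: expandable_def)
qed

lemma span_eigf_expandable: "span (range eigf) \<subseteq> expandable"
proof (rule span_minimal[OF _ subspace_expandable], safe)
  fix k
  have ps: "partial_sum n (eigf k) = eigf k" if "n > k" for n
  proof -
    have "partial_sum n (eigf k) = (\<Sum>j<n. if j = k then eigf k else 0)"
      unfolding partial_sum_def by (rule sum.cong) (auto simp: coef_eigf)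
    also have "\<dots> = eigf k" using that by simp
    finally show ?thesis .
  qed
  have "\<forall>\<^sub>F n in sequentially. norm2 (eigf k - partial_sum n (eigf k)) = 0"
    using eventually_gt_at_top[of k] by eventually_elim (simp add: ps, simp add: L2_norm_def)
  then show "eigf k \<in> expandable"
    by (simp add: expandable_def eigf_L2 tendsto_eventually)
qed

lemma cosk_in_span: "cosk k \<in> span (range eigf)"
proof -
  have "cosk k = cosnorm k *\<^sub>R eigf k" using cosnorm_pos[of k] by (simp add: eigf_def)
  then show ?thesis by (metis rangeI span_base span_scale)
qed

text \<open>Multiplication by \<open>cos (pi x / H)\<close> shifts the index up and down by one. At the lower end
  the index \<open>-1\<close> is reflected: by evenness of the cosine it stands for \<open>0\<close> in the Dirichlet case and
  for \<open>1\<close> in the Neumann case.\<close>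

lemma cos_mult_in_span:
  assumes "g \<in> span (range eigf)"
  shows "(\<lambda>x. cos (pi / H * x) * g x) \<in> span (range eigf)"
  using assms
proof (induction rule: span_induct)
  case base
  show ?case
  proof (rule subspaceI)
    show "0 \<in> {g. (\<lambda>x. cos (pi / H * x) * g x) \<in> span (range eigf)}"
      using span_zero[of "range eigf"] by (simp add: zero_fun_def)
  next
    fix f g assume "f \<in> {g. (\<lambda>x. cos (pi / H * x) * g x) \<in> span (range eigf)}"
      "g \<in> {g. (\<lambda>x. cos (pi / H * x) * g x) \<in> span (range eigf)}"
    then show "f + g \<in> {g. (\<lambda>x. cos (pi / H * x) * g x) \<in> span (range eigf)}"
      using span_add[of "\<lambda>x. cos (pi / H * x) * f x" "range eigf" "\<lambda>x. cos (pi / H * x) * g x"]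
      by (simp add: plus_fun_def distrib_left)
  next
    fix c f assume "f \<in> {g. (\<lambda>x. cos (pi / H * x) * g x) \<in> span (range eigf)}"
    then show "c *\<^sub>R f \<in> {g. (\<lambda>x. cos (pi / H * x) * g x) \<in> span (range eigf)}"
      using span_scale[of "\<lambda>x. cos (pi / H * x) * f x" "range eigf" c]
      by (simp add: scaleR_fun_def mult.left_commute)
  qed
next
  case (step g)
  then obtain k where g: "g = eigf k" by auto
  obtain j where j: "\<And>x. cos ((freq k - pi / H) * x) = cosk j x"
  proof (cases k)
    case 0
    show thesis
    proof (rule that[of "if d then 0 else 1"])
      fix x
      have "cos ((freq k - pi / H) * x) = cos (- ((freq k - pi / H) * x))" by (rule cos_minus[symmetric])
      also have "- ((freq k - pi / H) * x) = freq (if d then 0 else 1) * x"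
        using H_pos 0 by (simp add: freq_def field_simps)
      finally show "cos ((freq k - pi / H) * x) = cosk (if d then 0 else 1) x" by (simp add: cosk_def)
    qed
  next
    case (Suc j)
    show thesis
    proof (rule that[of j])
      have "freq k - pi / H = freq j"
        using H_pos Suc by (simp add: freq_def field_simps)
      then show "cos ((freq k - pi / H) * x) = cosk j x" for x by (simp add: cosk_def)
    qed
  qed
  have s: "freq k + pi / H = freq (Suc k)" using H_pos by (simp add: freq_def field_simps)
  have E: "cos (pi / H * x) * cosk k x = (cosk j x + cosk (Suc k) x) / 2" for x

  proof -
    have "cosk j x = cos (freq k * x - pi / H * x)" by (simp add: j[symmetric] left_diff_distrib)
    moreover have "cosk (Suc k) x = cos (freq k * x + pi / H * x)"
      by (simp add: cosk_def s[symmetric] distrib_right)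
    ultimately show ?thesis
      using cos_times_cos[of "freq k * x" "pi / H * x"]
      by (simp add: cosk_def mult.commute)
  qed
  have "1 / cosnorm k * (cos (pi / H * x) * cosk k x)
      = 1 / (2 * cosnorm k) * (cosk j x + cosk (Suc k) x)" for x
    by (simp only: E) simp
  then have "cos (pi / H * x) * (1 / cosnorm k * cosk k x)
      = 1 / (2 * cosnorm k) * (cosk j x + cosk (Suc k) x)" for x
    by (simp only: mult.left_commute[of "cos _"])
  then have "(\<lambda>x. cos (pi / H * x) * g x) = (1 / (2 * cosnorm k)) *\<^sub>R (cosk j + cosk (Suc k))"
    by (simp only: g eigf_def fun_eq_iff scaleR_fun_apply plus_fun_apply real_scaleR_def simp_thms)
  then show ?case by (simp add: span_scale span_add cosk_in_span)
qed

text \<open>The eigenfunctions are, up to factors, polynomials in \<open>cos (pi x / H)\<close> times the first one.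
  The form below therefore lets the Weierstrass theorem, in the variable \<open>cos (pi x / H)\<close>, treat both
  boundary conditions at once.\<close>

lemma cos_poly_expandable:
  assumes "real_polynomial_function p"
  shows "(\<lambda>x. p (cos (pi / H * x)) * cosk 0 x) \<in> expandable"
proof -
  obtain a n where p: "p = (\<lambda>x. \<Sum>i\<le>n. a i * x ^ i)"
    using assms real_polynomial_function_iff_sum by auto
  have pow: "(\<lambda>x. cos (pi / H * x) ^ i * cosk 0 x) \<in> span (range eigf)" for i
  proof (induction i)
    case 0
    show ?case using cosk_in_span[of 0] by simp
  next
    case (Suc i)
    from cos_mult_in_span[OF this] show ?case by (simp add: mult.assoc)
  qed
  have "(\<Sum>i\<le>n. a i *\<^sub>R (\<lambda>x. cos (pi / H * x) ^ i * cosk 0 x)) \<in> span (range eigf)"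
    by (intro span_sum span_scale pow)
  moreover have "(\<Sum>i\<le>n. a i *\<^sub>R (\<lambda>x. cos (pi / H * x) ^ i * cosk 0 x))
      = (\<lambda>x. \<Sum>i\<le>n. a i * (cos (pi / H * x) ^ i * cosk 0 x))"
    by (induction n) (auto simp: fun_eq_iff)
  ultimately have "(\<lambda>x. p (cos (pi / H * x)) * cosk 0 x) \<in> span (range eigf)"
    by (simp add: p sum_distrib_right mult.assoc)
  then show ?thesis using span_eigf_expandable by blast
qed

lemma cosk0_le1: "\<bar>cosk 0 x\<bar> \<le> 1"
  by (simp add: cosk_def)

text \<open>Completeness of the cosines. The first eigenfunction \<open>cosk 0\<close> is positive on \<open>(0,H)\<close> but vanishes at
  \<open>H\<close> in the Dirichlet case. So \<open>f\<close> is first cut off near \<open>H\<close>; the quotient by \<open>cosk 0\<close> is then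
  square integrable, and is approximated by a continuous function and that one by a polynomial in
  \<open>cos (pi x / H)\<close>. Multiplying back by \<open>cosk 0\<close>, which is at most one, does not increase the error.\<close>

lemma expandable_all:
  assumes f: "f \<in> L2"
  shows "f \<in> expandable"
proof (rule expandable_closed[OF f])
  fix e :: real assume e: "e > 0"
  let ?N = "norm2" and ?c = "\<lambda>n. H - 1 / real (Suc n)"
  define fn where "fn n x = (if x < ?c n then f x else 0)" for n x
  have fm: "f \<in> borel_measurable (leb H)" by (rule L2_measurable[OF f])
  have ind: "indicator {..< ?c n} \<in> borel_measurable (leb H)" for n
    by (intro measurable_restrict_space1 borel_measurable_indicator) simp
  have fn_eq: "fn n = (\<lambda>x. indicator {..< ?c n} x * f x)" for n
    by (auto simp: fn_def fun_eq_iff)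
  have fnm: "fn n \<in> borel_measurable (leb H)" for n
    unfolding fn_eq using ind fm by (rule borel_measurable_times)
  have abs_f: "(\<lambda>x. \<bar>f x\<bar>) \<in> L2"
    by (rule L2_bound[OF _ f]) (use fm in auto)
  have lim: "(\<lambda>n. ?N (fn n - f)) \<longlonglongrightarrow> 0"
  proof (rule L2_dominated_convergence(3)[OF fm fnm abs_f])
    show "AE x in leb H. (\<lambda>n. fn n x) \<longlonglongrightarrow> f x"
    proof (rule AE_leb_all)
      fix x assume "x < H"
      then have "\<forall>\<^sub>F n in sequentially. 1 / real (Suc n) < H - x"
        using order_tendstoD(2)[OF LIMSEQ_inverse_real_of_nat, of "H - x"]
        by (simp add: inverse_eq_divide)
      then have "\<forall>\<^sub>F n in sequentially. fn n x = f x"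
        by eventually_elim (auto simp: fn_def)
      then show "(\<lambda>n. fn n x) \<longlonglongrightarrow> f x" by (rule tendsto_eventually)
    qed
  qed (auto simp: fn_def intro!: AE_leb_all)
  from order_tendstoD(2)[OF lim, of "e/3"] e
  obtain n where n: "?N (fn n - f) < e/3" by (auto simp: eventually_sequentially)
  have fnL: "fn n \<in> L2"
    by (rule L2_bound[OF fnm f]) (auto simp: fn_def intro!: AE_leb_all)
  define w where "w x = fn n x / cosk 0 x" for x
  \<comment> \<open>the minimum of the decreasing function \<open>cosk 0\<close> on the part of the interval left after the cut\<close>
  define \<delta> where "\<delta> = cosk 0 (?c n)"
  have f0: "0 \<le> freq 0" "freq 0 * H \<le> pi / 2"
    using H_pos by (auto simp: freq_def)
  have d_pos: "0 < \<delta> \<and> \<delta> \<le> cosk 0 x" if "0 < x" "x < ?c n" for x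
  proof -
    have c: "0 < ?c n" "?c n < H" using that by auto
    have a: "freq 0 * x \<le> freq 0 * ?c n" using that f0 by (intro mult_left_mono) auto
    have b: "freq 0 * ?c n < pi / 2"
    proof (cases "freq 0 = 0")
      case False
      then have "freq 0 * ?c n < freq 0 * H" using c f0 by (intro mult_strict_left_mono) auto
      then show ?thesis using f0 by linarith
    qed simp
    have "0 \<le> freq 0 * x" using that f0 by simp
    then show ?thesis unfolding \<delta>_def cosk_def
      using a b pi_gt_zero by (intro conjI cos_gt_zero_pi cos_monotone_0_pi_le) linarith+
  qed
  have c0m: "cosk 0 \<in> borel_measurable (leb H)" by (rule L2_measurable[OF cosk_L2])
  have wm: "w \<in> borel_measurable (leb H)"
    unfolding w_def using fnm c0m by (intro borel_measurable_divide) auto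
  have wL: "w \<in> L2"
  proof (rule L2_bound[OF wm L2_scaleR[OF f, of "inverse \<delta>"]], rule AE_leb_all)
    fix x assume x: "0 < x" "x < H"
    show "\<bar>w x\<bar> \<le> \<bar>(inverse \<delta> *\<^sub>R f) x\<bar>"
    proof (cases "x < ?c n")
      case True
      then have "0 < \<delta>" "\<delta> \<le> cosk 0 x" using d_pos x by auto
      then show ?thesis using True
        using mult_left_mono[OF le_imp_inverse_le, of \<delta> "cosk 0 x" "\<bar>f x\<bar>"]
        by (auto simp: w_def fn_def abs_mult divide_inverse mult.commute)
    qed (simp add: w_def fn_def)
  qed
  obtain g where g: "continuous_on UNIV g" "?N (g - w) < e/3"
    using L2_continuous_dense[OF wL, of "e/3"] e by auto
  \<comment> \<open>a uniform error \<open>e'\<close> costs at most \<open>e' * sqrt H\<close> in the mean\<close>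
  define e' where "e' = e / (3 * sqrt H)"
  have e': "e' > 0" using e H_pos by (simp add: e'_def)
  have "continuous_on {-1..1} (\<lambda>y. H / pi * arccos y)"
    by (intro continuous_intros continuous_on_arccos) auto
  then have "continuous_on {-1..1} (\<lambda>y. g (H / pi * arccos y))"
    by (rule continuous_on_compose2[OF g(1)]) auto
  then obtain p where p: "real_polynomial_function p"
    and pg: "\<And>y. y \<in> {-1..1} \<Longrightarrow> \<bar>g (H / pi * arccos y) - p y\<bar> < e'"
    using Stone_Weierstrass_real_polynomial_function[of "{-1..1}" _ e'] e' by auto
  define P where "P x = p (cos (pi / H * x))" for x
  have Pc: "continuous_on {0..H} P"
    unfolding P_def using continuous_on_polymonial_function[OF p[unfolded real_polynomial_function_eq]]
    by (rule continuous_on_compose2[where t = UNIV]) (auto intro!: continuous_intros simp: less_imp_neq[OF H_pos, symmetric])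
  have PL: "P \<in> L2" by (rule L2_continuous[OF Pc])
  have gL: "g \<in> L2" by (rule L2_continuous) (rule continuous_on_subset[OF g(1) subset_UNIV])
  have "?N (P - g) \<le> \<bar>e'\<bar> * sqrt H"
  proof (rule L2_norm_bounded[OF H_pos])
    show "P - g \<in> borel_measurable (leb H)" by (intro L2_measurable L2_diff PL gL)
    show "AE x in leb H. \<bar>(P - g) x\<bar> \<le> e'"
    proof (rule AE_leb_all)
      fix x assume x: "0 < x" "x < H"
      have "arccos (cos (pi / H * x)) = pi / H * x"
        using x H_pos by (intro arccos_cos) (auto simp: field_simps)
      then have "H / pi * arccos (cos (pi / H * x)) = x" using H_pos by simp
      then show "\<bar>(P - g) x\<bar> \<le> e'"
        using pg[of "cos (pi / H * x)"] by (simp add: P_def abs_minus_commute)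
    qed
  qed
  also have "\<dots> = e/3" using e e' H_pos by (simp add: e'_def)
  finally have Pg: "?N (P - g) \<le> e/3" .
  define q where "q x = P x * cosk 0 x" for x
  have q: "q \<in> expandable" unfolding q_def P_def by (rule cos_poly_expandable[OF p])
  have qL: "q \<in> L2" using q by (simp add: expandable_def)
  have "?N (q - fn n) \<le> ?N (P - w)"
  proof (rule L2_norm_mono, intro L2_measurable L2_diff qL fnL, intro L2_diff PL wL, rule AE_leb_all)
    fix x assume x: "0 < x" "x < H"
    have "fn n x = w x * cosk 0 x"
      using d_pos[of x] x by (cases "x < ?c n") (auto simp: w_def fn_def)
    then have "\<bar>(q - fn n) x\<bar> = \<bar>P x - w x\<bar> * \<bar>cosk 0 x\<bar>"
      by (simp add: q_def abs_mult[symmetric] algebra_simps)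
    also have "\<dots> \<le> \<bar>P x - w x\<bar> * 1" using cosk0_le1 by (intro mult_left_mono) auto
    finally show "\<bar>(q - fn n) x\<bar> \<le> \<bar>(P - w) x\<bar>" by simp
  qed
  also have "\<dots> \<le> ?N (P - g) + ?N (g - w)" by (rule L2_norm_triangle_diff[OF PL gL wL])
  finally have "?N (q - fn n) < e/3 + e/3" using Pg g(2) by linarith
  then have "?N (q - f) < e"
    using L2_norm_triangle_diff[OF qL fnL f] n by linarith
  then show "\<exists>g\<in>expandable. ?N (g - f) < e" using q by blast
qed

lemma parseval:
  assumes f: "f \<in> L2"
  shows "(\<lambda>k. (coef f k)\<^sup>2) sums (norm2 f)\<^sup>2"
proof -
  have "(\<lambda>n. norm2 (f - partial_sum n f)) \<longlonglongrightarrow> 0"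
    using expandable_all[OF f] by (simp add: expandable_def)
  from tendsto_diff[OF tendsto_const tendsto_power[OF this, of 2]]
  have "(\<lambda>n. (norm2 f)\<^sup>2 - (norm2 (f - partial_sum n f))\<^sup>2)
      \<longlonglongrightarrow> (norm2 f)\<^sup>2 - 0\<^sup>2" .
  moreover have "(\<lambda>n. (norm2 f)\<^sup>2 - (norm2 (f - partial_sum n f))\<^sup>2)
      = (\<lambda>n. \<Sum>k<n. (coef f k)\<^sup>2)"
  proof
    show "(norm2 f)\<^sup>2 - (norm2 (f - partial_sum n f))\<^sup>2
        = (\<Sum>k<n. (coef f k)\<^sup>2)" for n
      using residual_norm[OF f, of n] by linarith
  qed
  ultimately show ?thesis by (simp add: sums_def)
qed

lemma L2_norm_eq_0_coef:
  assumes "f \<in> L2" "\<And>k. coef f k = 0"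
  shows "norm2 f = 0"
  using parseval[OF assms(1)] assms(2) by (simp add: sums_iff)

lemma coef_eq_imp_AE:
  assumes f: "f \<in> L2" and g: "g \<in> L2"
    and eq: "\<And>k. coef f k = coef g k"
  shows "AE x in leb H. f x = g x"
proof -
  have "norm2 (f - g) = 0"
    by (rule L2_norm_eq_0_coef[OF L2_diff[OF f g]]) (simp add: coef_diff f g eq)
  then show ?thesis using L2_norm_eq_0_iff[OF L2_diff[OF f g]] by simp
qed

end

section \<open>Indefinite integrals and integration by parts\<close>

text \<open>For square integrable \<open>g\<close> the Henstock-Kurzweil integral used here agrees with the Lebesgue
  integral; it makes the fundamental theorem of calculus directly applicable.\<close>

definition primitive :: "(real \<Rightarrow> real) \<Rightarrow> real \<Rightarrow> real" where
  "primitive g x = integral {0..x} g"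

lemma primitive_0 [simp]: "primitive g 0 = 0"
  by (simp add: primitive_def)

lemma L2_integrable_on:
  assumes "g \<in> L2_space (leb H)"
  shows "g integrable_on {0..H}"
proof -
  have "g integrable_on {0<..<H}"
    using has_integral_integral_lebesgue_on[OF integrable_leb_L2[OF assms]] by auto
  then show ?thesis using integrable_on_open_interval[of g 0 H] by simp
qed

lemma primitive_continuous: "g \<in> L2_space (leb H) \<Longrightarrow> continuous_on {0..H} (primitive g)"
  unfolding primitive_def using indefinite_integral_continuous_1[OF L2_integrable_on] .

lemma prim_L2: "g \<in> L2_space (leb H) \<Longrightarrow> primitive g \<in> L2_space (leb H)"
  by (rule L2_continuous[OF primitive_continuous])

lemma primitive_has_derivative:
  assumes "continuous_on {0..H} g" "0 \<le> x" "x \<le> H"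
  shows "(primitive g has_real_derivative g x) (at x within {0..H})"
  unfolding primitive_def using assms by (intro integral_has_real_derivative) auto

lemma indicator_L2: "indicator {..x} \<in> L2_space (leb H)"
proof (rule L2_bounded[of _ _ 1])
  show "indicator {..x} \<in> borel_measurable (leb H)"
    by (intro measurable_restrict_space1 borel_measurable_indicator) simp
qed (auto simp: indicator_def intro!: AE_leb_all)

text \<open>Point values of the primitive are continuous functionals of \<open>g\<close>, which is what carries
  statements about them over to limits in the mean.\<close>

lemma primitive_eq_inner:
  assumes g: "g \<in> L2_space (leb H)" and x: "0 \<le> x" "x \<le> H"
  shows "primitive g x = L2_inner (leb H) g (indicator {..x})"
proof -
  have "L2_inner (leb H) g (indicator {..x}) = integral {0..H} (\<lambda>y. g y * indicator {..x} y)"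
    unfolding L2_inner_def by (rule integral_leb[OF L2_mult_integrable[OF g indicator_L2]])
  also have "\<dots> = integral {0..H} (\<lambda>y. if y \<in> {0..x} then g y else 0)"
    by (rule Henstock_Kurzweil_Integration.integral_cong) (auto simp: indicator_def)
  also have "\<dots> = integral {0..x} g"
    using integral_restrict_Int[of "{0..H}" "{0..x}" g] x by (simp add: Int_absorb1 Int_commute)
  finally show ?thesis by (simp add: primitive_def)
qed

lemma primitive_diff:
  assumes "g \<in> L2_space (leb H)" "h \<in> L2_space (leb H)" "0 \<le> x" "x \<le> H"
  shows "primitive (g - h) x = primitive g x - primitive h x"
  using assms by (simp add: primitive_eq_inner[of _ H] L2_diff L2_inner_diff indicator_L2)

lemma primitive_bound:
  assumes H: "H > 0" and g: "g \<in> L2_space (leb H)" and x: "0 \<le> x" "x \<le> H"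
  shows "\<bar>primitive g x\<bar> \<le> L2_norm (leb H) g * sqrt H"
proof -
  have "L2_norm (leb H) (indicator {..x}) \<le> \<bar>1\<bar> * sqrt H"
    by (rule L2_norm_bounded[OF H L2_measurable[OF indicator_L2]])
       (auto simp: indicator_def intro!: AE_leb_all)
  then have "L2_norm (leb H) g * L2_norm (leb H) (indicator {..x}) \<le> L2_norm (leb H) g * sqrt H"
    by (intro mult_left_mono) auto
  then show ?thesis
    using L2_Cauchy_Schwarz[OF g indicator_L2, of x] primitive_eq_inner[OF g x] by simp
qed

text \<open>For continuous \<open>g\<close> this is the fundamental theorem of calculus. Both sides depend continuously
  on \<open>g\<close> in the mean, so density of the continuous functions extends it.\<close>

lemma primitive_by_parts:
  assumes H: "H > 0" and g: "g \<in> L2_space (leb H)"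
    and phi: "\<And>x. 0 \<le> x \<Longrightarrow> x \<le> H \<Longrightarrow> (\<phi> has_real_derivative \<phi>' x) (at x)"
    and phi': "continuous_on {0..H} \<phi>'"
  shows "L2_inner (leb H) g \<phi> = primitive g H * \<phi> H - L2_inner (leb H) (primitive g) \<phi>'"
proof -
  let ?N = "L2_norm (leb H)" and ?ip = "L2_inner (leb H)"
  have c_phi: "continuous_on {0..H} \<phi>"
    using phi by (intro continuous_at_imp_continuous_on) (auto intro!: DERIV_isCont[OF phi])
  have pL: "\<phi> \<in> L2_space (leb H)" and p'L: "\<phi>' \<in> L2_space (leb H)"
    by (intro L2_continuous c_phi phi')+
  \<comment> \<open>the defect of the formula; it is Lipschitz in the mean and vanishes for continuous functions\<close>
  define D where "D h = ?ip h \<phi> - primitive h H * \<phi> H + ?ip (primitive h) \<phi>'" for h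
  define C where "C = ?N \<phi> + sqrt H * \<bar>\<phi> H\<bar> + H * ?N \<phi>'"
  have bound: "\<bar>D h - D g\<bar> \<le> ?N (h - g) * C" if h: "h \<in> L2_space (leb H)" for h
  proof -
    have hg: "h - g \<in> L2_space (leb H)" by (rule L2_diff[OF h g])
    have p: "primitive h - primitive g \<in> L2_space (leb H)" by (intro L2_diff prim_L2 h g)
    have pb: "\<bar>(primitive h - primitive g) x\<bar> \<le> ?N (h - g) * sqrt H" if "0 \<le> x" "x \<le> H" for x
      using primitive_bound[OF H hg that] primitive_diff[OF h g that] by simp
    have 1: "\<bar>?ip (h - g) \<phi>\<bar> \<le> ?N (h - g) * ?N \<phi>" by (rule L2_Cauchy_Schwarz[OF hg pL])
    have 2: "\<bar>(primitive h H - primitive g H) * \<phi> H\<bar> \<le> ?N (h - g) * (sqrt H * \<bar>\<phi> H\<bar>)"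
      using mult_right_mono[OF pb[of H], of "\<bar>\<phi> H\<bar>"] H by (simp add: abs_mult mult.assoc)
    have "?N (primitive h - primitive g) \<le> \<bar>?N (h - g) * sqrt H\<bar> * sqrt H"
      by (rule L2_norm_bounded[OF H L2_measurable[OF p]]) (use pb in \<open>auto intro!: AE_leb_all\<close>)
    also have "\<dots> = ?N (h - g) * H" using H by (simp add: abs_mult)
    finally have "?N (primitive h - primitive g) * ?N \<phi>' \<le> ?N (h - g) * H * ?N \<phi>'"
      by (intro mult_right_mono) auto
    then have 3: "\<bar>?ip (primitive h - primitive g) \<phi>'\<bar> \<le> ?N (h - g) * (H * ?N \<phi>')"
      using L2_Cauchy_Schwarz[OF p p'L] by (simp add: mult.assoc)
    have "D h - D g = ?ip (h - g) \<phi> - (primitive h H - primitive g H) * \<phi> H + ?ip (primitive h - primitive g) \<phi>'"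
      by (simp add: D_def L2_inner_diff h g pL p'L prim_L2 algebra_simps)
    then show ?thesis using 1 2 3 unfolding C_def distrib_left by linarith
  qed
  have D0: "D h = 0" if h: "continuous_on UNIV h" for h
  proof -
    have hc: "continuous_on {0..H} h" using h continuous_on_subset by blast
    have hL: "h \<in> L2_space (leb H)" by (rule L2_continuous[OF hc])
    have "(\<integral>x. h x * \<phi> x + primitive h x * \<phi>' x \<partial>leb H) = primitive h H * \<phi> H - primitive h 0 * \<phi> 0"
    proof (rule leb_FTC)
      fix x assume x: "0 \<le> x" "x \<le> H"
      show "((\<lambda>x. primitive h x * \<phi> x) has_real_derivative h x * \<phi> x + primitive h x * \<phi>' x) (at x within {0..H})"
        using DERIV_mult[OF primitive_has_derivative[OF hc x]
            has_field_derivative_at_within[OF phi[OF x], of "{0..H}"]]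
        by (simp add: algebra_simps)
    qed (use H in \<open>auto intro!: continuous_intros hc c_phi phi' primitive_continuous[OF hL]\<close>)
    moreover have "(\<integral>x. h x * \<phi> x + primitive h x * \<phi>' x \<partial>leb H) = ?ip h \<phi> + ?ip (primitive h) \<phi>'"
      unfolding L2_inner_def
      by (intro Bochner_Integration.integral_add L2_mult_integrable hL pL p'L prim_L2)
    ultimately show ?thesis by (simp add: D_def)
  qed
  obtain gn where gn: "\<And>n::nat. continuous_on UNIV (gn n)" "\<And>n. gn n \<in> L2_space (leb H)"
    and lim: "(\<lambda>n. ?N (gn n - g)) \<longlonglongrightarrow> 0"
    using L2_continuous_approx[OF g] by blast
  have "\<bar>D g\<bar> \<le> ?N (gn n - g) * C" for n
    using bound[OF gn(2), of n] D0[OF gn(1), of n] by simp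
  moreover have "(\<lambda>n. ?N (gn n - g) * C) \<longlonglongrightarrow> 0" using tendsto_mult_right[OF lim, of C] by simp
  ultimately have "\<bar>D g\<bar> \<le> 0" by (intro LIMSEQ_le_const) blast+
  then show ?thesis by (simp add: D_def)
qed

lemma primitive_plus_const_by_parts:
  assumes H: "H > 0" and g: "g \<in> L2_space (leb H)"
    and phi: "\<And>x. 0 \<le> x \<Longrightarrow> x \<le> H \<Longrightarrow> (\<phi> has_real_derivative \<phi>' x) (at x)"
    and phi': "continuous_on {0..H} \<phi>'"
    and F: "\<And>x. 0 \<le> x \<Longrightarrow> x \<le> H \<Longrightarrow> F x = c + primitive g x"
  shows "L2_inner (leb H) g \<phi> = F H * \<phi> H - F 0 * \<phi> 0 - L2_inner (leb H) F \<phi>'"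
proof -
  have pg: "primitive g \<in> L2_space (leb H)" by (rule prim_L2[OF g])
  have p'L: "\<phi>' \<in> L2_space (leb H)" by (rule L2_continuous[OF phi'])
  have "L2_inner (leb H) F \<phi>' = L2_inner (leb H) ((\<lambda>x. c) + primitive g) \<phi>'"
    unfolding L2_inner_def
    by (rule Bochner_Integration.integral_cong) (auto simp: F)
  also have "\<dots> = L2_inner (leb H) (\<lambda>x. c) \<phi>' + L2_inner (leb H) (primitive g) \<phi>'"
    by (rule L2_inner_add[OF L2_const pg p'L])
  also have "L2_inner (leb H) (\<lambda>x. c) \<phi>' = c * (\<integral>x. \<phi>' x \<partial>leb H)"
    by (simp add: L2_inner_def)
  also have "(\<integral>x. \<phi>' x \<partial>leb H) = \<phi> H - \<phi> 0"
    by (rule leb_FTC) (use H phi phi' in \<open>auto intro: has_field_derivative_at_within\<close>)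
  finally show ?thesis
    using primitive_by_parts[OF H g phi phi'] F[of H] F[of 0] H by (simp add: algebra_simps)
qed

context mixed_problem
begin

lemma eigf_derivs:
  "(eigf k has_real_derivative - freq k * sin (freq k * x) / cosnorm k) (at x)"
  "((\<lambda>x. - freq k * sin (freq k * x) / cosnorm k) has_real_derivative - (freq k)\<^sup>2 * eigf k x) (at x)"
  using less_imp_neq[OF cosnorm_pos[of k], symmetric]
  by (auto simp: eigf_def cosk_def[abs_def] scaleR_fun_def power2_eq_square field_simps
      intro!: derivative_eq_intros)

text \<open>The condition at \<open>H\<close> for a function with derivative \<open>u'\<close>. The condition at \<open>0\<close> is
  built into derivatives of the form \<open>primitive v\<close>.\<close>

definition boundary_cond :: "(real \<Rightarrow> real) \<Rightarrow> (real \<Rightarrow> real) \<Rightarrow> bool" where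
  "boundary_cond u u' \<longleftrightarrow> (if d then u H = 0 else u' H = 0)"

lemma eigf_boundary: "d \<Longrightarrow> eigf k H = 0" "\<not> d \<Longrightarrow> sin (freq k * H) = 0"
proof -
  assume "\<not> d"
  then have "freq k * H = real k * pi" unfolding freq_def using H_pos by simp
  then show "sin (freq k * H) = 0" by simp
next
  assume d
  then have "freq k * H = real k * pi + pi / 2" unfolding freq_def using H_pos by (simp add: field_simps)
  then have "cos (freq k * H) = 0" by (simp add: cos_add)
  then show "eigf k H = 0" by (simp add: eigf_def cosk_def)
qed

text \<open>Two integrations by parts. The boundary terms at \<open>0\<close> vanish because \<open>primitive v\<close> and the
  derivative of the cosine do; those at \<open>H\<close> vanish because \<open>F\<close> and the eigenfunction satisfy the same
  boundary condition.\<close>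

lemma coef_second_derivative:
  assumes v: "v \<in> L2"
    and F: "\<And>x. 0 \<le> x \<Longrightarrow> x \<le> H \<Longrightarrow> F x = c + primitive (primitive v) x"
    and bc: "boundary_cond F (primitive v)"
  shows "coef v k = - (freq k)\<^sup>2 * coef F k"
proof -
  let ?e' = "\<lambda>x. - freq k * sin (freq k * x) / cosnorm k"
  let ?e'' = "\<lambda>x. - (freq k)\<^sup>2 * eigf k x"
  have 1: "L2_inner (leb H) v (eigf k)
      = primitive v H * eigf k H - L2_inner (leb H) (primitive v) ?e'"
    by (rule primitive_by_parts[OF H_pos v eigf_derivs(1)])
       (intro continuous_intros, simp add: less_imp_neq[OF cosnorm_pos, symmetric])
  have 2: "L2_inner (leb H) (primitive v) ?e'
      = F H * ?e' H - F 0 * ?e' 0 - L2_inner (leb H) F ?e''"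
    by (rule primitive_plus_const_by_parts[OF H_pos prim_L2[OF v] eigf_derivs(2) _ F])
       (auto intro!: continuous_intros eigf_continuous)
  have 3: "L2_inner (leb H) F ?e'' = - (freq k)\<^sup>2 * coef F k"
    using L2_inner_scaleR_right[of "leb H" F "- (freq k)\<^sup>2" "eigf k"]
    by (simp add: coef_def scaleR_fun_def)
  have 4: "primitive v H * eigf k H = 0" "F H * ?e' H = 0"
    using bc eigf_boundary[of k] by (auto simp: boundary_cond_def split: if_splits)
  show ?thesis using 1 2 3 4 by (simp add: coef_def)
qed

end

text \<open>Integrating by parts against the Neumann eigenfunctions shows that all coefficients of \<open>g\<close> vanish.\<close>

lemma primitive_eq_0_imp_null:
  assumes H: "H > 0" and g: "g \<in> L2_space (leb H)"
    and 0: "\<And>x. 0 < x \<Longrightarrow> x < H \<Longrightarrow> primitive g x = 0"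
  shows "AE x in leb H. g x = 0"
proof -
  interpret mixed_problem H False by standard (rule H)
  have z: "primitive g x = 0" if "x \<in> {0..H}" for x
  proof -
    have "x \<in> closure {0<..<H}" using H that by (simp add: closure_greaterThanLessThan)
    moreover have "continuous_on (closure {0<..<H}) (primitive g)"
      using H primitive_continuous[OF g] by (simp add: closure_greaterThanLessThan)
    ultimately show ?thesis
      using continuous_constant_on_closure[of "{0<..<H}" "primitive g" 0 x] 0 by auto
  qed
  have "coef g k = 0" for k
  proof -
    have "coef g k = primitive g H * eigf k H
        - L2_inner (leb H) (primitive g) (\<lambda>x. - freq k * sin (freq k * x) / cosnorm k)"
      unfolding coef_def by (rule primitive_by_parts[OF H g eigf_derivs(1)])
       (intro continuous_intros, simp add: less_imp_neq[OF cosnorm_pos, symmetric])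
    moreover have "L2_inner (leb H) (primitive g) (\<lambda>x. - freq k * sin (freq k * x) / cosnorm k)
        = (\<integral>x. 0 \<partial>leb H)"
      unfolding L2_inner_def by (rule Bochner_Integration.integral_cong) (auto simp: z)
    ultimately show ?thesis using z[of H] H by simp
  qed
  then show ?thesis using L2_norm_eq_0_coef[OF g] L2_norm_eq_0_iff[OF g] by simp
qed

section \<open>Test functions\<close>

text \<open>The classical smooth function that is flat at \<open>a\<close> and \<open>b\<close>. The extra powers make the family stable
  under differentiation, up to linear combinations; the scale \<open>c\<close> makes the members with \<open>i = j = 0\<close>
  tend to the indicator of the interval as \<open>c\<close> tends to zero.\<close>

definition bump :: "real \<Rightarrow> real \<Rightarrow> real \<Rightarrow> nat \<Rightarrow> nat \<Rightarrow> real \<Rightarrow> real" where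
  "bump a b c i j x = (if a < x \<and> x < b
     then exp (- c * (inverse (x - a) + inverse (b - x))) * inverse (x - a) ^ i * inverse (b - x) ^ j
     else 0)"

definition bumps :: "real \<Rightarrow> (real \<Rightarrow> real) set" where
  "bumps H = span {bump a b c i j | a b c i j. 0 < a \<and> a < b \<and> b < H \<and> 0 < c}"

text \<open>One term of the exponential series bounds \<open>exp (c / y)\<close> from below by a multiple of \<open>y ^ - (i + m)\<close>.\<close>

lemma exp_inverse_power_le:
  assumes "c > 0" "y > (0::real)"
  shows "exp (- c * inverse y) * inverse y ^ i \<le> fact (i + m) / c ^ (i + m) * y ^ m"
proof -
  have "(c * inverse y) ^ n / fact n \<le> exp (c * inverse y)" for n
    using sum_le_suminf[OF summable_exp[of "c * inverse y"], of "{n}"] assms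
    by (simp add: exp_def divide_inverse mult.commute scaleR_conv_of_real)
  from this[of "i + m"] have "(c * inverse y) ^ (i + m) / fact (i + m) \<le> exp (c * inverse y)" .
  then have "inverse (exp (c * inverse y)) \<le> inverse ((c * inverse y) ^ (i + m) / fact (i + m))"
    by (rule le_imp_inverse_le) (use assms in simp)
  then have "exp (- c * inverse y) * inverse y ^ i
      \<le> inverse ((c * inverse y) ^ (i + m) / fact (i + m)) * inverse y ^ i"
    using assms by (intro mult_right_mono) (auto simp: exp_minus)
  also have "\<dots> = fact (i + m) / c ^ (i + m) * y ^ m"
    using assms by (simp add: field_simps power_add)
  finally show ?thesis .
qed

text \<open>Flatness to second order at the end points, which gives the vanishing derivative there.\<close>

lemma bump_bound:
  assumes "c > 0"
  obtains K where "\<And>x. \<bar>bump a b c i j x\<bar> \<le> K * (x - a)\<^sup>2" "\<And>x. \<bar>bump a b c i j x\<bar> \<le> K * (x - b)\<^sup>2"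
proof -
  define k where "k n = fact n / c ^ n" for n
  have k: "k n \<ge> 0" for n using assms by (simp add: k_def)
  \<comment> \<open>two more powers are spent at the end point in question, none at the other\<close>
  define K where "K = k (i + 2) * k j + k i * k (j + 2)"
  have K: "K \<ge> 0" using k by (simp add: K_def)
  have split: "bump a b c i j x
      = (exp (- c * inverse (x - a)) * inverse (x - a) ^ i) * (exp (- c * inverse (b - x)) * inverse (b - x) ^ j)"
    if "a < x" "x < b" for x
    using that by (simp add: bump_def exp_add[symmetric] distrib_left)
  have "\<bar>bump a b c i j x\<bar> \<le> K * (x - a)\<^sup>2 \<and> \<bar>bump a b c i j x\<bar> \<le> K * (x - b)\<^sup>2" for x
  proof (cases "a < x \<and> x < b")
    case False
    then show ?thesis using K by (auto simp: bump_def)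
  next
    case True
    let ?A = "exp (- c * inverse (x - a)) * inverse (x - a) ^ i"
    let ?B = "exp (- c * inverse (b - x)) * inverse (b - x) ^ j"
    have A: "0 \<le> ?A" "?A \<le> k (i + 2) * (x - a)\<^sup>2" "?A \<le> k i"
      using True assms exp_inverse_power_le[of c "x - a" i 2] exp_inverse_power_le[of c "x - a" i 0]
      by (auto simp: k_def)
    have B: "0 \<le> ?B" "?B \<le> k (j + 2) * (b - x)\<^sup>2" "?B \<le> k j"
      using True assms exp_inverse_power_le[of c "b - x" j 2] exp_inverse_power_le[of c "b - x" j 0]
      by (auto simp: k_def)
    have "?A * ?B \<le> (k (i + 2) * (x - a)\<^sup>2) * k j"
      by (rule mult_mono[OF A(2) B(3) _ B(1)]) (use k in simp)
    moreover have "?A * ?B \<le> k i * (k (j + 2) * (b - x)\<^sup>2)"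
      by (rule mult_mono[OF A(3) B(2) k B(1)])
    moreover have "0 \<le> k (i + 2) * k j * (b - x)\<^sup>2" "0 \<le> k i * k (j + 2) * (x - a)\<^sup>2"
      using k by (auto intro!: mult_nonneg_nonneg)
    ultimately have "?A * ?B \<le> K * (x - a)\<^sup>2" "?A * ?B \<le> K * (b - x)\<^sup>2"
      unfolding K_def by (auto simp: algebra_simps)
    moreover have "0 \<le> ?A * ?B" using A B by simp
    ultimately show ?thesis using True
      by (simp add: split power2_commute[of b x])
  qed
  then show thesis using that by blast
qed

lemma DERIV_zero_of_square_bound:
  fixes f :: "real \<Rightarrow> real"
  assumes "\<And>x. \<bar>f x\<bar> \<le> K * (x - a)\<^sup>2"
  shows "(f has_real_derivative 0) (at a)"
proof -
  have fa: "f a = 0" using assms[of a] by simp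
  have "((\<lambda>x. (f x - f a) / (x - a)) \<longlongrightarrow> 0) (at a)"
  proof (rule Lim_null_comparison[of _ "\<lambda>x. K * \<bar>x - a\<bar>"])
    show "\<forall>\<^sub>F x in at a. norm ((f x - f a) / (x - a)) \<le> K * \<bar>x - a\<bar>"
    proof (rule always_eventually, rule allI)
      fix x
      show "norm ((f x - f a) / (x - a)) \<le> K * \<bar>x - a\<bar>"
      proof (cases "x = a")
        case False
        have "(x - a)\<^sup>2 = \<bar>x - a\<bar> * \<bar>x - a\<bar>" by (simp add: power2_eq_square)
        then show ?thesis using assms[of x] False fa by (simp add: divide_le_eq mult.assoc)
      qed simp
    qed
    have "((\<lambda>x. K * \<bar>x - a\<bar>) \<longlongrightarrow> K * \<bar>a - a\<bar>) (at a)" by (intro tendsto_intros)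
    then show "((\<lambda>x. K * \<bar>x - a\<bar>) \<longlongrightarrow> 0) (at a)" by simp
  qed
  then show ?thesis by (simp add: has_field_derivative_iff)
qed

lemma DERIV_inverse_power:
  "x \<noteq> a \<Longrightarrow> ((\<lambda>x::real. inverse (x - a) ^ i) has_real_derivative - real i * inverse (x - a) ^ Suc i) (at x)"
proof (induction i)
  case (Suc i)
  have "((\<lambda>x. inverse (x - a)) has_real_derivative - (inverse (x - a))\<^sup>2) (at x)"
    using Suc.prems by (auto intro!: derivative_eq_intros simp: power2_eq_square)
  from DERIV_mult[OF this Suc.IH[OF Suc.prems]] show ?case
    by (simp add: algebra_simps power2_eq_square)
qed simp

lemma bump_deriv:
  assumes "c > 0" "a < b"
  shows "(bump a b c i j has_real_derivative
    (c *\<^sub>R bump a b c (i + 2) j - c *\<^sub>R bump a b c i (j + 2)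
      - real i *\<^sub>R bump a b c (i + 1) j + real j *\<^sub>R bump a b c i (j + 1)) x) (at x)"
proof -
  let ?D = "c *\<^sub>R bump a b c (i + 2) j - c *\<^sub>R bump a b c i (j + 2)
      - real i *\<^sub>R bump a b c (i + 1) j + real j *\<^sub>R bump a b c i (j + 1)"
  have D0: "?D x = 0" if "x \<le> a \<or> x \<ge> b" using that by (auto simp: bump_def)
  consider "x < a \<or> x > b" | "x = a" | "x = b" | "a < x" "x < b" by linarith
  then show ?thesis
  proof cases
    case 1
    have "((\<lambda>x. 0) has_real_derivative 0) (at x)" by simp
    moreover have "open (- {a..b})" "x \<in> - {a..b}" using 1 by auto
    ultimately have "(bump a b c i j has_real_derivative 0) (at x)"
      by (rule has_field_derivative_transform_within_open) (auto simp: bump_def)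
    then show ?thesis using D0 1 by auto
  next
    case 2
    obtain K where "\<And>x. \<bar>bump a b c i j x\<bar> \<le> K * (x - a)\<^sup>2" using bump_bound[OF assms(1)] by blast
    from DERIV_zero_of_square_bound[OF this] show ?thesis using D0 2 by auto
  next
    case 3
    obtain K where "\<And>x. \<bar>bump a b c i j x\<bar> \<le> K * (x - b)\<^sup>2" using bump_bound[OF assms(1)] by blast
    from DERIV_zero_of_square_bound[OF this] show ?thesis using D0 3 by auto
  next
    case 4
    let ?u = "\<lambda>x. inverse (x - a)" and ?w = "\<lambda>x. inverse (b - x)"
    let ?E = "\<lambda>x. exp (- c * (?u x + ?w x))"
    have E: "(?E has_real_derivative ?E x * (c * (?u x)\<^sup>2 - c * (?w x)\<^sup>2)) (at x)"
    proof -
      have "((\<lambda>x. - c * (?u x + ?w x)) has_real_derivative c * (?u x)\<^sup>2 - c * (?w x)\<^sup>2) (at x)"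
        using 4 by (auto intro!: derivative_eq_intros simp: power2_eq_square algebra_simps)
      then show ?thesis by (rule DERIV_fun_exp)
    qed
    have u: "((\<lambda>x. ?u x ^ i) has_real_derivative - real i * ?u x ^ Suc i) (at x)"
      using 4 by (intro DERIV_inverse_power) auto
    have "((\<lambda>x. (- 1) ^ j * inverse (x - b) ^ j) has_real_derivative
        (- 1) ^ j * (- real j * inverse (x - b) ^ Suc j)) (at x)"
      using 4 by (intro DERIV_cmult DERIV_inverse_power) auto
    then have wd: "((\<lambda>x. (- 1) ^ j * inverse (x - b) ^ j) has_real_derivative
        real j * ((- 1) ^ Suc j * inverse (x - b) ^ Suc j)) (at x)"
      by (rule DERIV_cong) simp
    have m: "inverse (b - y) ^ n = (- 1) ^ n * inverse (y - b) ^ n" for n y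
    proof -
      have "b - y = - (y - b)" by simp
      then have "inverse (b - y) = (- 1) * inverse (y - b)" by (metis inverse_minus_eq mult_minus1)
      then show ?thesis by (simp only: power_mult_distrib)
    qed
    have w: "((\<lambda>x. ?w x ^ j) has_real_derivative real j * ?w x ^ Suc j) (at x)"
      unfolding m by (rule wd)
    have "((\<lambda>x. ?E x * ?u x ^ i * ?w x ^ j) has_real_derivative ?D x) (at x)"
      by (rule DERIV_cong[OF DERIV_mult[OF DERIV_mult[OF E u] w]])
         (use 4 in \<open>simp add: bump_def algebra_simps power2_eq_square\<close>)
    then show ?thesis
      by (rule has_field_derivative_transform_within_open[of _ _ _ "{a<..<b}"])
         (use 4 in \<open>auto simp: bump_def\<close>)
  qed
qed

lemma subspace_bumps: "subspace (bumps H)"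
  by (simp add: bumps_def)

lemma bump_in_bumps: "0 < a \<Longrightarrow> a < b \<Longrightarrow> b < H \<Longrightarrow> 0 < c \<Longrightarrow> bump a b c i j \<in> bumps H"
  unfolding bumps_def by (rule span_base) blast

text \<open>Smoothness is stability under differentiation: once every member has a derivative in the family,
  derivatives of all orders exist.\<close>

lemma bumps_deriv:
  assumes "f \<in> bumps H"
  shows "\<exists>f'\<in>bumps H. \<forall>x. (f has_real_derivative f' x) (at x)"
  using assms unfolding bumps_def
proof (induction rule: span_induct)
  case base
  show ?case
  proof (rule subspaceI, goal_cases)
    case 1
    show ?case unfolding bumps_def[symmetric]
      by (intro CollectI bexI[of _ 0] subspace_0 subspace_bumps allI) (simp add: zero_fun_def)
  next
    case (2 f g)
    then obtain f' g' where "f' \<in> bumps H" "\<forall>x. (f has_real_derivative f' x) (at x)"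
      "g' \<in> bumps H" "\<forall>x. (g has_real_derivative g' x) (at x)"
      unfolding bumps_def by blast
    then show ?case unfolding bumps_def[symmetric]
      by (intro CollectI bexI[of _ "f' + g'"] subspace_add subspace_bumps)
         (auto simp: plus_fun_def intro!: DERIV_add)
  next
    case (3 c f)
    then obtain f' where "f' \<in> bumps H" "\<forall>x. (f has_real_derivative f' x) (at x)"
      unfolding bumps_def by blast
    then show ?case unfolding bumps_def[symmetric]
      by (intro CollectI bexI[of _ "c *\<^sub>R f'"] subspace_scale subspace_bumps)
         (auto simp: scaleR_fun_def intro!: DERIV_cmult)
  qed
next
  case (step f)
  then obtain a b c i j where f: "f = bump a b c i j" and p: "0 < a" "a < b" "b < H" "0 < c" by auto
  have "c *\<^sub>R bump a b c (i + 2) j - c *\<^sub>R bump a b c i (j + 2)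
      - real i *\<^sub>R bump a b c (i + 1) j + real j *\<^sub>R bump a b c i (j + 1) \<in> bumps H"
    by (intro subspace_add subspace_diff subspace_scale subspace_bumps bump_in_bumps p)
  then show ?case using bump_deriv[OF p(4,2), of i j] unfolding f bumps_def[symmetric] by blast
qed

lemma bumps_support:
  assumes "H > 0" "f \<in> bumps H"
  shows "\<exists>a b. 0 < a \<and> a < b \<and> b < H \<and> (\<forall>x. x \<le> a \<or> b \<le> x \<longrightarrow> f x = 0)"
  using assms(2) unfolding bumps_def
proof (induction rule: span_induct)
  case base
  show ?case
  proof (rule subspaceI, goal_cases)
    case 1
    show ?case
      using assms(1) by (intro CollectI exI[of _ "H/3"] conjI exI[of _ "H/2"]) auto
  next
    case (2 f g)
    then obtain a b a' b' where "0 < a" "0 < a'" "a < b" "b < H" "\<forall>x. x \<le> a \<or> b \<le> x \<longrightarrow> f x = 0"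
      "a' < b'" "b' < H" "\<forall>x. x \<le> a' \<or> b' \<le> x \<longrightarrow> g x = 0"
      by auto
    then show ?case
      by (intro CollectI exI[of _ "min a a'"] exI[of _ "max b b'"] conjI) auto
  next
    case (3 c f)
    then obtain a b where "0 < a" "a < b" "b < H" "\<forall>x. x \<le> a \<or> b \<le> x \<longrightarrow> f x = 0"
      by auto
    then show ?case by (intro CollectI exI[of _ a] exI[of _ b]) auto
  qed
next
  case (step f)
  then obtain a b c i j where "f = bump a b c i j" "0 < a" "a < b" "b < H" by auto
  then show ?case by (intro exI[of _ a] exI[of _ b]) (auto simp: bump_def)
qed

lemma bumps_continuous: "f \<in> bumps H \<Longrightarrow> continuous_on S f"
  using bumps_deriv[of f H] by (blast intro: DERIV_continuous_on has_field_derivative_at_within)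

lemma bumps_L2: "f \<in> bumps H \<Longrightarrow> f \<in> L2_space (leb H)"
  by (rule L2_continuous[OF bumps_continuous])

text \<open>The membership test for both sources of test functions: the bumps themselves and the primitives of
  bumps with mean zero.\<close>

lemma test_function_primitiveI:
  assumes deriv: "\<And>x. (\<phi> has_real_derivative \<rho> x) (at x)" and chi: "\<rho> \<in> bumps H"
    and ab: "0 < a" "b < H" and supp: "\<And>x. x \<le> a \<or> b \<le> x \<Longrightarrow> \<phi> x = 0"
  shows "test_function H \<phi>"
proof -
  have it: "(deriv ^^ k) f \<in> bumps H" if "f \<in> bumps H" for k f
    using that
  proof (induction k arbitrary: f)
    case (Suc k)
    obtain f' where f': "f' \<in> bumps H" "\<And>x. (f has_real_derivative f' x) (at x)"
      using bumps_deriv[OF Suc.prems] by blast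
    then have "deriv f = f'" by (intro ext DERIV_imp_deriv)
    then show ?case using Suc.IH[OF f'(1)] by (simp add: funpow_swap1)
  qed simp
  have d: "deriv \<phi> = \<rho>" by (intro ext DERIV_imp_deriv deriv)
  have "(deriv ^^ k) \<phi> field_differentiable at x" for k x
  proof (cases k)
    case 0
    then show ?thesis using deriv by (auto simp: field_differentiable_def)
  next
    case (Suc m)
    have "(deriv ^^ m) \<rho> \<in> bumps H" by (rule it[OF chi])
    from bumps_deriv[OF this] have "(deriv ^^ m) \<rho> field_differentiable at x"
      unfolding field_differentiable_def by blast
    then show ?thesis by (simp add: Suc funpow_swap1 d)
  qed
  moreover have sub: "closure {x. \<phi> x \<noteq> 0} \<subseteq> {a..b}"
  proof (rule closure_minimal, safe)
    fix x assume "\<phi> x \<noteq> 0"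
    then show "x \<in> {a..b}" using supp[of x] by (cases "x < a \<or> b < x") auto
  qed simp
  moreover have "compact (closure {x. \<phi> x \<noteq> 0})"
    unfolding compact_closure
    using bounded_subset[OF bounded_closed_interval[of a b] order_trans[OF closure_subset sub]] .
  moreover have "closure {x. \<phi> x \<noteq> 0} \<subseteq> {0<..<H}"
    by (rule order_trans[OF sub]) (use ab in auto)
  ultimately show ?thesis unfolding test_function_def by blast
qed

lemma bumps_test_function:
  assumes "H > 0" "f \<in> bumps H"
  shows "test_function H f"
proof -
  obtain f' where "f' \<in> bumps H" "\<And>x. (f has_real_derivative f' x) (at x)"
    using bumps_deriv[OF assms(2)] by blast
  then show ?thesis
  proof -
    obtain a b where "0 < a" "b < H" "\<And>x. x \<le> a \<or> b \<le> x \<Longrightarrow> f x = 0"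
      using bumps_support[OF assms] by blast
    with \<open>f' \<in> bumps H\<close> show ?thesis
      by (intro test_function_primitiveI[of f f' H a b] \<open>\<And>x. (f has_real_derivative f' x) (at x)\<close>)
  qed
qed

lemma test_functionD:
  assumes t: "test_function H \<phi>"
  shows "(\<phi> has_real_derivative deriv \<phi> x) (at x)" "continuous_on S (deriv \<phi>)" "\<phi> 0 = 0" "\<phi> H = 0"
proof -
  have d: "(deriv ^^ k) \<phi> field_differentiable at x" for k x
    using t by (auto simp: test_function_def)
  from d[of 0] show "(\<phi> has_real_derivative deriv \<phi> x) (at x)"
    by (simp add: field_differentiable_derivI)
  from d[of 1] show "continuous_on S (deriv \<phi>)"
    by (simp add: continuous_at_imp_continuous_on field_differentiable_imp_continuous_at)
  have "{x. \<phi> x \<noteq> 0} \<subseteq> {0<..<H}"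
    using t order_trans[OF closure_subset] unfolding test_function_def by blast
  then show "\<phi> 0 = 0" "\<phi> H = 0" by auto
qed

text \<open>The end points approach \<open>0\<close> and \<open>x\<close> while the scale tends to zero. Starting at \<open>3\<close> keeps the left end
  point below the right one.\<close>

lemma bump_tendsto_indicator:
  assumes x: "0 < x" and y: "0 < y" "y \<noteq> x"
  shows "(\<lambda>n. bump (x / (real n + 3)) (x - x / (real n + 3)) (1 / (real n + 3)) 0 0 y)
    \<longlonglongrightarrow> indicator {..x} y"
proof (cases "y < x")
  case True
  have s: "(\<lambda>n. 1 / (real n + 3)) \<longlonglongrightarrow> 0"
    by (rule real_tendsto_sandwich[OF _ _ tendsto_const LIMSEQ_inverse_real_of_nat])
       (auto intro!: always_eventually simp: inverse_eq_divide frac_le)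
  have a: "(\<lambda>n. x / (real n + 3)) \<longlonglongrightarrow> 0"
    using tendsto_mult_left[OF s, of x] by simp
  have ev: "\<forall>\<^sub>F n in sequentially. x / (real n + 3) < y"
    "\<forall>\<^sub>F n in sequentially. x / (real n + 3) < x - y"
    using order_tendstoD(2)[OF a, of y] order_tendstoD(2)[OF a, of "x - y"] y True by auto
  have "(\<lambda>n. exp (- (1 / (real n + 3)) * (inverse (y - x / (real n + 3))
      + inverse (x - x / (real n + 3) - y)))) \<longlonglongrightarrow> exp (- 0 * (inverse (y - 0) + inverse (x - 0 - y)))"
    using y True by (intro tendsto_intros a s) auto
  moreover have ev': "\<forall>\<^sub>F n in sequentially. exp (- (1 / (real n + 3)) * (inverse (y - x / (real n + 3))
      + inverse (x - x / (real n + 3) - y)))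
      = bump (x / (real n + 3)) (x - x / (real n + 3)) (1 / (real n + 3)) 0 0 y"
    using ev by eventually_elim (simp add: bump_def)
  ultimately show ?thesis
    using True tendsto_cong[OF ev'] by (simp add: indicator_def)
next
  case False
  have "bump (x / (real n + 3)) (x - x / (real n + 3)) (1 / (real n + 3)) 0 0 y = 0" for n
  proof -
    have "x / (real n + 3) > 0" using x by simp
    then show ?thesis using False unfolding bump_def by auto
  qed
  then show ?thesis using False y by (simp add: indicator_def)
qed

text \<open>The fundamental lemma of the calculus of variations: bumps approximate the indicator of \<open>(0,x)\<close> in the
  mean, hence every integral of \<open>w\<close> over such an interval vanishes.\<close>

lemma bumps_orthogonal_imp_null:
  assumes H: "H > 0" and w: "w \<in> L2_space (leb H)"
    and orth: "\<And>\<psi>. \<psi> \<in> bumps H \<Longrightarrow> L2_inner (leb H) w \<psi> = 0"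
  shows "AE x in leb H. w x = 0"
proof (rule primitive_eq_0_imp_null[OF H w])
  fix x assume x: "0 < x" "x < H"
  define \<psi> where "\<psi> n = bump (x / (real n + 3)) (x - x / (real n + 3)) (1 / (real n + 3)) 0 0" for n
  have psi: "\<psi> n \<in> bumps H" for n
  proof -
    define q where "q = x / (real n + 3)"
    have q: "q > 0" "q * (real n + 3) = x" using x by (auto simp: q_def)
    have "q * 3 \<le> q * (real n + 3)" using q(1) by (intro mult_left_mono) auto
    then have "0 < q" "q < x - q" "x - q < H" using q x by linarith+
    then show ?thesis unfolding \<psi>_def q_def[symmetric]
      by (intro bump_in_bumps) auto
  qed
  let ?i = "indicator {..x} :: real \<Rightarrow> real"
  have lim: "(\<lambda>n. L2_norm (leb H) (\<psi> n - ?i)) \<longlonglongrightarrow> 0"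
  proof (rule L2_dominated_convergence(3)[where w = "\<lambda>x. 1"])
    show "AE y in leb H. (\<lambda>n. \<psi> n y) \<longlonglongrightarrow> ?i y"
      by (rule AE_leb_I[of "{x}"]) (auto simp: \<psi>_def intro!: bump_tendsto_indicator x)
    show "AE y in leb H. \<bar>\<psi> n y\<bar> \<le> 1" for n
      by (rule AE_leb_all) (auto simp: \<psi>_def bump_def intro!: mult_nonneg_nonneg add_nonneg_nonneg)
  qed (auto intro: L2_measurable indicator_L2 L2_const bumps_L2 psi)
  have "\<bar>primitive w x\<bar> \<le> L2_norm (leb H) w * L2_norm (leb H) (\<psi> n - ?i)" for n
  proof -
    have "L2_inner (leb H) w (\<psi> n - ?i) = - primitive w x"
      using orth[OF psi[of n]] primitive_eq_inner[OF w, of x] x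
      by (simp add: L2_inner_diff_right bumps_L2 psi indicator_L2 w)
    then show ?thesis
      using L2_Cauchy_Schwarz[OF w L2_diff[OF bumps_L2[OF psi[of n]] indicator_L2[of x]]] by simp
  qed
  moreover have "(\<lambda>n. L2_norm (leb H) w * L2_norm (leb H) (\<psi> n - ?i)) \<longlonglongrightarrow> 0"
    using tendsto_mult_left[OF lim, of "L2_norm (leb H) w"] by simp
  ultimately have "\<bar>primitive w x\<bar> \<le> 0" by (intro LIMSEQ_le_const) blast+
  then show "primitive w x = 0" by simp
qed

lemma not_AE_leb_False: "H > 0 \<Longrightarrow> \<not> (AE x in leb H. False)"
proof
  assume "H > 0" "AE x in leb H. False"
  then have "ae_filter (leb H) = bot" by (simp add: trivial_limit_def)
  then have "emeasure (leb H) (space (leb H)) = 0" by (simp add: ae_filter_eq_bot_iff)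
  with \<open>H > 0\<close> show False by (simp add: emeasure_restrict_space)
qed

text \<open>A bump with mean zero has a test function as its primitive, and any bump becomes one of mean zero
  after subtraction of a multiple of a fixed bump \<open>\<psi>0\<close> with nonzero mean. So \<open>w\<close>, minus its mean weighted
  by \<open>\<psi>0\<close>, is orthogonal to all bumps.\<close>

lemma du_Bois_Reymond:
  assumes H: "H > 0" and w: "w \<in> L2_space (leb H)"
    and orth: "\<And>\<phi>. test_function H \<phi> \<Longrightarrow> L2_inner (leb H) w (deriv \<phi>) = 0"
  shows "\<exists>C. AE x in leb H. w x = C"
proof -
  let ?ip = "L2_inner (leb H)" and ?one = "\<lambda>x::real. 1::real"
  have one: "?one \<in> L2_space (leb H)" by (rule L2_const)
  obtain \<psi>0 where p0: "\<psi>0 \<in> bumps H" "?ip ?one \<psi>0 \<noteq> 0"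
  proof (rule ccontr)
    assume "\<not> thesis"
    then have "AE x in leb H. ?one x = 0"
      using that by (intro bumps_orthogonal_imp_null[OF H one]) blast
    then show False using not_AE_leb_False[OF H] by simp
  qed
  \<comment> \<open>the only candidate for the constant, found by testing with \<open>\<psi>0\<close>\<close>
  define C where "C = ?ip w \<psi>0 / ?ip ?one \<psi>0"
  have "AE x in leb H. (w - C *\<^sub>R ?one) x = 0"
  proof (rule bumps_orthogonal_imp_null[OF H])
    show wc: "w - C *\<^sub>R ?one \<in> L2_space (leb H)" by (intro L2_diff L2_scaleR w one)
    fix \<psi> assume p: "\<psi> \<in> bumps H"
    define r where "r = ?ip ?one \<psi> / ?ip ?one \<psi>0"
    define \<rho> where "\<rho> = \<psi> - r *\<^sub>R \<psi>0"
    have chi: "\<rho> \<in> bumps H" unfolding \<rho>_def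
      by (intro subspace_diff[OF subspace_bumps] subspace_scale[OF subspace_bumps] p p0)
    have ip_chi: "?ip h \<rho> = ?ip h \<psi> - r * ?ip h \<psi>0" if "h \<in> L2_space (leb H)" for h
      by (simp add: \<rho>_def L2_inner_diff_right L2_inner_scaleR_right L2_scaleR bumps_L2 p p0 that)
    obtain a b where ab: "0 < a" "a < b" "b < H" and supp: "\<And>x. x \<le> a \<or> b \<le> x \<Longrightarrow> \<rho> x = 0"
      using bumps_support[OF H chi] by blast
    have int: "\<rho> integrable_on {u..v}" for u v
      by (rule integrable_continuous_real[OF bumps_continuous[OF chi]])
    have low: "primitive \<rho> x = 0" if "x \<le> a" for x
    proof -
      have "integral {0..x} \<rho> = integral {0..x} (\<lambda>x. 0)"
        by (rule Henstock_Kurzweil_Integration.integral_cong) (use supp that in auto)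
      then show ?thesis by (simp add: primitive_def)
    qed
    have const: "primitive \<rho> x = primitive \<rho> b" if "b \<le> x" for x
    proof -
      have "integral {0..b} \<rho> + integral {b..x} \<rho> = integral {0..x} \<rho>"
        using ab that by (intro Henstock_Kurzweil_Integration.integral_combine int) auto
      moreover have "integral {b..x} \<rho> = integral {b..x} (\<lambda>x. 0)"
        by (rule Henstock_Kurzweil_Integration.integral_cong) (use supp in auto)
      ultimately show ?thesis by (simp add: primitive_def)
    qed
    have "primitive \<rho> H = ?ip ?one \<rho>"
      using integral_leb[OF integrable_leb_L2[OF bumps_L2[OF chi]]] by (simp add: primitive_def L2_inner_def)
    also have "\<dots> = 0" using ip_chi[OF one] p0 by (simp add: r_def)
    finally have high: "primitive \<rho> x = 0" if "b \<le> x" for x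
      using const[of H] const[OF that] ab by simp
    have der: "(primitive \<rho> has_real_derivative \<rho> x) (at x)" for x
    proof (cases "x < a")
      case True
      have "((\<lambda>x. 0) has_real_derivative 0) (at x)" by simp
      then have "(primitive \<rho> has_real_derivative 0) (at x)"
        by (rule has_field_derivative_transform_within_open[of _ _ _ "{..<a}"]) (use True low in auto)
      then show ?thesis using supp[of x] True by simp
    next
      case False
      have "(primitive \<rho> has_real_derivative \<rho> x) (at x within {0..x + 1})"
        using False ab by (intro primitive_has_derivative bumps_continuous[OF chi]) auto
      moreover have "at x within {0..x + 1} = at x"
        using False ab by (intro at_within_interior) auto
      ultimately show ?thesis by simp
    qed
    have "test_function H (primitive \<rho>)"
      by (rule test_function_primitiveI[OF der chi ab(1,3)]) (use low high in auto)
    from orth[OF this] have "?ip w \<rho> = 0"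
      using DERIV_imp_deriv[OF der] by (simp add: ext[of "deriv (primitive \<rho>)" \<rho>])
    then have "?ip w \<psi> = C * ?ip ?one \<psi>" using ip_chi[OF w] by (simp add: r_def C_def)
    then show "?ip (w - C *\<^sub>R ?one) \<psi> = 0"
      using L2_inner_scaleR[of _ C ?one]
      by (simp only: L2_inner_diff[OF w L2_scaleR[OF one] bumps_L2[OF p]] L2_inner_scaleR)
  qed
  then show ?thesis by (auto elim!: eventually_mono)
qed

section \<open>Weak derivatives and the domain of the operator\<close>

lemma primitive_cong_AE:
  assumes "g \<in> L2_space (leb H)" "h \<in> L2_space (leb H)" "AE x in leb H. g x = h x" "0 \<le> x" "x \<le> H"
  shows "primitive g x = primitive h x"
  using assms L2_inner_cong_AE[of g "leb H" h "indicator {..x}"]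
  by (simp add: primitive_eq_inner[of _ H] L2_measurable indicator_L2)

text \<open>The primitive of the difference vanishes, and so does its derivative.\<close>

lemma continuous_AE_eq:
  assumes H: "H > 0" and f: "continuous_on {0..H} f" and g: "continuous_on {0..H} g"
    and ae: "AE x in leb H. f x = g x" and x: "x \<in> {0..H}"
  shows "f x = (g x :: real)"
proof -
  define h where "h = f - g"
  have h: "continuous_on {0..H} h" unfolding h_def fun_diff_def by (intro continuous_intros f g)
  have hL: "h \<in> L2_space (leb H)" by (rule L2_continuous[OF h])
  have h0: "AE x in leb H. h x = 0" using ae by (simp add: h_def)
  have p: "primitive h y = 0" if "0 \<le> y" "y \<le> H" for y
    using primitive_cong_AE[OF hL L2_0 _ that] h0 by (simp add: primitive_def zero_fun_def)
  have "h y = 0" if y: "y \<in> {0<..<H}" for y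
  proof -
    have "(primitive h has_real_derivative h y) (at y within {0..H})"
      using y by (intro primitive_has_derivative h) auto
    moreover have "at y within {0..H} = at y" using y by (intro at_within_interior) auto
    ultimately have "(primitive h has_real_derivative h y) (at y)" by simp
    moreover have "(primitive h has_real_derivative 0) (at y)"
      by (rule has_field_derivative_transform_within_open[of "\<lambda>x. 0" _ _ "{0<..<H}"]) (use y p in auto)
    ultimately show ?thesis by (rule DERIV_unique)
  qed
  then have "h x = 0"
    using continuous_constant_on_closure[of "{0<..<H}" h 0 x] h H x
    by (auto simp: closure_greaterThanLessThan)
  then show ?thesis by (simp add: h_def)
qed

lemma has_trace_iff:
  assumes H: "H > 0" and F: "continuous_on {0..H} F" and ae: "AE x in leb H. f x = F x"
    and a: "a \<in> {0..H}"
  shows "has_trace H f a y \<longleftrightarrow> F a = y"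
proof
  assume "has_trace H f a y"
  then obtain c where c: "continuous_on {0..H} c" "AE x in leb H. f x = c x" "c a = y"
    by (auto simp: has_trace_def)
  have "AE x in leb H. F x = c x" using ae c(2) by eventually_elim simp
  then show "F a = y" using continuous_AE_eq[OF H F c(1) _ a] c(3) by simp
qed (use F ae in \<open>auto simp: has_trace_def\<close>)

text \<open>Together with its converse below, this identifies functions with a weak derivative as
  indefinite integrals, up to null sets and a constant.\<close>

lemma primitive_has_weak_deriv:
  assumes H: "H > 0" and f: "f \<in> L2_space (leb H)" and g: "g \<in> L2_space (leb H)"
    and ae: "AE x in leb H. f x = c + primitive g x"
  shows "has_weak_deriv H f g"
  unfolding has_weak_deriv_def
proof (intro conjI allI impI f g)
  fix \<phi> assume t: "test_function H \<phi>"
  note D = test_functionD[OF t]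
  let ?F = "\<lambda>x. c + primitive g x"
  have F: "continuous_on {0..H} ?F" by (intro continuous_intros primitive_continuous g)
  have "L2_inner (leb H) g \<phi> = ?F H * \<phi> H - ?F 0 * \<phi> 0 - L2_inner (leb H) ?F (deriv \<phi>)"
    by (rule primitive_plus_const_by_parts[OF H g D(1,2)]) simp
  moreover have "L2_inner (leb H) f (deriv \<phi>) = L2_inner (leb H) ?F (deriv \<phi>)"
    using ae by (intro L2_inner_cong_AE L2_measurable f L2_continuous F D) auto
  ultimately show "(\<integral>x. f x * deriv \<phi> x \<partial>leb H) = - (\<integral>x. g x * \<phi> x \<partial>leb H)"
    using D by (simp add: L2_inner_def)
qed

lemma has_weak_deriv_primitive:
  assumes H: "H > 0" and wd: "has_weak_deriv H f g"
  shows "\<exists>c. AE x in leb H. f x = c + primitive g x"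
proof -
  have f: "f \<in> L2_space (leb H)" and g: "g \<in> L2_space (leb H)"
    using wd by (auto simp: has_weak_deriv_def)
  have "\<exists>C. AE x in leb H. (f - primitive g) x = C"
  proof (rule du_Bois_Reymond[OF H])
    show "f - primitive g \<in> L2_space (leb H)" by (intro L2_diff f prim_L2 g)
    fix \<phi> assume t: "test_function H \<phi>"
    note D = test_functionD[OF t]
    have "L2_inner (leb H) g \<phi> = primitive g H * \<phi> H - L2_inner (leb H) (primitive g) (deriv \<phi>)"
      by (rule primitive_by_parts[OF H g D(1,2)])
    moreover have "L2_inner (leb H) f (deriv \<phi>) = - L2_inner (leb H) g \<phi>"
      using wd t by (simp add: has_weak_deriv_def L2_inner_def)
    ultimately show "L2_inner (leb H) (f - primitive g) (deriv \<phi>) = 0"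
      using D by (simp add: L2_inner_diff f prim_L2 g L2_continuous)
  qed
  then obtain C where "AE x in leb H. (f - primitive g) x = C" by blast
  then have "AE x in leb H. f x = C + primitive g x" by eventually_elim auto
  then show ?thesis by blast
qed

lemma has_weak_deriv_unique:
  assumes H: "H > 0" and 1: "has_weak_deriv H f g" and 2: "has_weak_deriv H f h"
  shows "AE x in leb H. g x = h x"
proof -
  have g: "g \<in> L2_space (leb H)" and h: "h \<in> L2_space (leb H)"
    using 1 2 by (auto simp: has_weak_deriv_def)
  have "AE x in leb H. (g - h) x = 0"
  proof (rule bumps_orthogonal_imp_null[OF H L2_diff[OF g h]])
    fix \<psi> assume p: "\<psi> \<in> bumps H"
    then have "test_function H \<psi>" by (rule bumps_test_function[OF H])
    then have "L2_inner (leb H) g \<psi> = L2_inner (leb H) h \<psi>"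
      using 1 2 by (simp add: has_weak_deriv_def L2_inner_def)
    then show "L2_inner (leb H) (g - h) \<psi> = 0"
      by (simp add: L2_inner_diff g h bumps_L2[OF p])
  qed
  then show ?thesis by simp
qed

lemma wderiv:
  assumes "has_weak_deriv H f g"
  shows "has_weak_deriv H f (wderiv H f)"
  using someI[of "has_weak_deriv H f", OF assms] by (simp add: wderiv_def)

context mixed_problem
begin

text \<open>The component of the domain of the operator that belongs to the boundary condition \<open>d\<close>.\<close>

definition laplace_dom :: "(real \<Rightarrow> real) set" where
  "laplace_dom = {f \<in> H2_space H. has_trace H (wderiv H f) 0 0 \<and>
     (if d then has_trace H f H 0 else has_trace H (wderiv H f) H 0)}"

text \<open>Membership in the domain means that \<open>f\<close> is a twofold indefinite integral of its second derivative;
  the trace at \<open>0\<close> removes the linear term and the trace at \<open>H\<close> becomes a condition on point values.\<close>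

lemma laplace_domD:
  assumes f: "f \<in> laplace_dom"
  defines "v \<equiv> wderiv H (wderiv H f)"
  shows "f \<in> L2" "v \<in> L2"
    "\<exists>c. (AE x in leb H. f x = c + primitive (primitive v) x) \<and> boundary_cond (\<lambda>x. c + primitive (primitive v) x) (primitive v)"
proof -
  let ?g = "wderiv H f"
  have fg: "has_weak_deriv H f ?g" and gv: "has_weak_deriv H ?g v"
    using f wderiv unfolding laplace_dom_def H2_space_def H1_space_def v_def by blast+
  show fL: "f \<in> L2" and vL: "v \<in> L2"
    using fg gv by (auto simp: has_weak_deriv_def)
  have gL: "?g \<in> L2" using fg by (auto simp: has_weak_deriv_def)
  have pv: "primitive v \<in> L2" by (rule prim_L2[OF vL])
  obtain c1 where c1: "AE x in leb H. ?g x = c1 + primitive v x" using has_weak_deriv_primitive[OF H_pos gv] by blast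
  obtain c where c: "AE x in leb H. f x = c + primitive ?g x" using has_weak_deriv_primitive[OF H_pos fg] by blast
  have "has_trace H ?g 0 0" using f by (simp add: laplace_dom_def)
  moreover have "continuous_on {0..H} (\<lambda>x. c1 + primitive v x)"
    by (intro continuous_on_add continuous_on_const primitive_continuous vL)
  ultimately have "c1 = 0"
    using has_trace_iff[OF H_pos _ c1, of 0 0] H_pos by simp
  with c1 have g_ae: "AE x in leb H. ?g x = primitive v x" by simp
  have pg: "primitive ?g x = primitive (primitive v) x" if "x \<in> {0..H}" for x
    using primitive_cong_AE[OF gL pv g_ae] that by simp
  have "AE x in leb H. 0 < x \<and> x < H" by (rule AE_leb_all) auto
  with c have f_ae: "AE x in leb H. f x = c + primitive (primitive v) x"
    by eventually_elim (simp add: pg)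
  have F: "continuous_on {0..H} (\<lambda>x. c + primitive (primitive v) x)"
    by (intro continuous_on_add continuous_on_const primitive_continuous pv)
  have "boundary_cond (\<lambda>x. c + primitive (primitive v) x) (primitive v)"
    using f has_trace_iff[OF H_pos F f_ae, of H 0]
      has_trace_iff[OF H_pos primitive_continuous[OF vL] g_ae, of H 0] H_pos
    by (auto simp: laplace_dom_def boundary_cond_def split: if_splits)
  with f_ae show "\<exists>c. (AE x in leb H. f x = c + primitive (primitive v) x) \<and> boundary_cond (\<lambda>x. c + primitive (primitive v) x) (primitive v)"
    by blast
qed

lemma laplace_domI:
  assumes f: "f \<in> L2" and v: "v \<in> L2"
    and f_ae: "AE x in leb H. f x = c + primitive (primitive v) x"
    and bc: "boundary_cond (\<lambda>x. c + primitive (primitive v) x) (primitive v)"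
  shows "f \<in> laplace_dom" "AE x in leb H. wderiv H (wderiv H f) x = v x"
proof -
  let ?g = "wderiv H f"
  have pv: "primitive v \<in> L2" by (rule prim_L2[OF v])
  have f1: "has_weak_deriv H f (primitive v)" by (rule primitive_has_weak_deriv[OF H_pos f pv f_ae])
  have fg: "has_weak_deriv H f ?g" by (rule wderiv[OF f1])
  have g_ae: "AE x in leb H. ?g x = primitive v x" by (rule has_weak_deriv_unique[OF H_pos fg f1])
  have gL: "?g \<in> L2" using fg by (simp add: has_weak_deriv_def)
  have gv: "has_weak_deriv H ?g v"
    by (rule primitive_has_weak_deriv[OF H_pos gL v, of 0]) (use g_ae in simp)
  show "AE x in leb H. wderiv H ?g x = v x"
    by (rule has_weak_deriv_unique[OF H_pos wderiv[OF gv] gv])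
  have F: "continuous_on {0..H} (\<lambda>x. c + primitive (primitive v) x)"
    by (intro continuous_on_add continuous_on_const primitive_continuous pv)
  note G = primitive_continuous[OF v]
  show "f \<in> laplace_dom"
    using has_trace_iff[OF H_pos F f_ae, of H 0] has_trace_iff[OF H_pos G g_ae, of H 0]
      has_trace_iff[OF H_pos G g_ae, of 0 0] H_pos bc fg gv
    by (auto simp: laplace_dom_def boundary_cond_def H2_space_def H1_space_def split: if_splits)
qed

end

section \<open>The heat semigroup on coefficients\<close>

context mixed_problem
begin

definition series :: "(nat \<Rightarrow> real) \<Rightarrow> real \<Rightarrow> real" where
  "series b x = (\<Sum>k. b k * eigf k x)"

lemma eigf_bound: "\<bar>eigf k x\<bar> \<le> 1 / sqrt (H / 2)"
proof -
  have "sqrt (H / 2) \<le> cosnorm k" using H_pos by (simp add: cosnorm_def)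
  then have "1 / cosnorm k \<le> 1 / sqrt (H / 2)"
    using H_pos by (intro divide_left_mono) (auto simp: cosnorm_pos)
  moreover have "\<bar>eigf k x\<bar> \<le> 1 / cosnorm k"
    using cosnorm_pos[of k] by (simp add: eigf_def cosk_def abs_mult divide_right_mono)
  ultimately show ?thesis by linarith
qed

lemma
  assumes b: "summable (\<lambda>k. \<bar>b k\<bar>)"
  shows series_L2: "series b \<in> L2"
    and coef_series: "coef (series b) k = b k"
proof -
  let ?B = "1 / sqrt (H / 2)"
  define s where "s n = (\<Sum>k<n. b k *\<^sub>R eigf k)" for n
  have s_apply: "s n x = (\<Sum>k<n. b k * eigf k x)" for n x
    unfolding s_def by (induction n) auto
  have le: "\<bar>b k * eigf k x\<bar> \<le> ?B * \<bar>b k\<bar>" for k x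
    using mult_left_mono[OF eigf_bound[of k x], of "\<bar>b k\<bar>"] by (simp add: abs_mult mult.commute)
  have sb: "summable (\<lambda>k. ?B * \<bar>b k\<bar>)" using b by (rule summable_mult)
  have ul: "uniform_limit UNIV s (series b) sequentially"
    unfolding s_apply[abs_def] series_def[abs_def]
    by (rule Weierstrass_m_test[OF _ sb]) (simp only: real_norm_def le)
  have sc: "continuous_on UNIV (s n)" for n
    unfolding s_apply[abs_def] by (intro continuous_intros eigf_continuous)
  have ev: "\<forall>\<^sub>F n in sequentially. continuous_on UNIV (s n)"
    by (rule always_eventually, rule allI, rule sc)
  have c: "continuous_on UNIV (series b)"
    by (rule uniform_limit_theorem[OF ev ul trivial_limit_sequentially])
  show L: "series b \<in> L2"
    by (rule L2_continuous[OF continuous_on_subset[OF c subset_UNIV]])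
  have sL: "s n \<in> L2" for n unfolding s_def by (rule combination_L2)
  have "(\<lambda>n. norm2 (s n - series b)) \<longlonglongrightarrow> 0"
  proof (rule L2_dominated_convergence(3))
    show "(\<lambda>x. \<Sum>k. ?B * \<bar>b k\<bar>) \<in> L2" by (rule L2_const)
    show "AE x in leb H. \<bar>s n x\<bar> \<le> (\<Sum>k. ?B * \<bar>b k\<bar>)" for n
    proof (rule AE_leb_all)
      fix x
      have "\<bar>s n x\<bar> \<le> (\<Sum>k<n. \<bar>b k * eigf k x\<bar>)" unfolding s_apply by (rule sum_abs)
      also have "\<dots> \<le> (\<Sum>k<n. ?B * \<bar>b k\<bar>)" by (intro sum_mono le)
      also have "\<dots> \<le> (\<Sum>k. ?B * \<bar>b k\<bar>)"
        by (rule sum_le_suminf[OF sb]) (auto simp: H_pos less_imp_le)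
      finally show "\<bar>s n x\<bar> \<le> (\<Sum>k. ?B * \<bar>b k\<bar>)" .
    qed
    show "AE x in leb H. (\<lambda>n. s n x) \<longlonglongrightarrow> series b x"
      by (rule AE_leb_all) (rule tendsto_uniform_limitI[OF ul], simp)
  qed (auto intro: L2_measurable L sL)
  then have "(\<lambda>n. coef (s n - series b) k) \<longlonglongrightarrow> 0"
    by (rule Lim_null_comparison[rotated])
       (rule always_eventually, rule allI, simp only: real_norm_def coef_le_norm[OF L2_diff[OF sL L]])
  moreover have "\<forall>\<^sub>F n in sequentially. coef (s n - series b) k = b k - coef (series b) k"
    using eventually_gt_at_top[of k]
  proof eventually_elim
    case (elim n)
    then have "coef (s n) k = b k" unfolding s_def coef_combination by simp
    then show ?case unfolding coef_diff[OF sL L] by simp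
  qed
  ultimately have "(\<lambda>n::nat. b k - coef (series b) k) \<longlonglongrightarrow> 0"
    by (rule Lim_transform_eventually)
  then show "coef (series b) k = b k" by (simp add: LIMSEQ_const_iff)
qed

lemma summable_coef_power2: "f \<in> L2 \<Longrightarrow> summable (\<lambda>k. (coef f k)\<^sup>2)"
  using parseval by (rule sums_summable)

lemma norm_le_of_coef:
  assumes f: "f \<in> L2" and g: "g \<in> L2"
    and le: "\<And>k. \<bar>coef f k\<bar> \<le> \<bar>coef g k\<bar>"
  shows "norm2 f \<le> norm2 g"
proof (rule power2_le_imp_le)
  show "(norm2 f)\<^sup>2 \<le> (norm2 g)\<^sup>2"
    by (rule sums_le[OF _ parseval[OF f] parseval[OF g]]) (use le in \<open>simp add: abs_le_square_iff\<close>)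
qed simp

text \<open>Convergence of each coefficient suffices if the factors \<open>g\<close> are uniformly bounded: by Parseval the
  squared norm is a series to which dominated convergence applies. Strong continuity,
  differentiability, the generator and the exponential formula are all instances.\<close>

lemma spectral_convergence:
  assumes u: "\<forall>\<^sub>F s in F. u s \<in> L2 \<and> (\<forall>k. coef (u s) k = g s k * b k \<and> \<bar>g s k\<bar> \<le> M)"
    and b: "summable (\<lambda>k. (b k)\<^sup>2)"
    and lim: "\<And>k. ((\<lambda>s. g s k) \<longlongrightarrow> 0) F"
  shows "((\<lambda>s. norm2 (u s)) \<longlongrightarrow> 0) F"
proof (cases "F = bot")
  case False
  have "((\<lambda>s. \<Sum>k. (g s k * b k)\<^sup>2) \<longlongrightarrow> (\<Sum>k. 0)) F"
  proof (rule tannerys_theorem[THEN conjunct2, THEN conjunct2, OF _ _ _ False])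
    show "((\<lambda>s. (g s k * b k)\<^sup>2) \<longlongrightarrow> 0) F" for k
      using tendsto_power[OF tendsto_mult_left_zero[OF lim[of k], of "b k"], of 2] by simp
    show "\<forall>\<^sub>F (k, s) in at_top \<times>\<^sub>F F. norm ((g s k * b k)\<^sup>2) \<le> M\<^sup>2 * (b k)\<^sup>2"
    proof -
      have "\<forall>\<^sub>F (k::nat, s) in at_top \<times>\<^sub>F F. \<forall>j. \<bar>g s j\<bar> \<le> M"
        using u by (subst eventually_prod2) (auto elim: eventually_mono)
      then show ?thesis
      proof (rule eventually_mono, clarify)
        fix k s assume "\<forall>j. \<bar>g s j\<bar> \<le> M"
        then have "\<bar>g s k\<bar> \<le> \<bar>M\<bar>" by (meson abs_ge_self order_trans)
        then have "(g s k)\<^sup>2 \<le> M\<^sup>2" by (simp only: abs_le_square_iff)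
        then show "norm ((g s k * b k)\<^sup>2) \<le> M\<^sup>2 * (b k)\<^sup>2"
          by (simp add: power_mult_distrib mult_right_mono)
      qed
    qed
    show "summable (\<lambda>k. M\<^sup>2 * (b k)\<^sup>2)" using b by (rule summable_mult)
  qed
  then have "((\<lambda>s. sqrt (\<Sum>k. (g s k * b k)\<^sup>2)) \<longlongrightarrow> 0) F"
    using tendsto_real_sqrt by fastforce
  moreover have "\<forall>\<^sub>F s in F. sqrt (\<Sum>k. (g s k * b k)\<^sup>2) = norm2 (u s)"
    using u
  proof eventually_elim
    case (elim s)
    then have "(\<lambda>k. (g s k * b k)\<^sup>2) sums (norm2 (u s))\<^sup>2"
      using parseval[of "u s"] by simp
    then show ?case by (simp add: sums_iff)
  qed
  ultimately show ?thesis by (rule Lim_transform_eventually)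
qed simp

end

lemma mult_exp_le: "x \<ge> 0 \<Longrightarrow> t > 0 \<Longrightarrow> x * exp (- x * t) \<le> 1 / (t :: real)"
proof -
  assume "x \<ge> 0" "t > 0"
  have "x * t \<le> exp (x * t)" using exp_ge_add_one_self[of "x * t"] by linarith
  then have "x * t * exp (- x * t) \<le> exp (x * t) * exp (- x * t)" by (intro mult_right_mono) auto
  also have "\<dots> = 1" by (simp add: exp_add[symmetric])
  finally show ?thesis using \<open>t > 0\<close> by (simp add: field_simps)
qed

lemma eventually_at_within_Ioi:
  assumes "t > (0::real)" "\<And>s. s > t / 2 \<Longrightarrow> s \<noteq> t \<Longrightarrow> P s"
  shows "\<forall>\<^sub>F s in at t within {0<..}. P s"
proof -
  have "\<forall>\<^sub>F s in nhds t. s > t / 2" using assms(1) by (intro order_tendstoD(1)[OF filterlim_ident]) auto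
  then show ?thesis unfolding eventually_at_filter by eventually_elim (use assms(2) in auto)
qed

lemma exp_diff_le:
  fixes x a b :: real
  assumes "x \<ge> 0" "a \<le> b"
  shows "0 \<le> exp (- x * a) - exp (- x * b)" "exp (- x * a) - exp (- x * b) \<le> x * exp (- x * a) * (b - a)"
proof -
  have e: "exp (- x * b) = exp (- x * a) * exp (- (x * (b - a)))"
    by (simp add: exp_add[symmetric] algebra_simps)
  show "0 \<le> exp (- x * a) - exp (- x * b)" using assms by (simp add: mult_left_mono)
  have "exp (- x * a) * (1 - x * (b - a)) \<le> exp (- x * a) * exp (- (x * (b - a)))"
    using exp_ge_add_one_self[of "- (x * (b - a))"] by (intro mult_left_mono) auto
  then show "exp (- x * a) - exp (- x * b) \<le> x * exp (- x * a) * (b - a)"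
    unfolding e by (simp add: algebra_simps)
qed

text \<open>The operator \<open>u'' - \<kappa> u\<close>. Absorbing the decay rate into the eigenvalues lets one construction serve
  both diffusing components and every shift \<open>\<nu>\<close>.\<close>

locale heat_problem = mixed_problem +
  fixes \<kappa> :: real
  assumes kappa_nonneg: "\<kappa> \<ge> 0"
begin

text \<open>The eigenvalues of \<open>- u'' + \<kappa> u\<close>.\<close>

definition lam :: "nat \<Rightarrow> real" where
  "lam k = (freq k)\<^sup>2 + \<kappa>"

lemma lam_nonneg: "0 \<le> lam k"
  by (simp add: lam_def kappa_nonneg)

text \<open>Linear growth is all that the summability of \<open>exp (- lam k * t)\<close> needs: it follows by comparison with a
  geometric series.\<close>

lemma lam_ge: "(pi / H)\<^sup>2 * real k \<le> lam k"
proof -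
  define \<delta> :: real where "\<delta> = (if d then 1/2 else 0)"
  have "real k \<le> (real k + \<delta>)\<^sup>2"
  proof (cases k)
    case (Suc n)
    have "real k * 1 \<le> (real k + \<delta>) * (real k + \<delta>)"
      by (intro mult_mono) (auto simp: \<delta>_def Suc)
    then show ?thesis by (simp add: power2_eq_square)
  qed simp
  then have "(pi / H)\<^sup>2 * real k \<le> (pi / H)\<^sup>2 * (real k + \<delta>)\<^sup>2"
    by (intro mult_left_mono) auto
  also have "\<dots> = (freq k)\<^sup>2"
    by (simp add: freq_def \<delta>_def power_mult_distrib power_divide)
  finally show ?thesis using kappa_nonneg by (simp add: lam_def)
qed

lemma summable_exp_lam:
  assumes "t > 0"
  shows "summable (\<lambda>k. exp (- lam k * t))"
proof (rule summable_comparison_test')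
  let ?q = "exp (- ((pi / H)\<^sup>2 * t))"
  have "?q < 1" using assms H_pos by simp
  then show "summable (\<lambda>k. ?q ^ k)" by (intro summable_geometric) simp
  show "norm (exp (- lam k * t)) \<le> ?q ^ k" if "k \<ge> 0" for k
    using mult_right_mono[OF lam_ge[of k], of t] assms
    by (simp add: exp_of_nat_mult[symmetric] mult.commute mult.left_commute)
qed

lemma
  assumes t: "t > 0" and f: "f \<in> L2"
  shows summable_heat_coef: "summable (\<lambda>k. \<bar>exp (- lam k * t) * coef f k\<bar>)"
    and summable_heat_coef': "summable (\<lambda>k. \<bar>- lam k * exp (- lam k * t) * coef f k\<bar>)"
proof -
  let ?N = "norm2 f"
  show "summable (\<lambda>k. \<bar>exp (- lam k * t) * coef f k\<bar>)"
  proof (rule summable_comparison_test')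
    show "summable (\<lambda>k. exp (- lam k * t) * ?N)"
      by (intro summable_mult2 summable_exp_lam t)
    show "norm \<bar>exp (- lam k * t) * coef f k\<bar> \<le> exp (- lam k * t) * ?N" if "k \<ge> 0" for k
      using coef_le_norm[OF f, of k] by (simp add: abs_mult)
  qed
  show "summable (\<lambda>k. \<bar>- lam k * exp (- lam k * t) * coef f k\<bar>)"
  proof (rule summable_comparison_test')
    show "summable (\<lambda>k. 2 / t * exp (- lam k * (t / 2)) * ?N)"
      using t by (intro summable_mult2 summable_mult summable_exp_lam) simp
    show "norm \<bar>- lam k * exp (- lam k * t) * coef f k\<bar> \<le> 2 / t * exp (- lam k * (t / 2)) * ?N"
      if "k \<ge> 0" for k
    proof -
      have e: "exp (- lam k * t) = exp (- lam k * (t / 2)) * exp (- lam k * (t / 2))"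
        by (simp add: exp_add[symmetric])
      have "lam k * exp (- lam k * (t / 2)) \<le> 2 / t"
        using mult_exp_le[OF lam_nonneg, of "t/2" k] t by simp
      then have "(lam k * exp (- lam k * (t / 2))) * exp (- lam k * (t / 2)) \<le> 2 / t * exp (- lam k * (t / 2))"
        by (intro mult_right_mono) auto
      then have "lam k * exp (- lam k * t) \<le> 2 / t * exp (- lam k * (t / 2))"
        unfolding e by (simp only: mult.assoc)
      then have "(lam k * exp (- lam k * t)) * \<bar>coef f k\<bar> \<le> (2 / t * exp (- lam k * (t / 2))) * ?N"
        by (rule mult_mono[OF _ coef_le_norm[OF f]]) (use t in auto)
      then show ?thesis using lam_nonneg[of k] by (simp add: abs_mult)
    qed
  qed
qed

text \<open>For positive times the series converges uniformly and selects a continuous representative. At time zero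
  it need not converge pointwise, and the function itself is taken.\<close>

definition heat :: "real \<Rightarrow> (real \<Rightarrow> real) \<Rightarrow> real \<Rightarrow> real" where
  "heat t f = (if t = 0 then f else series (\<lambda>k. exp (- lam k * t) * coef f k))"

definition heat_deriv :: "real \<Rightarrow> (real \<Rightarrow> real) \<Rightarrow> real \<Rightarrow> real" where
  "heat_deriv t f = series (\<lambda>k. - lam k * exp (- lam k * t) * coef f k)"

lemma heat_0: "heat 0 f = f"
  by (simp add: heat_def)

lemma heat_L2: "t \<ge> 0 \<Longrightarrow> f \<in> L2 \<Longrightarrow> heat t f \<in> L2"
  using series_L2[OF summable_heat_coef, of t f] by (simp add: heat_def)

lemma coef_heat:
  "t \<ge> 0 \<Longrightarrow> f \<in> L2 \<Longrightarrow> coef (heat t f) k = exp (- lam k * t) * coef f k"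
  using coef_series[OF summable_heat_coef, of t f k] by (simp add: heat_def)

lemma heat_deriv_L2: "t > 0 \<Longrightarrow> f \<in> L2 \<Longrightarrow> heat_deriv t f \<in> L2"
  unfolding heat_deriv_def by (rule series_L2[OF summable_heat_coef'])

lemma coef_heat_deriv:
  "t > 0 \<Longrightarrow> f \<in> L2 \<Longrightarrow> coef (heat_deriv t f) k = - lam k * exp (- lam k * t) * coef f k"
  unfolding heat_deriv_def by (rule coef_series[OF summable_heat_coef'])

lemma exp_lam_le1: "t \<ge> 0 \<Longrightarrow> exp (- lam k * t) \<le> 1"
  using lam_nonneg[of k] by simp

lemma heat_contraction:
  assumes "t \<ge> 0" "f \<in> L2"
  shows "norm2 (heat t f) \<le> norm2 f"
  by (rule norm_le_of_coef)
     (use assms exp_lam_le1[of t] in \<open>auto simp: heat_L2 coef_heat abs_mult intro!: mult_left_le_one_le\<close>)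

lemma heat_continuous:
  assumes f: "f \<in> L2" and t: "t \<ge> 0"
  shows "((\<lambda>s. norm2 (heat s f - heat t f)) \<longlongrightarrow> 0) (at t within {0..})"
proof (rule spectral_convergence[where g = "\<lambda>s k. exp (- lam k * s) - exp (- lam k * t)" and M = 1])
  show "\<forall>\<^sub>F s in at t within {0..}. heat s f - heat t f \<in> L2
    \<and> (\<forall>k. coef (heat s f - heat t f) k = (exp (- lam k * s) - exp (- lam k * t)) * coef f k
      \<and> \<bar>exp (- lam k * s) - exp (- lam k * t)\<bar> \<le> 1)"
    unfolding eventually_at_filter
  proof (rule always_eventually, intro allI impI conjI)
    fix s k assume "s \<in> {0::real..}"
    then have s: "s \<ge> 0" by simp
    show "heat s f - heat t f \<in> L2" by (intro L2_diff heat_L2 s t f)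
    show "coef (heat s f - heat t f) k = (exp (- lam k * s) - exp (- lam k * t)) * coef f k"
      unfolding coef_diff[OF heat_L2[OF s f] heat_L2[OF t f]] coef_heat[OF s f] coef_heat[OF t f]
      by (simp add: left_diff_distrib)
    show "\<bar>exp (- lam k * s) - exp (- lam k * t)\<bar> \<le> 1"
      using exp_lam_le1[OF s, of k] exp_lam_le1[OF t, of k]
        exp_gt_zero[of "- lam k * s"] exp_gt_zero[of "- lam k * t"] by linarith
  qed
  show "((\<lambda>s. exp (- lam k * s) - exp (- lam k * t)) \<longlongrightarrow> 0) (at t within {0..})" for k
  proof -
    have "((\<lambda>s. exp (- lam k * s) - exp (- lam k * t)) \<longlongrightarrow> exp (- lam k * t) - exp (- lam k * t)) (at t within {0..})"
      by (intro tendsto_intros)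
    then show ?thesis by simp
  qed
qed (rule summable_coef_power2[OF f])

lemma heat_deriv_continuous:
  assumes f: "f \<in> L2" and t: "t > 0"
  shows "((\<lambda>s. norm2 (heat_deriv s f - heat_deriv t f)) \<longlongrightarrow> 0) (at t within {0<..})"
proof (rule spectral_convergence[where g = "\<lambda>s k. lam k * exp (- lam k * t) - lam k * exp (- lam k * s)"
      and M = "4 / t"])
  show "\<forall>\<^sub>F s in at t within {0<..}. heat_deriv s f - heat_deriv t f \<in> L2
    \<and> (\<forall>k. coef (heat_deriv s f - heat_deriv t f) k
        = (lam k * exp (- lam k * t) - lam k * exp (- lam k * s)) * coef f k
      \<and> \<bar>lam k * exp (- lam k * t) - lam k * exp (- lam k * s)\<bar> \<le> 4 / t)"
  proof (rule eventually_at_within_Ioi[OF t], intro allI conjI)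
    fix s k assume st: "s > t / 2"
    then have s: "s > 0" using t by linarith
    show "heat_deriv s f - heat_deriv t f \<in> L2" by (intro L2_diff heat_deriv_L2 s t f)
    show "coef (heat_deriv s f - heat_deriv t f) k
        = (lam k * exp (- lam k * t) - lam k * exp (- lam k * s)) * coef f k"
      unfolding coef_diff[OF heat_deriv_L2[OF s f] heat_deriv_L2[OF t f]]
        coef_heat_deriv[OF s f] coef_heat_deriv[OF t f]
      by (simp add: left_diff_distrib)
    have "1 / s \<le> 2 / t" using st s t by (simp add: field_simps)
    moreover have "1 / t \<le> 2 / t" "4 / t = 2 / t + 2 / t" using t by (auto simp: field_simps)
    moreover have "0 \<le> lam k * exp (- lam k * t)" "0 \<le> lam k * exp (- lam k * s)"
      using lam_nonneg by auto
    ultimately show "\<bar>lam k * exp (- lam k * t) - lam k * exp (- lam k * s)\<bar> \<le> 4 / t"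
      using mult_exp_le[OF lam_nonneg s, of k] mult_exp_le[OF lam_nonneg t, of k] by linarith
  qed
  show "((\<lambda>s. lam k * exp (- lam k * t) - lam k * exp (- lam k * s)) \<longlongrightarrow> 0) (at t within {0<..})" for k
  proof -
    have "((\<lambda>s. lam k * exp (- lam k * t) - lam k * exp (- lam k * s))
      \<longlongrightarrow> lam k * exp (- lam k * t) - lam k * exp (- lam k * t)) (at t within {0<..})"
      by (intro tendsto_intros)
    then show ?thesis by simp
  qed
qed (rule summable_coef_power2[OF f])

text \<open>The difference quotients of \<open>exp (- lam k * t)\<close> are bounded uniformly in \<open>k\<close> away from \<open>t = 0\<close>,
  because \<open>x exp (- x t)\<close> never exceeds \<open>1 / t\<close>. This is the smoothing effect, for arbitrary square
  integrable initial values.\<close>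

lemma heat_differentiable:
  assumes f: "f \<in> L2" and t: "t > 0"
  shows "((\<lambda>s. norm2 ((1 / (s - t)) *\<^sub>R (heat s f - heat t f) - heat_deriv t f)) \<longlongrightarrow> 0)
    (at t within {0<..})"
proof (rule spectral_convergence[where M = "3 / t" and g = "\<lambda>s k.
    (exp (- lam k * s) - exp (- lam k * t)) / (s - t) + lam k * exp (- lam k * t)"])
  let ?u = "\<lambda>s. (1 / (s - t)) *\<^sub>R (heat s f - heat t f) - heat_deriv t f"
  let ?g = "\<lambda>s k. (exp (- lam k * s) - exp (- lam k * t)) / (s - t) + lam k * exp (- lam k * t)"
  show "\<forall>\<^sub>F s in at t within {0<..}. ?u s \<in> L2
    \<and> (\<forall>k. coef (?u s) k = ?g s k * coef f k \<and> \<bar>?g s k\<bar> \<le> 3 / t)"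
  proof (rule eventually_at_within_Ioi[OF t], intro allI conjI)
    fix s k assume st: "s > t / 2" "s \<noteq> t"
    then have s: "s > 0" using t by linarith
    have sL: "heat s f \<in> L2" and tL: "heat t f \<in> L2"
      using s t by (auto intro: heat_L2 f)
    have dL: "heat_deriv t f \<in> L2" by (rule heat_deriv_L2[OF t f])
    show "?u s \<in> L2" by (intro L2_diff L2_scaleR sL tL dL)
    show "coef (?u s) k = ?g s k * coef f k"
      unfolding coef_diff[OF L2_scaleR[OF L2_diff[OF sL tL]] dL] coef_scaleR coef_diff[OF sL tL]
        coef_heat[OF less_imp_le[OF s] f] coef_heat[OF less_imp_le[OF t] f] coef_heat_deriv[OF t f]
      by (simp add: divide_inverse algebra_simps)
    have 1: "\<bar>exp (- lam k * s) - exp (- lam k * t)\<bar> \<le> 2 / t * \<bar>s - t\<bar>"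
    proof (cases "s \<le> t")
      case True
      have "lam k * exp (- lam k * s) \<le> 1 / s" by (rule mult_exp_le[OF lam_nonneg s])
      also have "\<dots> \<le> 2 / t" using st s t by (simp add: field_simps)
      finally have "lam k * exp (- lam k * s) * (t - s) \<le> 2 / t * (t - s)"
        using True by (intro mult_right_mono) auto
      then show ?thesis using exp_diff_le[OF lam_nonneg True, of k] True by simp
    next
      case False
      have "lam k * exp (- lam k * t) \<le> 1 / t" by (rule mult_exp_le[OF lam_nonneg t])
      also have "\<dots> \<le> 2 / t" using t by (simp add: field_simps)
      finally have "lam k * exp (- lam k * t) * (s - t) \<le> 2 / t * (s - t)"
        using False by (intro mult_right_mono) auto
      then show ?thesis using exp_diff_le[OF lam_nonneg, of t s k] False by simp
    qed
    have "\<bar>(exp (- lam k * s) - exp (- lam k * t)) / (s - t)\<bar> \<le> 2 / t"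
      using 1 st by (simp add: abs_divide pos_divide_le_eq)
    moreover have "0 \<le> lam k * exp (- lam k * t)" using lam_nonneg by auto
    moreover have "3 / t = 2 / t + 1 / t" by (simp add: add_divide_distrib[symmetric])
    ultimately show "\<bar>?g s k\<bar> \<le> 3 / t"
      using mult_exp_le[OF lam_nonneg t, of k] by linarith
  qed
  show "((\<lambda>s. ?g s k) \<longlongrightarrow> 0) (at t within {0<..})" for k
  proof -
    have "((\<lambda>s. exp (- lam k * s)) has_real_derivative - lam k * exp (- lam k * t)) (at t within {0<..})"
      by (auto intro!: derivative_eq_intros)
    then have "((\<lambda>s. (exp (- lam k * s) - exp (- lam k * t)) / (s - t))
        \<longlongrightarrow> - lam k * exp (- lam k * t)) (at t within {0<..})"
      by (simp add: has_field_derivative_iff)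
    from tendsto_add[OF this tendsto_const[of "lam k * exp (- lam k * t)"]] show ?thesis by simp
  qed
qed (rule summable_coef_power2[OF f])

end

section \<open>The generator\<close>

context heat_problem
begin

lemma heat_semigroup: "C0_semigroup (L2) (norm2) heat"
  unfolding C0_semigroup_def bounded_op_def
proof (intro conjI allI impI ballI)
  fix t :: real assume t: "t \<ge> 0"
  show "heat t u \<in> L2" if "u \<in> L2" for u by (rule heat_L2[OF t that])
  show "norm2 (heat t (u + v) - (heat t u + heat t v)) = 0"
    if u: "u \<in> L2" and v: "v \<in> L2" for u v
  proof (rule L2_norm_eq_0_coef)
    note uv = L2_add[OF u v]
    show "heat t (u + v) - (heat t u + heat t v) \<in> L2"
      by (intro L2_diff L2_add heat_L2 t u v)
    show "coef (heat t (u + v) - (heat t u + heat t v)) k = 0" for k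
      unfolding coef_diff[OF heat_L2[OF t uv] L2_add[OF heat_L2[OF t u] heat_L2[OF t v]]]
        coef_add[OF heat_L2[OF t u] heat_L2[OF t v]] coef_heat[OF t u] coef_heat[OF t v]
        coef_heat[OF t uv] coef_add[OF u v]
      by (simp add: distrib_left)
  qed
  show "norm2 (heat t (c *\<^sub>R u) - c *\<^sub>R heat t u) = 0"
    if u: "u \<in> L2" for c u
  proof (rule L2_norm_eq_0_coef)
    note cu = L2_scaleR[OF u, of c]
    show "heat t (c *\<^sub>R u) - c *\<^sub>R heat t u \<in> L2"
      by (intro L2_diff L2_scaleR heat_L2 t u)
    show "coef (heat t (c *\<^sub>R u) - c *\<^sub>R heat t u) k = 0" for k
      unfolding coef_diff[OF heat_L2[OF t cu] L2_scaleR[OF heat_L2[OF t u]]] coef_scaleR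
        coef_heat[OF t u] coef_heat[OF t cu] by simp
  qed
  show "\<exists>C. \<forall>u\<in>L2. norm2 (heat t u) \<le> C * norm2 u"
    using heat_contraction[OF t] by (intro exI[of _ 1]) simp
next
  fix u assume u: "u \<in> L2"
  show "norm2 (heat 0 u - u) = 0" by (simp add: heat_0 L2_norm_def)
  show "((\<lambda>t. norm2 (heat t u - u)) \<longlongrightarrow> 0) (at_right 0)"
    using tendsto_within_subset[OF heat_continuous[OF u order_refl], of "{0<..}"]
    by (simp add: heat_0 subset_iff)
  show "norm2 (heat (s + t) u - heat s (heat t u)) = 0" if s: "s \<ge> 0" and t: "t \<ge> 0" for s t
  proof (rule L2_norm_eq_0_coef)
    have st: "s + t \<ge> 0" using s t by simp
    note tu = heat_L2[OF t u]
    show "heat (s + t) u - heat s (heat t u) \<in> L2"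
      by (intro L2_diff heat_L2 st s t u)
    show "coef (heat (s + t) u - heat s (heat t u)) k = 0" for k
      unfolding coef_diff[OF heat_L2[OF st u] heat_L2[OF s tu]] coef_heat[OF st u] coef_heat[OF s tu]
        coef_heat[OF t u]
      by (simp add: distrib_left mult.assoc[symmetric] mult_exp_exp)
  qed
qed

lemma heat_C0_curve:
  "u \<in> L2 \<Longrightarrow> C0_curve (L2) (norm2) {0..} (\<lambda>t. heat t u)"
  by (auto simp: C0_curve_def heat_L2 heat_continuous)

lemma heat_C1_curve:
  assumes u: "u \<in> L2"
  shows "C1_curve (L2) (norm2) {0<..} (\<lambda>t. heat t u)"
proof -
  have "C0_curve (L2) (norm2) {0<..} (\<lambda>t. heat t u)"
    unfolding C0_curve_def
    by (auto intro!: heat_L2 u tendsto_within_subset[OF heat_continuous[OF u], of _ "{0<..}"])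
  moreover have "C0_curve (L2) (norm2) {0<..} (\<lambda>t. heat_deriv t u)"
    unfolding C0_curve_def by (auto intro!: heat_deriv_L2 heat_deriv_continuous u)
  ultimately show ?thesis
    unfolding C1_curve_def using heat_differentiable[OF u] by auto
qed

text \<open>From left to right, coefficients are continuous functionals. From right to left, the
  factor \<open>1 + lam k\<close> splits off the square summable coefficients of \<open>u - v\<close>, and the remaining factor is
  bounded by one.\<close>

lemma generator_coef:
  assumes u: "u \<in> L2" and v: "v \<in> L2"
  shows "(u, v) \<in> generator (L2) (norm2) heat
    \<longleftrightarrow> (\<forall>k. coef v k = - lam k * coef u k)"
proof -
  let ?w = "\<lambda>t. (1 / t) *\<^sub>R (heat t u - u) - v"
  have wL: "?w t \<in> L2" if "t > 0" for t
    using that by (intro L2_diff L2_scaleR heat_L2 u v) auto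
  have cw: "coef (?w t) k = (exp (- lam k * t) - 1) / t * coef u k - coef v k" if "t > 0" for t k
  proof -
    have t: "t \<ge> 0" using that by simp
    note hu = heat_L2[OF t u]
    show ?thesis
      unfolding coef_diff[OF L2_scaleR[OF L2_diff[OF hu u]] v] coef_scaleR coef_diff[OF hu u]
        coef_heat[OF t u] by (simp add: left_diff_distrib)
  qed
  have der: "((\<lambda>t. (exp (- lam k * t) - 1) / t) \<longlongrightarrow> - lam k) (at_right 0)" for k
  proof -
    have "((\<lambda>t. exp (- lam k * t)) has_real_derivative - lam k) (at 0 within {0<..})"
      by (auto intro!: derivative_eq_intros)
    then show ?thesis by (simp add: has_field_derivative_iff)
  qed
  have pos: "\<forall>\<^sub>F t in at_right 0. (t::real) > 0" by (simp add: eventually_at_right_less)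
  show ?thesis
  proof
    assume "(u, v) \<in> generator (L2) (norm2) heat"
    then have lim: "((\<lambda>t. norm2 (?w t)) \<longlongrightarrow> 0) (at_right 0)"
      by (simp add: generator_def)
    show "\<forall>k. coef v k = - lam k * coef u k"
    proof
      fix k
      have "((\<lambda>t. coef (?w t) k) \<longlongrightarrow> 0) (at_right 0)"
      proof (rule Lim_null_comparison[OF _ lim])
        show "\<forall>\<^sub>F t in at_right 0. norm (coef (?w t) k) \<le> norm2 (?w t)"
          using pos by eventually_elim (simp add: coef_le_norm[OF wL])
      qed
      moreover have "\<forall>\<^sub>F t in at_right 0. coef (?w t) k = (exp (- lam k * t) - 1) / t * coef u k - coef v k"
        using pos by eventually_elim (rule cw)
      ultimately have "((\<lambda>t. (exp (- lam k * t) - 1) / t * coef u k - coef v k) \<longlongrightarrow> 0) (at_right 0)"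
        by (rule Lim_transform_eventually)
      moreover have "((\<lambda>t. (exp (- lam k * t) - 1) / t * coef u k - coef v k)
          \<longlongrightarrow> - lam k * coef u k - coef v k) (at_right 0)"
        by (intro tendsto_intros der)
      ultimately have "- lam k * coef u k - coef v k = 0"
        by (intro tendsto_unique[OF trivial_limit_at_right_real])
      then show "coef v k = - lam k * coef u k" by simp
    qed
  next
    assume cv: "\<forall>k. coef v k = - lam k * coef u k"
    \<comment> \<open>the coefficients of \<open>u - v\<close> are \<open>1 + lam k\<close> times those of \<open>u\<close>\<close>
    let ?g = "\<lambda>t k. ((exp (- lam k * t) - 1) / t + lam k) / (1 + lam k)"
    have pl: "1 + lam k > 0" for k using lam_nonneg[of k] by linarith
    have "((\<lambda>t. norm2 (?w t)) \<longlongrightarrow> 0) (at_right 0)"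
    proof (rule spectral_convergence[where g = ?g and M = 1])
      show "summable (\<lambda>k. (coef (u - v) k)\<^sup>2)" by (rule summable_coef_power2[OF L2_diff[OF u v]])
      show "\<forall>\<^sub>F t in at_right 0. ?w t \<in> L2
        \<and> (\<forall>k. coef (?w t) k = ?g t k * coef (u - v) k \<and> \<bar>?g t k\<bar> \<le> 1)"
        using pos
      proof eventually_elim
        case (elim t)
        have "coef (?w t) k = ?g t k * coef (u - v) k \<and> \<bar>?g t k\<bar> \<le> 1" for k
        proof
          have e: "coef (u - v) k = (1 + lam k) * coef u k"
            using cv by (simp add: coef_diff[OF u v] algebra_simps)
          have "?g t k * ((1 + lam k) * coef u k) = ((exp (- lam k * t) - 1) / t + lam k) * coef u k"
            using pl[of k] by simp
          also have "\<dots> = coef (?w t) k"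
            unfolding cw[OF elim] cv[rule_format] by (simp only: distrib_right minus_mult_left diff_minus_eq_add)
          finally show "coef (?w t) k = ?g t k * coef (u - v) k" unfolding e ..
          have "0 \<le> 1 - exp (- lam k * t)" "1 - exp (- lam k * t) \<le> lam k * t"
            using exp_diff_le[OF lam_nonneg, of 0 t k] elim by auto
          then have "0 \<le> (1 - exp (- lam k * t)) / t" "(1 - exp (- lam k * t)) / t \<le> lam k"
            using elim by (auto simp: divide_le_eq)
          moreover have "(exp (- lam k * t) - 1) / t = - ((1 - exp (- lam k * t)) / t)"
            by (simp add: divide_inverse algebra_simps)
          ultimately have "\<bar>(exp (- lam k * t) - 1) / t + lam k\<bar> \<le> 1 + lam k"
            using lam_nonneg[of k] by linarith
          then show "\<bar>?g t k\<bar> \<le> 1" using pl[of k] by (simp add: abs_divide)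
        qed
        then show ?case using wL[OF elim] by blast
      qed
      show "((\<lambda>t. ?g t k) \<longlongrightarrow> 0) (at_right 0)" for k
      proof -
        have "((\<lambda>t. ?g t k) \<longlongrightarrow> (- lam k + lam k) / (1 + lam k)) (at_right 0)"
          using pl[of k] by (intro tendsto_intros der) auto
        then show ?thesis by simp
      qed
    qed
    then show "(u, v) \<in> generator (L2) (norm2) heat"
      by (simp add: generator_def u v)
  qed
qed

lemma coef_cong_AE:
  assumes "f \<in> L2" "g \<in> L2" "AE x in leb H. f x = g x"
  shows "coef f k = coef g k"
  unfolding coef_def using assms by (intro L2_inner_cong_AE L2_measurable eigf_L2)

lemma coef_laplace_dom:
  assumes u: "u \<in> laplace_dom"
  shows "coef (wderiv H (wderiv H u)) k = - (freq k)\<^sup>2 * coef u k"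
proof -
  let ?v = "wderiv H (wderiv H u)"
  note D = laplace_domD[OF u]
  obtain c where ae: "AE x in leb H. u x = c + primitive (primitive ?v) x"
    and bc: "boundary_cond (\<lambda>x. c + primitive (primitive ?v) x) (primitive ?v)" using D(3) by blast
  have FL: "(\<lambda>x. c + primitive (primitive ?v) x) \<in> L2"
    by (intro L2_continuous continuous_on_add continuous_on_const primitive_continuous prim_L2 D(2))
  show ?thesis
    using coef_second_derivative[OF D(2) _ bc, of c k] coef_cong_AE[OF D(1) FL ae, of k] by simp
qed

lemma freq_eq_0: "freq k = 0 \<Longrightarrow> \<not> d \<and> k = 0"
  using H_pos by (auto simp: freq_def split: if_splits)

lemma freq_0_Neumann: "\<not> d \<Longrightarrow> freq 0 = 0"
  unfolding freq_def by simp

lemma eigf_0_Neumann: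
  assumes "\<not> d"
  shows "eigf 0 = (\<lambda>x. 1 / cosnorm 0)"
  unfolding eigf_def scaleR_fun_def cosk_def[abs_def] freq_0_Neumann[OF assms] by simp

text \<open>The twofold integral of \<open>w\<close> has the coefficients of \<open>u\<close> wherever the frequency is not zero. In the
  Dirichlet case this covers all indices, and the constant of integration is fixed by the condition at \<open>H\<close>.
  In the Neumann case the index \<open>0\<close> says that \<open>w\<close> has mean zero, which is the condition at \<open>H\<close>,
  and the constant of integration adjusts the mean of \<open>u\<close>.\<close>

lemma laplace_domI_coef:
  assumes u: "u \<in> L2" and w: "w \<in> L2"
    and c: "\<And>k. coef w k = - (freq k)\<^sup>2 * coef u k"
  shows "u \<in> laplace_dom \<and> (AE x in leb H. wderiv H (wderiv H u) x = w x)"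
proof -
  have pw: "primitive (primitive w) \<in> L2" by (intro prim_L2 w)
  have one: "(\<lambda>x. 1) \<in> L2" by (rule L2_const)
  have F_eq: "(\<lambda>x. a + primitive (primitive w) x) = a *\<^sub>R (\<lambda>x. 1) + primitive (primitive w)" for a :: real
    by (simp add: fun_eq_iff)
  have FL: "(\<lambda>x. a + primitive (primitive w) x) \<in> L2" for a
    unfolding F_eq by (intro L2_add L2_scaleR one pw)
  have "\<exists>a. boundary_cond (\<lambda>x. a + primitive (primitive w) x) (primitive w)
    \<and> (\<forall>k. freq k = 0 \<longrightarrow> coef (\<lambda>x. a + primitive (primitive w) x) k = coef u k)"
  proof (cases d)
    case True
    have "boundary_cond (\<lambda>x. - primitive (primitive w) H + primitive (primitive w) x) (primitive w)"
      unfolding boundary_cond_def using True by simp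
    then show ?thesis using True freq_eq_0 by blast
  next
    case False
    note e0 = eigf_0_Neumann[OF False]
    have "0 = coef w 0" using c[of 0] freq_0_Neumann[OF False] by simp
    also have "\<dots> = primitive w H / cosnorm 0"
      using integral_leb[OF integrable_leb_L2[OF w]] by (simp add: coef_def e0 L2_inner_def primitive_def)
    finally have wH: "primitive w H = 0" using cosnorm_pos[of 0] by simp
    have c1: "coef (\<lambda>x. 1) 0 \<noteq> 0"
    proof -
      have "(\<lambda>x. 1) = cosnorm 0 *\<^sub>R eigf 0" using cosnorm_pos[of 0] by (simp add: e0 fun_eq_iff)
      then show ?thesis using cosnorm_pos[of 0] coef_eigf[of 0 0] by (simp add: coef_scaleR)
    qed
    define a where "a = (coef u 0 - coef (primitive (primitive w)) 0) / coef (\<lambda>x. 1) 0"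
    have "coef (\<lambda>x. a + primitive (primitive w) x) 0 = coef u 0"
      unfolding F_eq coef_add[OF L2_scaleR[OF one] pw] coef_scaleR using c1 by (simp add: a_def)
    moreover have "boundary_cond (\<lambda>x. a + primitive (primitive w) x) (primitive w)"
      unfolding boundary_cond_def using wH False by simp
    ultimately show ?thesis using freq_eq_0 by blast
  qed
  then obtain a where bc: "boundary_cond (\<lambda>x. a + primitive (primitive w) x) (primitive w)"
    and z: "\<And>k. freq k = 0 \<Longrightarrow> coef (\<lambda>x. a + primitive (primitive w) x) k = coef u k" by blast
  have "coef u k = coef (\<lambda>x. a + primitive (primitive w) x) k" for k
    using coef_second_derivative[OF w _ bc, of a k] c[of k] z[of k] by (cases "freq k = 0") auto
  then have "AE x in leb H. u x = a + primitive (primitive w) x"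
    by (rule coef_eq_imp_AE[OF u FL])
  from laplace_domI[OF u w this bc] show ?thesis by blast
qed

lemma heat_generator:
  "generator (L2) (norm2) heat =
    {(u, v). u \<in> laplace_dom \<and> v \<in> L2
      \<and> norm2 (v - (wderiv H (wderiv H u) - \<kappa> *\<^sub>R u)) = 0}"
proof (intro set_eqI iffI; clarify)
  fix u v
  assume g: "(u, v) \<in> generator (L2) (norm2) heat"
  then have u: "u \<in> L2" and v: "v \<in> L2" by (auto simp: generator_def)
  have w: "v + \<kappa> *\<^sub>R u \<in> L2" by (intro L2_add L2_scaleR u v)
  have "coef (v + \<kappa> *\<^sub>R u) k = - (freq k)\<^sup>2 * coef u k" for k
  proof -
    have "coef v k = - lam k * coef u k" using g generator_coef[OF u v] by blast
    then show ?thesis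
      unfolding coef_add[OF v L2_scaleR[OF u]] coef_scaleR by (simp add: lam_def algebra_simps)
  qed
  from laplace_domI_coef[OF u w this]
  have laplace_dom: "u \<in> laplace_dom" and ae: "AE x in leb H. wderiv H (wderiv H u) x = (v + \<kappa> *\<^sub>R u) x" by auto
  have L: "v - (wderiv H (wderiv H u) - \<kappa> *\<^sub>R u) \<in> L2"
    by (intro L2_diff L2_scaleR u v laplace_domD(2)[OF laplace_dom])
  have "AE x in leb H. (v - (wderiv H (wderiv H u) - \<kappa> *\<^sub>R u)) x = 0"
    using ae by eventually_elim simp
  then show "u \<in> laplace_dom \<and> v \<in> L2
      \<and> norm2 (v - (wderiv H (wderiv H u) - \<kappa> *\<^sub>R u)) = 0"
    using laplace_dom v L2_norm_eq_0_iff[OF L] by blast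
next
  fix u v
  assume laplace_dom: "u \<in> laplace_dom" and v: "v \<in> L2"
    and 0: "norm2 (v - (wderiv H (wderiv H u) - \<kappa> *\<^sub>R u)) = 0"
  note u = laplace_domD(1)[OF laplace_dom] and w = laplace_domD(2)[OF laplace_dom]
  have wu: "wderiv H (wderiv H u) - \<kappa> *\<^sub>R u \<in> L2" by (intro L2_diff L2_scaleR u w)
  have "AE x in leb H. (v - (wderiv H (wderiv H u) - \<kappa> *\<^sub>R u)) x = 0"
    using 0 L2_norm_eq_0_iff[OF L2_diff[OF v wu]] by blast
  then have "AE x in leb H. v x = (wderiv H (wderiv H u) - \<kappa> *\<^sub>R u) x" by simp
  note eq = coef_cong_AE[OF v wu this]
  have "coef v k = - lam k * coef u k" for k
    unfolding eq coef_diff[OF w L2_scaleR[OF u]] coef_scaleR coef_laplace_dom[OF laplace_dom]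
    by (simp add: lam_def algebra_simps)
  then show "(u, v) \<in> generator (L2) (norm2) heat"
    using generator_coef[OF u v] by blast
qed

end

section \<open>Order bounds through the resolvent\<close>

lemma cosh_deriv: "((\<lambda>x. cosh (r * x)) has_real_derivative r * sinh (r * x)) (at x within S)"
  and r_sinh_deriv: "((\<lambda>x. r * sinh (r * x)) has_real_derivative r\<^sup>2 * cosh (r * x)) (at x within S)"
  for r :: real
  by (auto intro!: derivative_eq_intros simp: power2_eq_square)

lemma cosh_mult_continuous: "continuous_on S (\<lambda>x. cosh (r * x))" for r :: real
  using cosh_deriv by (rule DERIV_continuous_on)

lemma primitive_of_derivative:
  assumes "\<And>x. x \<in> {0..H} \<Longrightarrow> (G has_real_derivative g x) (at x within {0..H})" "x \<in> {0..H}"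
  shows "primitive g x = G x - G 0"
proof -
  have "(G has_vector_derivative g y) (at y within {0..x})" if "y \<in> {0..x}" for y
    unfolding has_real_derivative_iff_has_vector_derivative[symmetric]
    by (rule has_field_derivative_subset[OF assms(1)]) (use that assms(2) in auto)
  then have "(g has_integral G x - G 0) {0..x}"
    using assms(2) by (intro fundamental_theorem_of_calculus) auto
  then show ?thesis by (simp add: primitive_def integral_unique)
qed

context mixed_problem
begin

text \<open>The solution of \<open>u'' = r\<^sup>2 u\<close> that satisfies the boundary condition at \<open>H\<close>; the one that satisfies the
  condition at \<open>0\<close> is \<open>cosh (r x)\<close>.\<close>

definition psi :: "real \<Rightarrow> real \<Rightarrow> real" where
  "psi r x = (if d then sinh (r * (H - x)) else cosh (r * (H - x)))"

definition psi' :: "real \<Rightarrow> real \<Rightarrow> real" where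
  "psi' r x = - r * (if d then cosh (r * (H - x)) else sinh (r * (H - x)))"

definition wronskian :: "real \<Rightarrow> real" where
  "wronskian r = r * (if d then cosh (r * H) else sinh (r * H))"

text \<open>Variation of constants: \<open>green r f\<close> solves \<open>r\<^sup>2 u - u'' = f\<close> with the boundary conditions. Its kernel is
  the product of the two homogeneous solutions over their Wronskian, and is visibly nonnegative.\<close>

definition green :: "real \<Rightarrow> (real \<Rightarrow> real) \<Rightarrow> real \<Rightarrow> real" where
  "green r f x = (psi r x * primitive (\<lambda>y. cosh (r * y) * f y) x
     + cosh (r * x) * (primitive (\<lambda>y. psi r y * f y) H - primitive (\<lambda>y. psi r y * f y) x)) / wronskian r"

text \<open>The terms in which the integrals are differentiated cancel, so this is the derivative of
  \<open>green r f\<close>.\<close>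

definition green' :: "real \<Rightarrow> (real \<Rightarrow> real) \<Rightarrow> real \<Rightarrow> real" where
  "green' r f x = (psi' r x * primitive (\<lambda>y. cosh (r * y) * f y) x
     + r * sinh (r * x) * (primitive (\<lambda>y. psi r y * f y) H - primitive (\<lambda>y. psi r y * f y) x)) / wronskian r"

lemma psi_deriv: "(psi r has_real_derivative psi' r x) (at x within S)"
proof -
  have "((\<lambda>x. sinh (r * (H - x))) has_real_derivative - r * cosh (r * (H - x))) (at x within S)"
    "((\<lambda>x. cosh (r * (H - x))) has_real_derivative - r * sinh (r * (H - x))) (at x within S)"
    by (auto intro!: derivative_eq_intros)
  then show ?thesis unfolding psi_def[abs_def] psi'_def by (cases d) simp_all
qed

lemma psi'_deriv: "(psi' r has_real_derivative r\<^sup>2 * psi r x) (at x within S)"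
proof -
  have "((\<lambda>x. - r * cosh (r * (H - x))) has_real_derivative r\<^sup>2 * sinh (r * (H - x))) (at x within S)"
    "((\<lambda>x. - r * sinh (r * (H - x))) has_real_derivative r\<^sup>2 * cosh (r * (H - x))) (at x within S)"
    by (auto intro!: derivative_eq_intros simp: power2_eq_square)
  then show ?thesis unfolding psi_def psi'_def[abs_def] by (cases d) simp_all
qed

lemma psi_continuous: "continuous_on S (psi r)"
  using psi_deriv by (rule DERIV_continuous_on)

lemma wronskian_eq: "r * sinh (r * x) * psi r x - cosh (r * x) * psi' r x = wronskian r"
proof -
  have e: "r * H = r * x + r * (H - x)" by (simp add: algebra_simps)
  show ?thesis
    unfolding wronskian_def psi_def psi'_def e cosh_add sinh_add
    by (simp add: algebra_simps)
qed

lemma wronskian_pos: "r > 0 \<Longrightarrow> wronskian r > 0"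
  using H_pos by (simp add: wronskian_def)

lemma psi_nonneg: "r > 0 \<Longrightarrow> x \<le> H \<Longrightarrow> psi r x \<ge> 0"
  by (simp add: psi_def)

lemma
  assumes r: "r > 0" and f: "continuous_on {0..H} f" and x: "0 \<le> x" "x \<le> H"
  shows green_deriv: "(green r f has_real_derivative green' r f x) (at x within {0..H})"
    and green'_deriv: "(green' r f has_real_derivative r\<^sup>2 * green r f x - f x) (at x within {0..H})"
proof -
  let ?p = "primitive (\<lambda>y. cosh (r * y) * f y)" and ?q = "primitive (\<lambda>y. psi r y * f y)"
  have p: "(?p has_real_derivative cosh (r * x) * f x) (at x within {0..H})"
    by (intro primitive_has_derivative x continuous_on_mult cosh_mult_continuous f)
  have "(?q has_real_derivative psi r x * f x) (at x within {0..H})"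
    by (intro primitive_has_derivative x continuous_on_mult psi_continuous f)
  then have q: "((\<lambda>x. ?q H - ?q x) has_real_derivative - (psi r x * f x)) (at x within {0..H})"
    by (auto intro!: derivative_eq_intros)
  have w: "wronskian r \<noteq> 0" using wronskian_pos[OF r] by simp
  show "(green r f has_real_derivative green' r f x) (at x within {0..H})"
    unfolding green_def[abs_def] green'_def
    by (rule DERIV_cong[OF DERIV_cdivide[OF DERIV_add[OF DERIV_mult[OF psi_deriv p] DERIV_mult[OF cosh_deriv q]]]])
       (simp add: algebra_simps)
  show "(green' r f has_real_derivative r\<^sup>2 * green r f x - f x) (at x within {0..H})"
  proof -
    have "(green' r f has_real_derivative
      (r\<^sup>2 * psi r x * ?p x + cosh (r * x) * f x * psi' r x
        + (r\<^sup>2 * cosh (r * x) * (?q H - ?q x) + - (psi r x * f x) * (r * sinh (r * x)))) / wronskian r)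
      (at x within {0..H})"
      unfolding green'_def[abs_def]
      by (rule DERIV_cdivide[OF DERIV_add[OF DERIV_mult[OF psi'_deriv p] DERIV_mult[OF r_sinh_deriv q]]])
    also have "(r\<^sup>2 * psi r x * ?p x + cosh (r * x) * f x * psi' r x
        + (r\<^sup>2 * cosh (r * x) * (?q H - ?q x) + - (psi r x * f x) * (r * sinh (r * x))))
      = r\<^sup>2 * (psi r x * ?p x + cosh (r * x) * (?q H - ?q x))
        - f x * (r * sinh (r * x) * psi r x - cosh (r * x) * psi' r x)"
      by (simp add: algebra_simps)
    also have "\<dots> / wronskian r = r\<^sup>2 * green r f x - f x"
      unfolding wronskian_eq green_def using w by (simp add: diff_divide_distrib)
    finally show ?thesis .
  qed
qed

lemma green_continuous:
  "r > 0 \<Longrightarrow> continuous_on {0..H} f \<Longrightarrow> continuous_on {0..H} (green r f)"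
  using green_deriv by (intro DERIV_continuous_on) auto

lemma coef_green:
  assumes r: "r > 0" and f: "continuous_on {0..H} f"
  shows "coef (green r f) k = coef f k / (r\<^sup>2 + (freq k)\<^sup>2)"
proof -
  let ?u = "green r f"
  define v where "v = r\<^sup>2 *\<^sub>R ?u - f"
  have uc: "continuous_on {0..H} ?u" by (rule green_continuous[OF r f])
  have uL: "?u \<in> L2" and fL: "f \<in> L2"
    by (intro L2_continuous uc f)+
  have vL: "v \<in> L2" unfolding v_def by (intro L2_diff L2_scaleR uL fL)
  have u'0: "green' r f 0 = 0" by (simp add: green'_def)
  have pv: "primitive v x = green' r f x" if "x \<in> {0..H}" for x
    using primitive_of_derivative[of H "green' r f" v x] green'_deriv[OF r f] that u'0 by (simp add: v_def)
  have ppv: "primitive (primitive v) x = ?u x - ?u 0" if "x \<in> {0..H}" for x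
    using primitive_of_derivative[of H ?u "primitive v" x] green_deriv[OF r f] that by (simp add: pv)
  have bc: "boundary_cond ?u (primitive v)"
  proof (cases d)
    case True
    have "psi r H = 0" unfolding psi_def using True by simp
    then have "?u H = 0" by (simp add: green_def)
    then show ?thesis unfolding boundary_cond_def using True by simp
  next
    case False
    have "psi' r H = 0" unfolding psi'_def using False by simp
    then have "green' r f H = 0" by (simp add: green'_def)
    then show ?thesis unfolding boundary_cond_def using False pv[of H] H_pos by simp
  qed
  have "coef v k = - (freq k)\<^sup>2 * coef ?u k"
    by (rule coef_second_derivative[OF vL _ bc, of "?u 0"]) (simp add: ppv)
  moreover have "coef v k = r\<^sup>2 * coef ?u k - coef f k"
    unfolding v_def coef_diff[OF L2_scaleR[OF uL] fL] coef_scaleR ..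
  ultimately have "(r\<^sup>2 + (freq k)\<^sup>2) * coef ?u k = coef f k" by (simp add: algebra_simps)
  moreover have "r\<^sup>2 + (freq k)\<^sup>2 > 0" using r by (simp add: add_pos_nonneg)
  then have "r\<^sup>2 + (freq k)\<^sup>2 \<noteq> 0" by linarith
  ultimately show ?thesis by (metis eq_divide_imp mult.commute)
qed

text \<open>Exact integration gives \<open>1 / r\<^sup>2\<close> plus a multiple of \<open>psi' r H\<close>, which is zero for the Neumann condition and
  negative for the Dirichlet condition.\<close>

lemma green_const_le:
  assumes r: "r > 0" and x: "x \<in> {0..H}"
  shows "green r (\<lambda>y. 1) x \<le> 1 / r\<^sup>2"
proof -
  have q: "primitive (psi r) y = (psi' r y - psi' r 0) / r\<^sup>2" if "y \<in> {0..H}" for y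
    using primitive_of_derivative[of H "\<lambda>x. psi' r x / r\<^sup>2" "psi r" y] DERIV_cdivide[OF psi'_deriv[of r], where c = "r\<^sup>2"] r that
    by (simp add: diff_divide_distrib)
  have "primitive (\<lambda>y. cosh (r * y)) x = (r * sinh (r * x)) / r\<^sup>2"
    using primitive_of_derivative[of H "\<lambda>x. r * sinh (r * x) / r\<^sup>2" "\<lambda>y. cosh (r * y)" x]
      DERIV_cdivide[OF r_sinh_deriv[of r], where c = "r\<^sup>2"] r x by simp
  then have "green r (\<lambda>y. 1) x
      = (psi r x * ((r * sinh (r * x)) / r\<^sup>2) + cosh (r * x) * ((psi' r H - psi' r x) / r\<^sup>2)) / wronskian r"
    using q[of H] q[OF x] H_pos by (simp add: green_def diff_divide_distrib)
  also have "\<dots> = (psi r x * (r * sinh (r * x)) + cosh (r * x) * (psi' r H - psi' r x)) / wronskian r / r\<^sup>2"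
    by (simp only: add_divide_distrib times_divide_eq_right divide_divide_eq_left mult.commute[of "r\<^sup>2"])
  also have "psi r x * (r * sinh (r * x)) + cosh (r * x) * (psi' r H - psi' r x)
      = wronskian r + cosh (r * x) * psi' r H"
    using wronskian_eq[of r x] by (simp add: algebra_simps)
  also have "(wronskian r + cosh (r * x) * psi' r H) / wronskian r / r\<^sup>2 \<le> 1 / r\<^sup>2"
  proof (rule divide_right_mono)
    have "psi' r H \<le> 0" using r by (simp add: psi'_def)
    then have "cosh (r * x) * psi' r H \<le> 0" by (simp add: mult_nonneg_nonpos)
    then show "(wronskian r + cosh (r * x) * psi' r H) / wronskian r \<le> 1"
      using wronskian_pos[OF r] by (simp add: divide_le_eq)
  qed simp
  finally show ?thesis .
qed

lemma green_nonneg: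
  assumes r: "r > 0" and f: "continuous_on {0..H} f" and ge: "\<And>x. x \<in> {0..H} \<Longrightarrow> 0 \<le> f x"
    and x: "x \<in> {0..H}"
  shows "0 \<le> green r f x"
proof -
  have int: "g integrable_on {a..b}" if "continuous_on {0..H} g" "0 \<le> a" "b \<le> H" for g :: "real \<Rightarrow> real" and a b
    by (rule integrable_continuous_real) (use that in \<open>auto intro: continuous_on_subset\<close>)
  have cc: "continuous_on {0..H} (\<lambda>y. cosh (r * y) * f y)" "continuous_on {0..H} (\<lambda>y. psi r y * f y)"
    by (intro continuous_on_mult cosh_mult_continuous psi_continuous f)+
  have "0 \<le> primitive (\<lambda>y. cosh (r * y) * f y) x"
    unfolding primitive_def
    by (intro Henstock_Kurzweil_Integration.integral_nonneg int cc) (use x ge in auto)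
  moreover have "primitive (\<lambda>y. psi r y * f y) H - primitive (\<lambda>y. psi r y * f y) x
      = integral {x..H} (\<lambda>y. psi r y * f y)"
    using Henstock_Kurzweil_Integration.integral_combine[of 0 x H "\<lambda>y. psi r y * f y"] int[OF cc(2)] x
    by (simp add: primitive_def)
  moreover have "0 \<le> integral {x..H} (\<lambda>y. psi r y * f y)"
    by (intro Henstock_Kurzweil_Integration.integral_nonneg int cc)
       (use x ge psi_nonneg[OF r] in auto)
  ultimately show ?thesis
    using wronskian_pos[OF r] psi_nonneg[OF r] x
    by (simp add: green_def)
qed

text \<open>Since \<open>l\<close> is not positive, the bound on the mass of the kernel can only help.\<close>

lemma green_ge:
  assumes r: "r > 0" and f: "continuous_on {0..H} f" and ge: "\<And>x. x \<in> {0..H} \<Longrightarrow> l \<le> f x"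
    and l: "l \<le> 0" and x: "x \<in> {0..H}"
  shows "l / r\<^sup>2 \<le> green r f x"
proof -
  have g: "continuous_on {0..H} (\<lambda>y. f y - l)" by (intro continuous_intros f)
  have lin: "primitive (\<lambda>y. h y * f y) z = primitive (\<lambda>y. h y * (f y - l)) z + l * primitive (\<lambda>y. h y * 1) z"
    if h: "continuous_on {0..H} h" and z: "z \<in> {0..H}" for h z
  proof -
    have i: "(\<lambda>y. h y * (f y - l)) integrable_on {0..z}" "(\<lambda>y. l * (h y * 1)) integrable_on {0..z}"
      by (rule integrable_continuous_real, rule continuous_on_subset[of "{0..H}"],
          use z in \<open>auto intro!: continuous_intros h f\<close>)+
    have "primitive (\<lambda>y. h y * (f y - l)) z + l * primitive (\<lambda>y. h y * 1) z
        = integral {0..z} (\<lambda>y. h y * (f y - l) + l * (h y * 1))"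
      unfolding primitive_def Henstock_Kurzweil_Integration.integral_add[OF i] by simp
    then show ?thesis by (simp add: primitive_def algebra_simps)
  qed
  have HH: "H \<in> {0..H}" using H_pos by simp
  have "green r f x = green r (\<lambda>y. f y - l) x + l * green r (\<lambda>y. 1) x"
    unfolding green_def lin[OF cosh_mult_continuous x] lin[OF psi_continuous x] lin[OF psi_continuous HH]
    by (simp add: add_divide_distrib[symmetric] algebra_simps)
  moreover have "0 \<le> green r (\<lambda>y. f y - l) x"
    by (rule green_nonneg[OF r g _ x]) (use ge in auto)
  moreover have "l * (1 / r\<^sup>2) \<le> l * green r (\<lambda>y. 1) x"
    using green_const_le[OF r x] l by (rule mult_left_mono_neg)
  ultimately show ?thesis by simp
qed

end

context heat_problem
begin

text \<open>The inverse of \<open>I - s A\<close> for \<open>A u = u'' - \<kappa> u\<close>, on continuous functions.\<close>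

definition resolvent :: "real \<Rightarrow> (real \<Rightarrow> real) \<Rightarrow> real \<Rightarrow> real" where
  "resolvent s f = (1 / s) *\<^sub>R green (sqrt (1 / s + \<kappa>)) f"

lemma resolvent:
  assumes s: "s > 0" and f: "continuous_on {0..H} f" and ge: "\<And>x. x \<in> {0..H} \<Longrightarrow> l \<le> f x"
    and l: "l \<le> 0"
  shows "continuous_on {0..H} (resolvent s f)" "\<And>x. x \<in> {0..H} \<Longrightarrow> l \<le> resolvent s f x"
    "coef (resolvent s f) k = coef f k / (1 + s * lam k)"
proof -
  define r where "r = sqrt (1 / s + \<kappa>)"
  have sk: "1 / s + \<kappa> > 0" using s kappa_nonneg by (simp add: add_pos_nonneg)
  then have r: "r > 0" and r2: "r\<^sup>2 = 1 / s + \<kappa>" by (auto simp: r_def)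
  show "continuous_on {0..H} (resolvent s f)"
    unfolding resolvent_def r_def[symmetric] scaleR_fun_def
    by (intro continuous_on_scaleR continuous_on_const green_continuous r f)
  show "l \<le> resolvent s f x" if x: "x \<in> {0..H}" for x
  proof -
    have "s * r\<^sup>2 = 1 + s * \<kappa>" using s by (simp add: r2 distrib_left)
    then have "1 \<le> s * r\<^sup>2" using s kappa_nonneg by simp
    then have "l * (s * r\<^sup>2) \<le> l * 1" using l by (intro mult_left_mono_neg) auto
    then have "l \<le> l / (s * r\<^sup>2)" using s r l by (simp add: le_divide_eq)
    also have "\<dots> = (1 / s) * (l / r\<^sup>2)" by simp
    also have "\<dots> \<le> (1 / s) * green r f x"
      using green_ge[OF r f ge l x] s by (intro mult_left_mono) auto
    finally show ?thesis by (simp add: resolvent_def r_def)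
  qed
  have "coef (resolvent s f) k = (1 / s) * (coef f k / (r\<^sup>2 + (freq k)\<^sup>2))"
    unfolding resolvent_def r_def[symmetric] coef_scaleR coef_green[OF r f] ..
  also have "\<dots> = coef f k / (s * (r\<^sup>2 + (freq k)\<^sup>2))" by simp
  also have "s * (r\<^sup>2 + (freq k)\<^sup>2) = 1 + s * lam k"
    using s by (simp add: r2 lam_def distrib_left)
  finally show "coef (resolvent s f) k = coef f k / (1 + s * lam k)" .
qed

lemma resolvent_power:
  assumes s: "s > 0" and f: "continuous_on {0..H} f" and ge: "\<And>x. x \<in> {0..H} \<Longrightarrow> l \<le> f x"
    and l: "l \<le> 0"
  shows "continuous_on {0..H} ((resolvent s ^^ n) f) \<and> (\<forall>x\<in>{0..H}. l \<le> (resolvent s ^^ n) f x)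
    \<and> (\<forall>k. coef ((resolvent s ^^ n) f) k = coef f k / (1 + s * lam k) ^ n)"
proof (induction n)
  case 0
  show ?case using f ge by simp
next
  case (Suc n)
  then have c: "continuous_on {0..H} ((resolvent s ^^ n) f)"
    and g: "\<And>x. x \<in> {0..H} \<Longrightarrow> l \<le> (resolvent s ^^ n) f x"
    and k: "\<And>k. coef ((resolvent s ^^ n) f) k = coef f k / (1 + s * lam k) ^ n" by auto
  show ?case using resolvent[OF s c g l] by (simp add: k mult.commute)
qed

text \<open>The exponential formula: \<open>exp (- lam k * t)\<close> is the limit of \<open>(1 + lam k * t / n) ^ - n\<close>, so \<open>heat t f\<close> is
  the limit in the mean of powers of resolvents, each of which keeps the bound \<open>l\<close>.\<close>

lemma heat_ge_continuous:
  assumes t: "t > 0" and f: "continuous_on {0..H} f" and ge: "\<And>x. x \<in> {0..H} \<Longrightarrow> l \<le> f x"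
    and l: "l \<le> 0"
  shows "AE x in leb H. l \<le> heat t f x"
proof -
  define J where "J n = (resolvent (t / real (Suc n)) ^^ Suc n) f" for n
  have s: "t / real (Suc n) > 0" for n using t by simp
  have J: "continuous_on {0..H} (J n)" "\<And>x. x \<in> {0..H} \<Longrightarrow> l \<le> J n x"
    "coef (J n) k = coef f k / (1 + t / real (Suc n) * lam k) ^ Suc n" for n k
    using resolvent_power[OF s[of n] f ge l, of "Suc n"] unfolding J_def by blast+
  have fL: "f \<in> L2" by (rule L2_continuous[OF f])
  have t0: "t \<ge> 0" using t by simp
  have hL: "heat t f \<in> L2" by (rule heat_L2[OF t0 fL])
  have JL: "J n \<in> L2" for n by (rule L2_continuous[OF J(1)])
  let ?g = "\<lambda>n k. 1 / (1 + t / real (Suc n) * lam k) ^ Suc n - exp (- lam k * t)"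
  have "(\<lambda>n. norm2 (J n - heat t f)) \<longlonglongrightarrow> 0"
  proof (rule spectral_convergence[where g = ?g and M = 1])
    show "\<forall>\<^sub>F n in sequentially. J n - heat t f \<in> L2
      \<and> (\<forall>k. coef (J n - heat t f) k = ?g n k * coef f k \<and> \<bar>?g n k\<bar> \<le> 1)"
    proof (intro always_eventually allI conjI)
      fix n k
      show "J n - heat t f \<in> L2" by (rule L2_diff[OF JL hL])
      show "coef (J n - heat t f) k = ?g n k * coef f k"
        unfolding coef_diff[OF JL hL] J(3) coef_heat[OF t0 fL] by (simp add: left_diff_distrib)
      have "1 \<le> (1 + t / real (Suc n) * lam k) ^ Suc n"
        using lam_nonneg[of k] t by (intro one_le_power) simp
      then have "0 \<le> 1 / (1 + t / real (Suc n) * lam k) ^ Suc n" "1 / (1 + t / real (Suc n) * lam k) ^ Suc n \<le> 1"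
        by (auto simp: divide_le_eq)
      then show "\<bar>?g n k\<bar> \<le> 1" using exp_lam_le1[OF t0, of k] exp_gt_zero[of "- lam k * t"] by linarith
    qed
    show "(\<lambda>n. ?g n k) \<longlonglongrightarrow> 0" for k
    proof -
      have "(\<lambda>n. (1 + lam k * t / real n) ^ n) \<longlonglongrightarrow> exp (lam k * t)"
        by (rule tendsto_exp_limit_sequentially)
      then have "(\<lambda>n. (1 + lam k * t / real (Suc n)) ^ Suc n) \<longlonglongrightarrow> exp (lam k * t)"
        by (rule LIMSEQ_Suc)
      then have "(\<lambda>n. 1 / (1 + lam k * t / real (Suc n)) ^ Suc n - exp (- lam k * t))
          \<longlonglongrightarrow> 1 / exp (lam k * t) - exp (- lam k * t)"
        by (intro tendsto_intros) auto
      then show ?thesis by (simp add: exp_minus inverse_eq_divide mult.commute)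
    qed
  qed (rule summable_coef_power2[OF fL])
  then show ?thesis
  proof (rule L2_limit_ge[OF JL hL])
    show "AE x in leb H. l \<le> J n x" for n by (rule AE_leb_all) (rule J(2), simp)
  qed simp
qed

text \<open>The one order property behind both order statements of the theorem; continuous approximants that
  stay above \<open>l\<close> carry it over to all square integrable functions.\<close>

lemma heat_ge:
  assumes t: "t \<ge> 0" and f: "f \<in> L2" and ge: "AE x in leb H. l \<le> f x"
    and l: "l \<le> 0"
  shows "AE x in leb H. l \<le> heat t f x"
proof (cases "t = 0")
  case True
  then show ?thesis using ge by (simp add: heat_0)
next
  case False
  obtain g where g: "\<And>n. continuous_on UNIV (g n)" "\<And>n. g n \<in> L2" "\<And>n x. l \<le> g n x"
    and lim: "(\<lambda>n::nat. norm2 (g n - f)) \<longlonglongrightarrow> 0"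
    using L2_continuous_approx_ge[OF f ge] by blast
  have hg: "heat t (g n) \<in> L2" for n by (rule heat_L2[OF t g(2)])
  have hf: "heat t f \<in> L2" by (rule heat_L2[OF t f])
  have le: "norm2 (heat t (g n) - heat t f) \<le> norm2 (g n - f)" for n
  proof (rule norm_le_of_coef[OF L2_diff[OF hg hf] L2_diff[OF g(2) f]])
    fix k
    have "coef (heat t (g n) - heat t f) k = exp (- lam k * t) * coef (g n - f) k"
      unfolding coef_diff[OF hg hf] coef_diff[OF g(2) f] coef_heat[OF t g(2)] coef_heat[OF t f]
      by (simp add: right_diff_distrib)
    then show "\<bar>coef (heat t (g n) - heat t f) k\<bar> \<le> \<bar>coef (g n - f) k\<bar>"
      using exp_lam_le1[OF t, of k] by (simp only: abs_mult abs_exp_cancel mult_left_le_one_le abs_ge_zero exp_ge_zero)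
  qed
  have "(\<lambda>n. norm2 (heat t (g n) - heat t f)) \<longlonglongrightarrow> 0"
    by (rule real_tendsto_sandwich[OF _ _ tendsto_const lim]) (auto intro!: always_eventually le)
  then show ?thesis
  proof (rule L2_limit_ge[OF hg hf])
    show "AE x in leb H. l \<le> heat t (g n) x" for n
      by (rule heat_ge_continuous[OF _ continuous_on_subset[OF g(1) subset_UNIV] g(3) l]) (use t False in simp)
  qed simp
qed

text \<open>The lower bound \<open>- c\<close> applies to \<open>f\<close> and to \<open>- f\<close>.\<close>

lemma heat_abs_le:
  assumes t: "t \<ge> 0" and f: "f \<in> L2" and le: "AE x in leb H. \<bar>f x\<bar> \<le> c" and c: "c \<ge> 0"
  shows "AE x in leb H. \<bar>heat t f x\<bar> \<le> c"
proof -
  have f': "- 1 *\<^sub>R f \<in> L2" by (rule L2_scaleR[OF f])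
  have "AE x in leb H. - c \<le> f x" "AE x in leb H. - c \<le> (- 1 *\<^sub>R f) x"
    using le by (auto elim!: eventually_mono)
  then have 1: "AE x in leb H. - c \<le> heat t f x" and 2: "AE x in leb H. - c \<le> heat t (- 1 *\<^sub>R f) x"
    using heat_ge[OF t f] heat_ge[OF t f'] c by (simp_all only: neg_le_0_iff_le)
  have "AE x in leb H. heat t (- 1 *\<^sub>R f) x = (- 1 *\<^sub>R heat t f) x"
    by (rule coef_eq_imp_AE[OF heat_L2[OF t f'] L2_scaleR[OF heat_L2[OF t f]]])
       (simp only: coef_scaleR coef_heat[OF t f] coef_heat[OF t f'] mult.left_commute)
  with 1 2 show ?thesis by eventually_elim auto
qed

end

section \<open>Product semigroups and the theorem\<close>

definition sum_norm :: "('a \<Rightarrow> real) \<Rightarrow> ('b \<Rightarrow> real) \<Rightarrow> 'a \<times> 'b \<Rightarrow> real" where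
  "sum_norm N1 N2 = (\<lambda>(a, b). N1 a + N2 b)"

lemma sum_norm_apply [simp]: "sum_norm N1 N2 (a, b) = N1 a + N2 b"
  by (simp add: sum_norm_def)

lemma tendsto_add_nonneg_iff:
  fixes f g :: "'a \<Rightarrow> real"
  assumes "\<And>x. 0 \<le> f x" "\<And>x. 0 \<le> g x"
  shows "((\<lambda>x. f x + g x) \<longlongrightarrow> 0) F \<longleftrightarrow> (f \<longlongrightarrow> 0) F \<and> (g \<longlongrightarrow> 0) F"
proof
  assume l: "((\<lambda>x. f x + g x) \<longlongrightarrow> 0) F"
  have "(f \<longlongrightarrow> 0) F"
    by (rule Lim_null_comparison[OF _ l]) (use assms in \<open>simp add: always_eventually\<close>)
  moreover have "(g \<longlongrightarrow> 0) F"
    by (rule Lim_null_comparison[OF _ l]) (use assms in \<open>simp add: always_eventually\<close>)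
  ultimately show "(f \<longlongrightarrow> 0) F \<and> (g \<longlongrightarrow> 0) F" ..
next
  assume "(f \<longlongrightarrow> 0) F \<and> (g \<longlongrightarrow> 0) F"
  then show "((\<lambda>x. f x + g x) \<longlongrightarrow> 0) F" using tendsto_add[of f 0 F g 0] by simp
qed

lemma bounded_op_prod:
  assumes A: "bounded_op S1 N1 A" and B: "bounded_op S2 N2 B"
    and n: "\<And>a. a \<in> S1 \<Longrightarrow> 0 \<le> N1 a" "\<And>b. b \<in> S2 \<Longrightarrow> 0 \<le> N2 b"
  shows "bounded_op (S1 \<times> S2) (sum_norm N1 N2) (\<lambda>(a, b). (A a, B b))"
proof -
  obtain C1 where C1: "\<And>a. a \<in> S1 \<Longrightarrow> N1 (A a) \<le> C1 * N1 a" using A unfolding bounded_op_def by blast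
  obtain C2 where C2: "\<And>b. b \<in> S2 \<Longrightarrow> N2 (B b) \<le> C2 * N2 b" using B unfolding bounded_op_def by blast
  have "N1 (A a) + N2 (B b) \<le> max C1 C2 * (N1 a + N2 b)" if "a \<in> S1" "b \<in> S2" for a b
  proof -
    have "C1 * N1 a \<le> max C1 C2 * N1 a" "C2 * N2 b \<le> max C1 C2 * N2 b"
      using that n by (auto intro!: mult_right_mono)
    then show ?thesis using C1[OF that(1)] C2[OF that(2)] unfolding distrib_left by linarith
  qed
  then have "\<exists>C. \<forall>u\<in>S1 \<times> S2. sum_norm N1 N2 ((\<lambda>(a, b). (A a, B b)) u) \<le> C * sum_norm N1 N2 u"
    by (intro exI[of _ "max C1 C2"]) auto
  then show ?thesis using A B unfolding bounded_op_def by auto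
qed

lemma C0_semigroup_prod:
  assumes T1: "C0_semigroup S1 N1 T1" and T2: "C0_semigroup S2 N2 T2"
    and n: "\<And>a. 0 \<le> N1 a" "\<And>b. 0 \<le> N2 b"
  shows "C0_semigroup (S1 \<times> S2) (sum_norm N1 N2) (\<lambda>t (a, b). (T1 t a, T2 t b))"
  using T1 T2 bounded_op_prod[of S1 N1 _ S2 N2] n
  unfolding C0_semigroup_def by (auto simp: tendsto_add_nonneg_iff)

lemma generator_prod:
  assumes n: "\<And>a. 0 \<le> N1 a" "\<And>b. 0 \<le> N2 b"
  shows "((a, b), (a', b')) \<in> generator (S1 \<times> S2) (sum_norm N1 N2) (\<lambda>t (a, b). (T1 t a, T2 t b))
    \<longleftrightarrow> (a, a') \<in> generator S1 N1 T1 \<and> (b, b') \<in> generator S2 N2 T2"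
  unfolding generator_def using n by (auto simp: tendsto_add_nonneg_iff)

lemma C0_curve_prod:
  assumes "C0_curve S1 N1 J f" "C0_curve S2 N2 J g" "\<And>a. 0 \<le> N1 a" "\<And>b. 0 \<le> N2 b"
  shows "C0_curve (S1 \<times> S2) (sum_norm N1 N2) J (\<lambda>t. (f t, g t))"
  using assms unfolding C0_curve_def by (auto simp: tendsto_add_nonneg_iff)

lemma C1_curve_prod:
  assumes f: "C1_curve S1 N1 J f" and g: "C1_curve S2 N2 J g" and n: "\<And>a. 0 \<le> N1 a" "\<And>b. 0 \<le> N2 b"
  shows "C1_curve (S1 \<times> S2) (sum_norm N1 N2) J (\<lambda>t. (f t, g t))"
proof -
  obtain f' where f': "C0_curve S1 N1 J f'"
    "\<And>t. t \<in> J \<Longrightarrow> ((\<lambda>s. N1 ((1 / (s - t)) *\<^sub>R (f s - f t) - f' t)) \<longlongrightarrow> 0) (at t within J)"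
    using f by (auto simp: C1_curve_def)
  obtain g' where g': "C0_curve S2 N2 J g'"
    "\<And>t. t \<in> J \<Longrightarrow> ((\<lambda>s. N2 ((1 / (s - t)) *\<^sub>R (g s - g t) - g' t)) \<longlongrightarrow> 0) (at t within J)"
    using g by (auto simp: C1_curve_def)
  have "C0_curve (S1 \<times> S2) (sum_norm N1 N2) J (\<lambda>t. (f t, g t))"
    using f g by (intro C0_curve_prod n) (auto simp: C1_curve_def)
  moreover have "C0_curve (S1 \<times> S2) (sum_norm N1 N2) J (\<lambda>t. (f' t, g' t))"
    by (intro C0_curve_prod n f' g')
  ultimately show ?thesis
    unfolding C1_curve_def
    by (intro conjI exI[of _ "\<lambda>t. (f' t, g' t)"] ballI)
       (auto simp: tendsto_add_nonneg_iff n f' g')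
qed

text \<open>The semigroup of the third component, generated by multiplication with \<open>- c\<close>.\<close>

definition decay :: "real \<Rightarrow> real \<Rightarrow> real \<Rightarrow> real" where
  "decay c t z = exp (- c * t) * z"

lemma decay_deriv: "((\<lambda>t. decay c t z) has_real_derivative - c * decay c t z) (at t within S)"
  unfolding decay_def by (auto intro!: derivative_eq_intros)

lemma decay_deriv_tendsto:
  "((\<lambda>s. \<bar>(decay c s z - decay c t z) / (s - t) - (- c * decay c t z)\<bar>) \<longlongrightarrow> 0) (at t within S)"
  using decay_deriv[of c z t S] unfolding has_field_derivative_iff
  by (intro tendsto_rabs_zero) (simp only: LIM_zero_iff)

lemma decay_tendsto: "((\<lambda>s. \<bar>decay c s z - decay c t z\<bar>) \<longlongrightarrow> 0) (at t within S)"
  using DERIV_continuous[OF decay_deriv[of c z t S]] unfolding continuous_within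
  by (intro tendsto_rabs_zero) (simp only: LIM_zero_iff)

lemma decay_bounded_op: "bounded_op UNIV abs (decay c t)"
  unfolding bounded_op_def
  by (auto simp: decay_def distrib_left abs_mult intro!: exI[of _ "exp (- c * t)"])

lemma decay_semigroup: "C0_semigroup UNIV abs (decay c)"
  using decay_bounded_op decay_tendsto[of c _ 0 "{0<..}"]
  by (auto simp: C0_semigroup_def decay_def distrib_left mult_exp_exp mult.assoc[symmetric])

lemma decay_generator: "(u, v) \<in> generator UNIV abs (decay c) \<longleftrightarrow> v = - c * u"
proof -
  have d: "((\<lambda>t. (decay c t u - u) / t) \<longlongrightarrow> - c * u) (at_right 0)"
    using decay_deriv[of c u 0 "{0<..}"] unfolding has_field_derivative_iff by (simp add: decay_def)
  have "(u, v) \<in> generator UNIV abs (decay c)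
      \<longleftrightarrow> ((\<lambda>t. (decay c t u - u) / t - v) \<longlongrightarrow> 0) (at_right 0)"
    by (simp add: generator_def tendsto_rabs_zero_iff)
  also have "\<dots> \<longleftrightarrow> ((\<lambda>t. (decay c t u - u) / t) \<longlongrightarrow> v) (at_right 0)" by (rule LIM_zero_iff)
  also have "\<dots> \<longleftrightarrow> v = - c * u"
    using d tendsto_unique[OF trivial_limit_at_right_real _ d] by blast
  finally show ?thesis .
qed

lemma decay_C0_curve: "C0_curve UNIV abs J (\<lambda>t. decay c t z)"
  by (simp add: C0_curve_def decay_tendsto)

lemma decay_C1_curve: "C1_curve UNIV abs J (\<lambda>t. decay c t z)"
proof -
  have "C0_curve UNIV abs J (\<lambda>t. - c * decay c t z)"
    using decay_C0_curve[of J c "- c * z"] by (simp add: decay_def mult.left_commute)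
  then show ?thesis
    using decay_C0_curve[of J c z] decay_deriv_tendsto[of c z]
    unfolding C1_curve_def by (intro conjI exI[of _ "\<lambda>t. - c * decay c t z"]) auto
qed

lemma decay_le: "c \<ge> 0 \<Longrightarrow> t \<ge> 0 \<Longrightarrow> \<bar>decay c t z\<bar> \<le> \<bar>z\<bar>"
  by (simp add: decay_def abs_mult mult_left_le_one_le)

text \<open>The interval has positive measure, so the essential supremum of a nonnegative function is not
  negative.\<close>

lemma Linf_AE_le:
  assumes H: "H > 0" and f: "f \<in> Linf_space (leb H)"
  shows "0 \<le> Linf_norm (leb H) f" "AE x in leb H. \<bar>f x\<bar> \<le> Linf_norm (leb H) f"
proof -
  let ?e = "esssup (leb H) (\<lambda>x. ereal \<bar>f x\<bar>)"
  have ae: "AE x in leb H. ereal \<bar>f x\<bar> \<le> ?e" by (rule esssup_AE)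
  have "0 \<le> ?e"
  proof (rule ccontr)
    assume "\<not> 0 \<le> ?e"
    then have neg: "?e < 0" by simp
    have "AE x in leb H. False"
      using ae
    proof eventually_elim
      case (elim x)
      have "(0::ereal) \<le> ereal \<bar>f x\<bar>" by simp
      then show ?case using elim neg by (meson leD order_trans)
    qed
    then show False using not_AE_leb_False[OF H] by simp
  qed
  moreover have "?e < \<infinity>" using f by (simp add: Linf_space_def)
  ultimately obtain M where M: "?e = ereal M" "0 \<le> M" by (cases ?e) auto
  then show "0 \<le> Linf_norm (leb H) f" "AE x in leb H. \<bar>f x\<bar> \<le> Linf_norm (leb H) f"
    using ae by (auto simp: Linf_norm_def)
qed

lemma LinfI:
  assumes H: "H > 0" and f: "f \<in> borel_measurable (leb H)" and le: "AE x in leb H. \<bar>f x\<bar> \<le> c"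
  shows "f \<in> Linf_space (leb H)" "Linf_norm (leb H) f \<le> c"
proof -
  let ?e = "esssup (leb H) (\<lambda>x. ereal \<bar>f x\<bar>)"
  have e: "?e \<le> ereal c"
  proof (rule esssup_I)
    show "(\<lambda>x. ereal \<bar>f x\<bar>) \<in> borel_measurable (leb H)" using f by simp
  qed (use le in simp)
  then have "?e < \<infinity>" using less_ereal.simps(4)[of c] by (metis infinity_ereal_def order_le_less_trans)
  then show L: "f \<in> Linf_space (leb H)" using f by (simp add: Linf_space_def)
  have "?e \<noteq> - \<infinity>"
  proof
    assume "?e = - \<infinity>"
    then have "AE x in leb H. False"
      using esssup_AE[of "\<lambda>x. ereal \<bar>f x\<bar>" "leb H"] by simp
    then show False using not_AE_leb_False[OF H] by simp
  qed
  then show "Linf_norm (leb H) f \<le> c"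
    using e \<open>?e < \<infinity>\<close> unfolding Linf_norm_def by (cases ?e) auto
qed

lemma Linf_subset_L2: "H > 0 \<Longrightarrow> f \<in> Linf_space (leb H) \<Longrightarrow> f \<in> L2_space (leb H)"
  using L2_bounded[OF _ Linf_AE_le(2)] by (auto simp: Linf_space_def)

lemma Linf_norm_eq_0:
  assumes H: "H > 0" and f: "f \<in> L2_space (leb H)" and 0: "L2_norm (leb H) f = 0"
  shows "Linf_norm (leb H) f = 0"
proof -
  have "AE x in leb H. f x = 0" using L2_norm_eq_0_iff[OF f] 0 by simp
  then have "AE x in leb H. \<bar>f x\<bar> \<le> 0" by simp
  note L = LinfI[OF H L2_measurable[OF f] this]
  show ?thesis using L(2) Linf_AE_le(1)[OF H L(1)] by linarith
qed

context heat_problem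
begin

lemma heat_Linf:
  assumes t: "t \<ge> 0" and f: "f \<in> Linf_space (leb H)"
  shows "heat t f \<in> Linf_space (leb H)" "Linf_norm (leb H) (heat t f) \<le> Linf_norm (leb H) f"
proof -
  have fL: "f \<in> L2" by (rule Linf_subset_L2[OF H_pos f])
  have "AE x in leb H. \<bar>heat t f x\<bar> \<le> Linf_norm (leb H) f"
    by (rule heat_abs_le[OF t fL Linf_AE_le(2,1)[OF H_pos f]])
  from LinfI[OF H_pos L2_measurable[OF heat_L2[OF t fL]] this]
  show "heat t f \<in> Linf_space (leb H)" "Linf_norm (leb H) (heat t f) \<le> Linf_norm (leb H) f" .
qed

lemma heat_bounded_op_Linf:
  assumes t: "t \<ge> 0"
  shows "bounded_op (Linf_space (leb H)) (Linf_norm (leb H)) (heat t)"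
proof -
  have L2: "bounded_op (L2) (norm2) (heat t)"
    using heat_semigroup t by (simp add: C0_semigroup_def)
  note sub = Linf_subset_L2[OF H_pos]
  have "Linf_norm (leb H) (heat t (u + v) - (heat t u + heat t v)) = 0"
    if "u \<in> Linf_space (leb H)" "v \<in> Linf_space (leb H)" for u v
    using L2 sub[OF that(1)] sub[OF that(2)]
    by (intro Linf_norm_eq_0[OF H_pos] L2_diff L2_add heat_L2 t) (auto simp: bounded_op_def)
  moreover have "Linf_norm (leb H) (heat t (c *\<^sub>R u) - c *\<^sub>R heat t u) = 0"
    if "u \<in> Linf_space (leb H)" for c u
    using L2 sub[OF that]
    by (intro Linf_norm_eq_0[OF H_pos] L2_diff L2_scaleR heat_L2 t) (auto simp: bounded_op_def)
  ultimately show ?thesis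
    unfolding bounded_op_def using heat_Linf[OF t] by (auto intro!: exI[of _ 1])
qed

end

theorem theorem4:
  fixes H m m\<^sub>p \<nu> :: real
  assumes "H > 0" and "m > 0" and "m\<^sub>p > 0" and "\<nu> \<ge> 0"
  shows "\<exists>T :: real \<Rightarrow> state \<Rightarrow> state.
    generates (X_space H) (X_norm H) (A_dom H) (\<lambda>u. A_op H m m\<^sub>p u - \<nu> *\<^sub>R u) T \<and>
    (\<forall>u\<^sub>0 \<in> X_space H.
        C0_curve (X_space H) (X_norm H) {0..} (\<lambda>t. T t u\<^sub>0) \<and>
        C1_curve (X_space H) (X_norm H) {0<..} (\<lambda>t. T t u\<^sub>0)) \<and>
    (\<forall>t\<ge>0. \<forall>u\<^sub>0 \<in> Xinf_space H.
        T t u\<^sub>0 \<in> Xinf_space H \<and> Xinf_norm H (T t u\<^sub>0) \<le> Xinf_norm H u\<^sub>0) \<and>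
    (\<forall>t\<ge>0. bounded_op (Xinf_space H) (Xinf_norm H) (T t)) \<and>
    (\<forall>t\<ge>0. \<forall>\<epsilon>\<ge>0. \<forall>u\<^sub>0 \<in> X_eps H \<epsilon>. T t u\<^sub>0 \<in> X_eps H \<epsilon>)"
proof -
  interpret n: heat_problem H True \<nu> using assms by unfold_locales auto
  interpret p: heat_problem H False "\<nu> + m\<^sub>p" using assms by unfold_locales auto
  let ?L = "L2_space (leb H)" and ?N = "L2_norm (leb H)"
  let ?Li = "Linf_space (leb H)" and ?Ni = "Linf_norm (leb H)"
  have X: "X_space H = ?L \<times> ?L \<times> UNIV" by (simp add: X_space_def)
  have XN: "X_norm H = sum_norm ?N (sum_norm ?N abs)" by (auto simp: X_norm_def fun_eq_iff)
  have Xi: "Xinf_space H = ?Li \<times> ?Li \<times> UNIV" by (simp add: Xinf_space_def)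
  have XiN: "Xinf_norm H = sum_norm ?Ni (sum_norm ?Ni abs)" by (auto simp: Xinf_norm_def fun_eq_iff)
  have pos: "0 \<le> ?N f" "0 \<le> sum_norm ?N abs w" for f w by (auto simp: sum_norm_def split: prod.split)
  define T where "T = (\<lambda>t (a, b). (n.heat t a, (\<lambda>t (b, c). (p.heat t b, decay (\<nu> + m) t c)) t b))"
  have T_apply: "T t (a, b, c) = (n.heat t a, p.heat t b, decay (\<nu> + m) t c)" for t a b c
    by (simp add: T_def)
  have "C0_semigroup (X_space H) (X_norm H) T"
    unfolding X XN T_def
    by (intro C0_semigroup_prod n.heat_semigroup p.heat_semigroup decay_semigroup pos) auto
  moreover have "generator (X_space H) (X_norm H) T
    = {(u, v). u \<in> A_dom H \<and> v \<in> X_space H \<and> X_norm H (v - (A_op H m m\<^sub>p u - \<nu> *\<^sub>R u)) = 0}"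
  proof (intro set_eqI)
    fix w :: "state \<times> state"
    obtain a b c a' b' c' where w: "w = ((a, b, c), (a', b', c'))" by (metis prod_cases3 surj_pair)
    have "w \<in> generator (X_space H) (X_norm H) T \<longleftrightarrow> (a, a') \<in> generator ?L ?N n.heat
        \<and> (b, b') \<in> generator ?L ?N p.heat \<and> c' = - (\<nu> + m) * c"
      unfolding w X XN T_def generator_prod[OF pos] generator_prod[OF pos(1) abs_ge_zero] decay_generator ..
    also have "\<dots> \<longleftrightarrow> (a \<in> n.laplace_dom \<and> b \<in> p.laplace_dom) \<and> (a' \<in> ?L \<and> b' \<in> ?L)
        \<and> ?N (a' - (wderiv H (wderiv H a) - \<nu> *\<^sub>R a)) = 0
        \<and> ?N (b' - (wderiv H (wderiv H b) - (\<nu> + m\<^sub>p) *\<^sub>R b)) = 0 \<and> \<bar>c' - (- (\<nu> + m) * c)\<bar> = 0"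
      unfolding n.heat_generator p.heat_generator by auto
    also have "a \<in> n.laplace_dom \<and> b \<in> p.laplace_dom \<longleftrightarrow> (a, b, c) \<in> A_dom H"
      by (auto simp: n.laplace_dom_def p.laplace_dom_def A_dom_def)
    also have "a' \<in> ?L \<and> b' \<in> ?L \<longleftrightarrow> (a', b', c') \<in> X_space H" by (simp add: X)
    also have "?N (a' - (wderiv H (wderiv H a) - \<nu> *\<^sub>R a)) = 0
        \<and> ?N (b' - (wderiv H (wderiv H b) - (\<nu> + m\<^sub>p) *\<^sub>R b)) = 0 \<and> \<bar>c' - (- (\<nu> + m) * c)\<bar> = 0
      \<longleftrightarrow> X_norm H ((a', b', c') - (A_op H m m\<^sub>p (a, b, c) - \<nu> *\<^sub>R (a, b, c))) = 0"
    proof -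
      have b: "wderiv H (wderiv H b) - m\<^sub>p *\<^sub>R b - \<nu> *\<^sub>R b = wderiv H (wderiv H b) - (\<nu> + m\<^sub>p) *\<^sub>R b"
        by (simp add: scaleR_add_left)
      have c: "- m * c - \<nu> * c = - (\<nu> + m) * c" by (simp add: algebra_simps)
      have "X_norm H ((a', b', c') - (A_op H m m\<^sub>p (a, b, c) - \<nu> *\<^sub>R (a, b, c)))
        = ?N (a' - (wderiv H (wderiv H a) - \<nu> *\<^sub>R a))
          + (?N (b' - (wderiv H (wderiv H b) - (\<nu> + m\<^sub>p) *\<^sub>R b)) + \<bar>c' - (- (\<nu> + m) * c)\<bar>)"
        unfolding XN A_op_def scaleR_Pair diff_Pair prod.case sum_norm_apply b c real_scaleR_def ..
      then show ?thesis
        by (simp only: add_nonneg_eq_0_iff add_nonneg_nonneg L2_norm_nonneg abs_ge_zero)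
    qed
    finally show "w \<in> generator (X_space H) (X_norm H) T \<longleftrightarrow> w \<in> {(u, v). u \<in> A_dom H \<and> v \<in> X_space H
        \<and> X_norm H (v - (A_op H m m\<^sub>p u - \<nu> *\<^sub>R u)) = 0}"
      unfolding w by simp
  qed
  ultimately have gen: "generates (X_space H) (X_norm H) (A_dom H) (\<lambda>u. A_op H m m\<^sub>p u - \<nu> *\<^sub>R u) T"
    by (simp add: generates_def)
  have curves: "C0_curve (X_space H) (X_norm H) {0..} (\<lambda>t. T t u)
      \<and> C1_curve (X_space H) (X_norm H) {0<..} (\<lambda>t. T t u)" if uX: "u \<in> X_space H" for u
  proof -
    obtain a b c where u: "u = (a, b, c)" "a \<in> ?L" "b \<in> ?L" using uX by (auto simp: X)
    then show ?thesis
      unfolding u(1) T_apply X XN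
      by (intro conjI C0_curve_prod C1_curve_prod n.heat_C0_curve n.heat_C1_curve p.heat_C0_curve
          p.heat_C1_curve decay_C0_curve decay_C1_curve pos) auto
  qed
  have Linf: "T t u \<in> Xinf_space H \<and> Xinf_norm H (T t u) \<le> Xinf_norm H u"
    if t: "t \<ge> 0" and uX: "u \<in> Xinf_space H" for t u
  proof -
    obtain a b c where u: "u = (a, b, c)" "a \<in> ?Li" "b \<in> ?Li" using uX by (auto simp: Xi)
    have "\<bar>decay (\<nu> + m) t c\<bar> \<le> \<bar>c\<bar>" using assms t by (intro decay_le) auto
    then show ?thesis
      using n.heat_Linf[OF t u(2)] p.heat_Linf[OF t u(3)] unfolding u(1) T_apply Xi XiN by simp
  qed
  have bdd: "bounded_op (Xinf_space H) (Xinf_norm H) (T t)" if t: "t \<ge> 0" for t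
    unfolding Xi XiN T_def
    by (intro bounded_op_prod n.heat_bounded_op_Linf p.heat_bounded_op_Linf decay_bounded_op t)
       (auto simp: Linf_AE_le(1)[OF assms(1)])
  have eps: "T t u \<in> X_eps H \<epsilon>" if t: "t \<ge> 0" and e: "\<epsilon> \<ge> 0" and uX: "u \<in> X_eps H \<epsilon>" for t \<epsilon> u
  proof -
    obtain a b c where u: "u = (a, b, c)" by (metis prod_cases3)
    have L: "a \<in> ?L" "b \<in> ?L" and ae: "AE h in leb H. 0 \<le> (a + \<epsilon> *\<^sub>R indicator {0..H}) h"
      "AE h in leb H. 0 \<le> b h" and c: "0 \<le> c"
      using uX by (auto simp: u X_eps_def X_plus_def X_space_def)
    have i: "indicator {0..H} \<in> ?L"
    proof (rule L2_bounded[of _ _ 1])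
      show "indicator {0..H} \<in> borel_measurable (leb H)"
        by (intro measurable_restrict_space1 borel_measurable_indicator) simp
    qed (auto simp: indicator_def)
    have ind: "AE h in leb H. (indicator {0..H} h :: real) = 1" by (rule AE_leb_all) auto
    have "AE h in leb H. - \<epsilon> \<le> a h" using ae(1) ind by eventually_elim simp
    from n.heat_ge[OF t L(1) this] e have "AE h in leb H. - \<epsilon> \<le> n.heat t a h" by simp
    then have "AE h in leb H. 0 \<le> (n.heat t a + \<epsilon> *\<^sub>R indicator {0..H}) h"
      using ind by eventually_elim simp
    moreover have "AE h in leb H. 0 \<le> p.heat t b h" using p.heat_ge[OF t L(2) ae(2)] by simp
    moreover have "0 \<le> decay (\<nu> + m) t c" using c by (simp add: decay_def)
    moreover have "n.heat t a \<in> ?L" "p.heat t b \<in> ?L" by (intro n.heat_L2 p.heat_L2 t L)+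
    moreover from this have "n.heat t a + \<epsilon> *\<^sub>R indicator {0..H} \<in> ?L" by (intro L2_add L2_scaleR i)
    ultimately show ?thesis by (simp add: u T_apply X_eps_def X_plus_def X_space_def)
  qed
  show ?thesis
    by (intro exI[of _ T] conjI ballI allI impI gen)
       (use curves Linf bdd eps in blast)+
qed

end
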